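(* Let $m\ge1$ be an integer, $p$ a prime, $0<\varepsilon<1$, and $S$ a matrix as in the context with $s_{0,1}s_{1,2}\cdots s_{m-1,m}\ne0$. Let $\mathcal F_k=\{F_{k,0},\ldots,F_{k,m}\}\in\mathfrak F(S,m)$, $k=1,2,\ldots$, be a sequence of (not necessarily distinct) permutation polynomial systems over $\mathbb F_p$. For $\mathbf v\in\mathbb F_p^{m+1}$ let $(u_{n,0}(\mathbf v),\ldots,u_{n,m}(\mathbf v))$, $n\ge0$, be the sequence with initial value $(u_{0,0}(\mathbf v),\ldots,u_{0,m}(\mathbf v))=\mathbf v$ and $$u_{n+1,i}(\mathbf v)\equiv F_{n+1,i}\big(u_{n,0}(\mathbf v),\ldots,u_{n,m}(\mathbf v)\big)\pmod p,\qquad 0\le u_{n,i}(\mathbf v)<p,\qquad i=0,\ldots,m.$$ Then for all initial values $\mathbf v\in\mathbb F_p^{m+1}$ except at most $O(\varepsilon p^{m+1})$, and any positive integer $N\le p^{m+1}$, the discrepancy $D_N(\mathbf v)$ of the sequence $$\left(\frac{u_{n,0}(\mathbf v)}p,\ldots,\frac{u_{n,m-1}(\mathbf v)}p\right),\qquad n=0,\ldots,N-1,$$ satisfies the bound $D_N(\mathbf v)\ll\varepsilon^{-1}C(N,p)$, where $$C(N,p)=\begin{cases}N^{-1/2}(\log N)^{m+1}\log p&\text{if }N\le p^{1/(m+1)},\\ p^{-1/(2(m+1))}(\log N)^{m+1}\log p&\text{if }N>p^{1/(m+1)},\end{cases}$$ and the implied constants may depend only on $S$ and $m$.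
   Context: The discrepancy of a sequence $\Gamma$ of $N$ points in $[0,1)^s$ is $$\Delta(\Gamma)=\sup_{B\subseteq[0,1)^s}\left|\frac{T_\Gamma(B)}N-|B|\right|,$$ where the supremum is over all boxes $B=[\alpha_1,\beta_1)\times\cdots\times[\alpha_s,\beta_s)\subseteq[0,1)^s$, $|B|$ is the volume of $B$, and $T_\Gamma(B)$ is the number of points of $\Gamma$ (counted with multiplicity) inside $B$. $\mathbb F_p$ is represented by $\{0,1,\ldots,p-1\}$. $A\ll B$ and $A=O(B)$ mean $|A|\le cB$ for some constant $c>0$. $S$ is an integral upper triangular $(m+1)\times(m+1)$ matrix, rows and columns indexed by $0,\ldots,m$, with ones on the diagonal and entries $s_{i,j}$ for $0\le i<j\le m$ (used as exponents, hence non-negative). $\mathfrak F(S,m)$ is the set of all systems $\{F_0,\ldots,F_m\}$ of polynomials in $\mathbb F_p[X_0,\ldots,X_m]$ of the form $$F_i=X_iG_i(X_{i+1},\ldots,X_m)+H_i(X_{i+1},\ldots,X_m)\quad (0\le i\le m-1),\qquad F_m=g_mX_m+h_m,$$ with $g_m,h_m\in\mathbb F_p$, $g_m\ne0$, $G_i,H_i\in\mathbb F_p[X_{i+1},\ldots,X_m]$, where for $0\le i\le m-1$ $$G_i=g_iX_{i+1}^{s_{i,i+1}}\cdots X_m^{s_{i,m}}+\widetilde G_i,\qquad g_i\in\mathbb F_p^*,$$ and $\deg_{X_j}\widetilde G_i<s_{i,j}$, $\deg_{X_j}H_i\le s_{i,j}$ for $j=i+1,\ldots,m$ (the zero polynomial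 has degree $-\infty$). A system $\{F_0,\ldots,F_m\}$ is a permutation polynomial system if the map $\mathbf w\mapsto(F_0(\mathbf w),\ldots,F_m(\mathbf w))$ is a bijection of $\mathbb F_p^{m+1}$.
   Formalization: The bound is stated for 2 ≤ N ≤ p^(m+1) rather than every positive integer N, because at N = 1 the bound C(1,p) is 0 (log 1 = 0) while the discrepancy of a single point is 1. *)

theory Defs
  imports
    "HOL-Analysis.Analysis"
    "HOL-Library.Poly_Mapping"
    "HOL-Library.FuncSet"
    "HOL-Computational_Algebra.Primes"
    "Jordan_Normal_Form.Matrix"
begin

section \<open>Polynomials in several variables over the prime field\<close>

text \<open>
  The prime \<open>p\<close> has to be quantified inside the main statement (the implied constants do not
  depend on it), so the prime field cannot be a type depending on \<open>p\<close>.
  Its elements are represented by the integers \<open>0, \<dots>, p - 1\<close>. A polynomial is a finitely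
  supported map from exponent vectors to its coefficients in this range; the ring operations are
  those of integer polynomials followed by reduction of the coefficients.
\<close>

type_synonym int_mpoly = "(nat \<Rightarrow>\<^sub>0 nat) \<Rightarrow>\<^sub>0 int"

definition Fp :: "nat \<Rightarrow> int set" where
  "Fp p = {0..<int p}"

definition Fp_units :: "nat \<Rightarrow> int set" where
  "Fp_units p = Fp p - {0}"

text \<open>\<open>Fp_poly p V\<close> is the polynomial ring over the prime field in the variables with index
  in \<open>V\<close>.\<close>

definition Fp_poly :: "nat \<Rightarrow> nat set \<Rightarrow> int_mpoly set" where
  "Fp_poly p V = {P. \<forall>t. Poly_Mapping.lookup P t \<in> Fp p \<and>
                         (t \<in> Poly_Mapping.keys P \<longrightarrow> Poly_Mapping.keys t \<subseteq> V)}"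

definition reduce :: "nat \<Rightarrow> int_mpoly \<Rightarrow> int_mpoly" where
  "reduce p P = Poly_Mapping.map (\<lambda>c. c mod int p) P"

definition mvar :: "nat \<Rightarrow> int_mpoly" where
  "mvar i = Poly_Mapping.single (Poly_Mapping.single i 1) 1"

definition mconst :: "int \<Rightarrow> int_mpoly" where
  "mconst c = Poly_Mapping.single 0 c"

definition poly_eval :: "nat \<Rightarrow> int_mpoly \<Rightarrow> (nat \<Rightarrow> int) \<Rightarrow> int" where
  "poly_eval p P w =
     (\<Sum>t\<in>Poly_Mapping.keys P. Poly_Mapping.lookup P t *
        (\<Prod>j\<in>Poly_Mapping.keys t. w j ^ Poly_Mapping.lookup t j)) mod int p"

text \<open>Degree in one variable; the supremum of the empty set gives the zero polynomial the
  degree \<open>-\<infinity>\<close>. This matters below: if an exponent \<open>S $$ (i, j)\<close> is zero, the strict bound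
  forces the polynomial to vanish.\<close>

definition deg_in :: "nat \<Rightarrow> int_mpoly \<Rightarrow> ereal" where
  "deg_in j P = (SUP t\<in>Poly_Mapping.keys P. ereal (real (Poly_Mapping.lookup t j)))"


section \<open>Triangular polynomial systems\<close>

definition poly_systems :: "nat \<Rightarrow> nat mat \<Rightarrow> nat \<Rightarrow> (nat \<Rightarrow> int_mpoly) set" where
  "poly_systems p S m = {F.
     (\<forall>i<m. \<exists>g\<in>Fp_units p. \<exists>G\<in>Fp_poly p {i<..m}. \<exists>G'\<in>Fp_poly p {i<..m}. \<exists>H\<in>Fp_poly p {i<..m}.
        F i = reduce p (mvar i * G + H) \<and>
        G = reduce p (mconst g * (\<Prod>j\<in>{i<..m}. mvar j ^ (S $$ (i, j))) + G') \<and>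
        (\<forall>j\<in>{i<..m}. deg_in j G' < ereal (real (S $$ (i, j))) \<and>
                      deg_in j H \<le> ereal (real (S $$ (i, j))))) \<and>
     (\<exists>g\<in>Fp_units p. \<exists>h\<in>Fp p. F m = reduce p (mconst g * mvar m + mconst h))}"

definition Fp_vectors :: "nat \<Rightarrow> nat \<Rightarrow> (nat \<Rightarrow> int) set" where
  "Fp_vectors p m = {..m} \<rightarrow>\<^sub>E Fp p"

definition system_map :: "nat \<Rightarrow> nat \<Rightarrow> (nat \<Rightarrow> int_mpoly) \<Rightarrow> (nat \<Rightarrow> int) \<Rightarrow> (nat \<Rightarrow> int)" where
  "system_map p m F w = (\<lambda>i\<in>{..m}. poly_eval p (F i) w)"

definition permutation_system :: "nat \<Rightarrow> nat \<Rightarrow> (nat \<Rightarrow> int_mpoly) \<Rightarrow> bool" where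
  "permutation_system p m F \<longleftrightarrow>
     bij_betw (system_map p m F) (Fp_vectors p m) (Fp_vectors p m)"

text \<open>The systems are numbered from 1; the entry \<open>F 0\<close> of a sequence is never used.\<close>

primrec orbit ::
  "nat \<Rightarrow> nat \<Rightarrow> (nat \<Rightarrow> nat \<Rightarrow> int_mpoly) \<Rightarrow> (nat \<Rightarrow> int) \<Rightarrow> nat \<Rightarrow> (nat \<Rightarrow> int)" where
  "orbit p m F v 0 = v"
| "orbit p m F v (Suc n) = system_map p m (F (Suc n)) (orbit p m F v n)"


section \<open>Discrepancy\<close>

text \<open>\<open>discrepancy s N x\<close> is the discrepancy of the points \<open>x 0, \<dots>, x (N - 1)\<close>, whose
  coordinates have the indices \<open>0, \<dots>, s - 1\<close>. Counting the indices \<open>n < N\<close> counts the points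
  with multiplicity.\<close>

definition discrepancy :: "nat \<Rightarrow> nat \<Rightarrow> (nat \<Rightarrow> nat \<Rightarrow> real) \<Rightarrow> real" where
  "discrepancy s N x =
     (SUP (\<alpha>, \<beta>) \<in> {(\<alpha>, \<beta>). \<forall>i<s. 0 \<le> \<alpha> i \<and> \<alpha> i \<le> \<beta> i \<and> \<beta> i \<le> (1::real)}.
        \<bar>real (card {n. n < N \<and> (\<forall>i<s. x n i \<in> {\<alpha> i..<\<beta> i})}) / real N
          - (\<Prod>i<s. \<beta> i - \<alpha> i)\<bar>)"

text \<open>Since \<open>ln 1 = 0\<close>, this is meaningful as a bound only for \<open>N \<ge> 2\<close>: the discrepancy of a
  single point is 1.\<close>

definition disc_bound :: "nat \<Rightarrow> nat \<Rightarrow> nat \<Rightarrow> real" where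
  "disc_bound m N p =
     (if real N \<le> real p powr (1 / real (m + 1))
      then real N powr (- 1 / 2) * ln (real N) ^ (m + 1) * ln (real p)
      else real p powr (- 1 / (2 * real (m + 1))) * ln (real N) ^ (m + 1) * ln (real p))"

end

theory Submission
  imports Defs "HOL-Number_Theory.Cong" "HOL-Computational_Algebra.Polynomial"
begin

text \<open>
  Two ideas carry the proof: an arithmetic one that controls pairs of points of an orbit, and a
  second moment that needs nothing but pairs.

  Arithmetic. When the coordinates above \<open>i\<close> are fixed, every step acts on coordinate \<open>i\<close> by an
  affine map, so \<open>k\<close> steps act by \<open>w i \<mapsto> M * w i + R\<close>, where the multiplier \<open>M\<close> is the product of the
  values of the polynomials \<open>G\<^sub>i\<close> along the orbit (\<open>orbit_affine\<close>). The displacement after \<open>k\<close> steps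
  is \<open>(M - 1) * w i + R\<close>. Wherever no multiplier with \<open>i < m\<close> equals 1, the displacements of the
  coordinates \<open>0, \<dots>, m - 1\<close> and the value of the last coordinate determine the state, from the
  top coordinate downwards; so every displacement vector is attained at most \<open>p\<close> times
  (\<open>card_displacement_fibre\<close>). The multiplier is rarely 1: the coefficient of the highest power of
  \<open>X\<^sub>i\<^sub>+\<^sub>1\<close> in \<open>G\<^sub>i\<close> is a monomial in the later variables, hence \<open>M\<close> is a polynomial in \<open>X\<^sub>i\<^sub>+\<^sub>1\<close> of
  degree exactly \<open>k * s\<^sub>i\<^sub>,\<^sub>i\<^sub>+\<^sub>1 > 0\<close> unless some state on the way is degenerate, and degenerate states
  can be counted one step at a time because the steps are bijections. This gives
  \<open>O(k * p ^ m)\<close> exceptional states out of \<open>p ^ (m + 1)\<close> (\<open>card_unit_multiplier\<close>).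

  Second moment. Translate a box by a uniformly distributed vector modulo \<open>p\<close>. The mean over the
  translations of the squared deviation of the number of points in the box depends only on the
  differences of pairs of points, and pairs with uniformly distributed differences contribute nothing
  beyond the square of the expected number. So the variance has the size it has for independent points
  (\<open>second_moment_box\<close>). An interval of residues and an initial segment of times are signed sums of
  logarithmically many dyadic cells, and the largest deviation over the cells of one level is at
  most the square root of the sum of the squares over that level, whose mean is \<open>O(2 ^ J)\<close> for
  \<open>2 ^ J\<close> points (\<open>box_count_le_energy\<close>, \<open>sum_energy\<close>). The cells depend neither
  on the box nor on the length of the segment, so the bound is uniform in both; averaging it over
  translations and initial values gives \<open>mean_maximal_discrepancy\<close>: \<open>m\<close> logarithmic factors come from space, one from time.

  The exceptional states are negligible for segments of length at most \<open>sqrt p\<close>, in particular for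
  blocks of length about \<open>p\<^sup>1\<^sup>/\<^sup>(\<^sup>m\<^sup>+\<^sup>1\<^sup>)\<close>; longer segments are cut into such blocks
  (\<open>blocks_discrepancy\<close>). Markov's inequality at
  each of the \<open>O(log p)\<close> dyadic scales of \<open>N\<close> produces the exceptional set and the factor
  \<open>\<epsilon>\<^sup>-\<^sup>1 log p\<close> (\<open>exceptional_set\<close>).
\<close>

section \<open>Evaluation of polynomials over the prime field\<close>

lemma finite_Fp [simp]: "finite (Fp p)" and card_Fp [simp]: "card (Fp p) = p"
  by (simp_all add: Fp_def)

definition monomial_value :: "(nat \<Rightarrow> int) \<Rightarrow> (nat \<Rightarrow>\<^sub>0 nat) \<Rightarrow> int" where
  "monomial_value w t = (\<Prod>j\<in>Poly_Mapping.keys t. w j ^ Poly_Mapping.lookup t j)"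

text \<open>
  Evaluation over the integers, before reduction modulo \<open>p\<close>: it is exactly additive and
  multiplicative, so that congruences enter only through the reduction of coefficients.
\<close>

definition int_eval :: "(nat \<Rightarrow> int) \<Rightarrow> int_mpoly \<Rightarrow> int" where
  "int_eval w P = (\<Sum>t\<in>Poly_Mapping.keys P. Poly_Mapping.lookup P t * monomial_value w t)"

lemma poly_eval_int_eval: "poly_eval p P w = int_eval w P mod int p"
  by (simp add: poly_eval_def int_eval_def monomial_value_def)

lemma monomial_value_superset:
  assumes "finite K" "Poly_Mapping.keys t \<subseteq> K"
  shows "monomial_value w t = (\<Prod>j\<in>K. w j ^ Poly_Mapping.lookup t j)"
  unfolding monomial_value_def using assms
  by (intro prod.mono_neutral_left) (auto simp: in_keys_iff)

lemma monomial_value_add: "monomial_value w (s + t) = monomial_value w s * monomial_value w t"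
proof -
  let ?K = "Poly_Mapping.keys s \<union> Poly_Mapping.keys t"
  have "Poly_Mapping.keys (s + t) \<subseteq> ?K"
    by (rule Poly_Mapping.keys_add)
  then show ?thesis
    by (simp add: monomial_value_superset[where K = ?K] lookup_add power_add prod.distrib)
qed

lemma int_eval_superset:
  assumes "finite K" "Poly_Mapping.keys P \<subseteq> K"
  shows "int_eval w P = (\<Sum>t\<in>K. Poly_Mapping.lookup P t * monomial_value w t)"
  unfolding int_eval_def using assms
  by (intro sum.mono_neutral_left) (auto simp: in_keys_iff)

lemma int_eval_add: "int_eval w (P + Q) = int_eval w P + int_eval w Q"
proof -
  let ?K = "Poly_Mapping.keys P \<union> Poly_Mapping.keys Q"
  have "Poly_Mapping.keys (P + Q) \<subseteq> ?K"
    by (rule Poly_Mapping.keys_add)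
  then show ?thesis
    by (simp add: int_eval_superset[where K = ?K] lookup_add algebra_simps sum.distrib)
qed

lemma int_eval_diff: "int_eval w (P - Q) = int_eval w P - int_eval w Q"
  using int_eval_add[of w "P - Q" Q] by simp

lemma int_eval_single: "int_eval w (Poly_Mapping.single t c) = c * monomial_value w t"
  by (simp add: int_eval_superset[where K = "{t}"])

text \<open>
  Every product in a triangular system has a monomial as one factor, so multiplicativity in this
  case is enough. Integer polynomials form the free abelian group on the monomials, which reduces
  the claim to a product of two monomials.
\<close>

lemma int_eval_single_mult:
  "int_eval w (Poly_Mapping.single t c * P) = c * monomial_value w t * int_eval w P"
proof -
  have "Poly_Mapping.keys P \<subseteq> UNIV" by simp
  then show ?thesis
  proof (induction P rule: frag_induction)
    case zero
    then show ?case by (simp add: int_eval_def)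
  next
    case (one x)
    then show ?case by (simp add: mult_single int_eval_single monomial_value_add)
  next
    case (diff a b)
    then show ?case by (simp add: int_eval_diff right_diff_distrib)
  qed
qed

lemma int_eval_mvar_mult: "int_eval w (mvar i * P) = w i * int_eval w P"
  by (simp add: mvar_def int_eval_single_mult monomial_value_def)

lemma int_eval_mconst_mult: "int_eval w (mconst c * P) = c * int_eval w P"
  by (simp add: mconst_def int_eval_single_mult monomial_value_def)

lemma int_eval_mconst: "int_eval w (mconst c) = c"
  by (simp add: mconst_def int_eval_single monomial_value_def)

lemma int_eval_mvar: "int_eval w (mvar i) = w i"
  by (simp add: mvar_def int_eval_single monomial_value_def)

lemma int_eval_mvar_power_mult: "int_eval w (mvar i ^ e * P) = w i ^ e * int_eval w P"
  by (induction e) (simp_all add: int_eval_mvar_mult mult.assoc)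

lemma int_eval_power_product:
  "finite A \<Longrightarrow> int_eval w (\<Prod>j\<in>A. mvar j ^ e j) = (\<Prod>j\<in>A. w j ^ e j)"
proof (induction A rule: finite_induct)
  case empty
  have "int_eval w (mconst 1) = 1" by (rule int_eval_mconst)
  then show ?case by (simp add: mconst_def)
next
  case (insert x A)
  then show ?case by (simp add: int_eval_mvar_power_mult)
qed

lemma int_eval_reduce: "[int_eval w (reduce p P) = int_eval w P] (mod int p)"
proof -
  have lookup: "Poly_Mapping.lookup (reduce p P) t = Poly_Mapping.lookup P t mod int p" for t
    by (simp add: reduce_def Poly_Mapping.map.rep_eq when_def)
  have "Poly_Mapping.keys (reduce p P) \<subseteq> Poly_Mapping.keys P"
    by (auto simp: in_keys_iff lookup)
  then have "int_eval w (reduce p P) =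
      (\<Sum>t\<in>Poly_Mapping.keys P. (Poly_Mapping.lookup P t mod int p) * monomial_value w t)"
    by (simp add: int_eval_superset[where K = "Poly_Mapping.keys P"] lookup)
  also have "[\<dots> = int_eval w P] (mod int p)"
    unfolding int_eval_def by (intro cong_sum cong_scalar_right) (simp add: cong_def)
  finally show ?thesis .
qed

lemma int_eval_cong:
  assumes "P \<in> Fp_poly p V" "\<And>j. j \<in> V \<Longrightarrow> w j = w' j"
  shows "int_eval w P = int_eval w' P"
proof -
  have "monomial_value w t = monomial_value w' t" if "t \<in> Poly_Mapping.keys P" for t
    unfolding monomial_value_def
  proof (rule prod.cong[OF refl])
    fix j assume "j \<in> Poly_Mapping.keys t"
    with that assms(1) have "j \<in> V" by (auto simp: Fp_poly_def)
    then show "w j ^ Poly_Mapping.lookup t j = w' j ^ Poly_Mapping.lookup t j"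
      using assms(2) by simp
  qed
  then show ?thesis by (simp add: int_eval_def)
qed

lemma lookup_less_of_deg_in_less:
  assumes "deg_in j P < ereal (real d)" "t \<in> Poly_Mapping.keys P"
  shows "Poly_Mapping.lookup t j < d"
proof -
  have "ereal (real (Poly_Mapping.lookup t j)) \<le> deg_in j P"
    unfolding deg_in_def using assms(2) by (rule SUP_upper)
  with assms(1) have "ereal (real (Poly_Mapping.lookup t j)) < ereal (real d)"
    by (rule order.strict_trans1[rotated])
  then show ?thesis by simp
qed

text \<open>
  Restriction of a polynomial to a line parallel to a coordinate axis. The alternative
  \<open>Q = 0\<close> covers \<open>d = 0\<close>, where the bound on the exponents forces \<open>P = 0\<close>.
\<close>

lemma int_eval_as_univariate:
  assumes "\<And>t. t \<in> Poly_Mapping.keys P \<Longrightarrow> Poly_Mapping.lookup t j < d"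
  obtains Q :: "int poly" where "Q = 0 \<or> degree Q < d" "\<And>x. int_eval (w(j := x)) P = poly Q x"
proof
  define co where "co t = Poly_Mapping.lookup P t *
      (\<Prod>i\<in>Poly_Mapping.keys t - {j}. w i ^ Poly_Mapping.lookup t i)" for t
  define Q where "Q = (\<Sum>t\<in>Poly_Mapping.keys P. monom (co t) (Poly_Mapping.lookup t j))"
  show "Q = 0 \<or> degree Q < d"
  proof (cases "d = 0")
    case True
    with assms have "Poly_Mapping.keys P = {}" by (metis all_not_in_conv not_less_zero)
    then show ?thesis by (simp add: Q_def)
  next
    case False
    have "degree Q < d" unfolding Q_def
      using False assms by (intro degree_sum_less) (auto intro: order.strict_trans1[OF degree_monom_le])
    then show ?thesis ..
  qed
  show "int_eval (w(j := x)) P = poly Q x" for x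
  proof -
    have "monomial_value (w(j := x)) t =
        x ^ Poly_Mapping.lookup t j *
        (\<Prod>i\<in>Poly_Mapping.keys t - {j}. w i ^ Poly_Mapping.lookup t i)" for t
    proof -
      have "monomial_value (w(j := x)) t =
          (\<Prod>i\<in>insert j (Poly_Mapping.keys t - {j}). (w(j := x)) i ^ Poly_Mapping.lookup t i)"
        by (rule monomial_value_superset) auto
      also have "\<dots> = x ^ Poly_Mapping.lookup t j *
          (\<Prod>i\<in>Poly_Mapping.keys t - {j}. (w(j := x)) i ^ Poly_Mapping.lookup t i)"
        by (subst prod.insert) auto
      also have "(\<Prod>i\<in>Poly_Mapping.keys t - {j}. (w(j := x)) i ^ Poly_Mapping.lookup t i) =
          (\<Prod>i\<in>Poly_Mapping.keys t - {j}. w i ^ Poly_Mapping.lookup t i)"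
        by (intro prod.cong) auto
      finally show ?thesis .
    qed
    then show ?thesis
      by (simp add: int_eval_def Q_def poly_sum poly_monom co_def algebra_simps)
  qed
qed

text \<open>
  The leading coefficient is a unit modulo \<open>p\<close>, and this is inherited by the quotient by a linear
  factor; a root modulo \<open>p\<close> leaves the integer remainder \<open>poly P a\<close>, which vanishes modulo \<open>p\<close>.
\<close>

lemma card_roots_mod_prime:
  fixes P :: "int poly"
  assumes "prime p" "\<not> int p dvd lead_coeff P"
  shows "card {x \<in> Fp p. int p dvd poly P x} \<le> degree P"
  using assms(2)
proof (induction "degree P" arbitrary: P)
  case 0
  then obtain c where "P = [:c:]" by (metis degree_eq_zeroE)
  with 0 have "{x \<in> Fp p. int p dvd poly P x} = {}" by auto
  then show ?case by (metis card.empty le0)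
next
  case (Suc n)
  show ?case
  proof (cases "{x \<in> Fp p. int p dvd poly P x} = {}")
    case True
    show ?thesis unfolding True by simp
  next
    case False
    then obtain a where a: "a \<in> Fp p" "int p dvd poly P a" by auto
    define Q where "Q = synthetic_div P a"
    have P: "P = [:- a, 1:] * Q + [:poly P a:]"
      unfolding Q_def by (rule synthetic_div_correct'[symmetric])
    have degQ: "degree Q = n"
      using Suc(2) by (simp add: Q_def degree_synthetic_div)
    have "Q \<noteq> 0"
      using P Suc(2) by (metis degree_pCons_0 add_0 mult_zero_right nat.distinct(1))
    then have "degree ([:- a, 1:] * Q) = Suc n"
      using degree_mult_eq[of "[:- a, 1:]" Q] degQ by (simp del: mult_pCons_left)
    then have "lead_coeff P = lead_coeff ([:- a, 1:] * Q)"
      by (metis P degree_pCons_0 lead_coeff_add_le add.commute zero_less_Suc)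
    also have "\<dots> = lead_coeff Q"
      by (simp add: lead_coeff_mult del: mult_pCons_left)
    finally have lead: "\<not> int p dvd lead_coeff Q"
      using Suc.prems by simp
    have "{x \<in> Fp p. int p dvd poly P x} \<subseteq> insert a {x \<in> Fp p. int p dvd poly Q x}"
    proof
      fix x assume x: "x \<in> {x \<in> Fp p. int p dvd poly P x}"
      have "poly P x = (x - a) * poly Q x + poly P a"
        by (subst P) (simp add: algebra_simps)
      with x a(2) have "int p dvd (x - a) * poly Q x"
        by (metis (no_types, lifting) dvd_add_left_iff mem_Collect_eq)
      with assms(1) have "int p dvd x - a \<or> int p dvd poly Q x"
        by (simp add: prime_dvd_mult_iff)
      moreover have "x = a" if "int p dvd x - a"
        using that x a(1) by (auto simp: Fp_def mod_eq_dvd_iff[symmetric])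
      ultimately show "x \<in> insert a {x \<in> Fp p. int p dvd poly Q x}"
        using x by auto
    qed
    then have "card {x \<in> Fp p. int p dvd poly P x} \<le> card (insert a {x \<in> Fp p. int p dvd poly Q x})"
      by (intro card_mono) auto
    also have "\<dots> \<le> Suc (card {x \<in> Fp p. int p dvd poly Q x})"
      by (rule card_insert_le_m1) auto
    also have "\<dots> \<le> degree P"
      using Suc(1)[of Q] degQ lead Suc(2) by auto
    finally show ?thesis .
  qed
qed

text \<open>
  All that is used of one step of a triangular system, in terms of values instead of polynomials:
  the step is affine in each coordinate with coefficients that depend on the later coordinates only,
  the multiplier \<open>G m\<close> of the last coordinate is a unit, and on a line in direction \<open>Suc i\<close> along which
  all later coordinates are units the multiplier \<open>G i\<close> is a polynomial of exact degree \<open>s i\<close>.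
\<close>

definition triangular_step ::
  "nat \<Rightarrow> nat \<Rightarrow> (nat \<Rightarrow> nat) \<Rightarrow> ((nat \<Rightarrow> int) \<Rightarrow> nat \<Rightarrow> int) \<Rightarrow>
   (nat \<Rightarrow> (nat \<Rightarrow> int) \<Rightarrow> int) \<Rightarrow> (nat \<Rightarrow> (nat \<Rightarrow> int) \<Rightarrow> int) \<Rightarrow> bool" where
  "triangular_step p m s f G H \<longleftrightarrow>
     (\<forall>i\<le>m. \<forall>w. [f w i = w i * G i w + H i w] (mod int p)) \<and>
     (\<forall>i\<le>m. \<forall>w w'. (\<forall>j\<in>{i<..m}. w j = w' j) \<longrightarrow> G i w = G i w' \<and> H i w = H i w') \<and>
     (\<forall>w. \<not> int p dvd G m w) \<and>
     (\<forall>i<m. \<forall>w. (\<forall>j\<in>{Suc i<..m}. \<not> int p dvd w j) \<longrightarrow>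
        (\<exists>P. degree P = s i \<and> \<not> int p dvd lead_coeff P \<and>
             (\<forall>x. [G i (w(Suc i := x)) = poly P x] (mod int p))))"

lemma not_dvd_of_Fp_units: "g \<in> Fp_units p \<Longrightarrow> \<not> int p dvd g"
  by (auto simp: Fp_units_def Fp_def zdvd_not_zless)

text \<open>
  Since \<open>G'\<close> has smaller degree in the variable \<open>Suc i\<close>, the coefficient of the highest power of
  that variable is the monomial \<open>c\<close> in the later variables alone, and so it is a unit.
\<close>

lemma leading_form_restriction:
  assumes p: "prime p" and i: "i < m" and g: "g \<in> Fp_units p"
    and G: "G = reduce p (mconst g * (\<Prod>j\<in>{i<..m}. mvar j ^ e j) + G')"
    and deg: "deg_in (Suc i) G' < ereal (real (e (Suc i)))"
    and w: "\<forall>j\<in>{Suc i<..m}. \<not> int p dvd w j"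
  shows "\<exists>P. degree P = e (Suc i) \<and> \<not> int p dvd lead_coeff P \<and>
             (\<forall>x. [int_eval (w(Suc i := x)) G = poly P x] (mod int p))"
proof -
  obtain Q :: "int poly" where Q: "Q = 0 \<or> degree Q < e (Suc i)"
      "\<And>x. int_eval (w(Suc i := x)) G' = poly Q x"
    using int_eval_as_univariate[OF lookup_less_of_deg_in_less[OF deg]] by blast
  define c where "c = g * (\<Prod>j\<in>{Suc i<..m}. w j ^ e j)"
  have split: "{i<..m} = insert (Suc i) {Suc i<..m}" using i by auto
  have c: "\<not> int p dvd c"
    using p not_dvd_of_Fp_units[OF g] w prime_dvd_power[of "int p"]
    by (auto simp: c_def prime_dvd_mult_iff prime_dvd_prod_iff)
  then have c0: "c \<noteq> 0" by auto
  define P where "P = monom c (e (Suc i)) + Q"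
  have "degree P = e (Suc i) \<and> lead_coeff P = c"
  proof (cases "Q = 0")
    case True
    then show ?thesis using c0 by (simp add: P_def degree_monom_eq)
  next
    case False
    with Q have "degree Q < degree (monom c (e (Suc i)))"
      using c0 by (simp add: degree_monom_eq)
    then show ?thesis using c0 coeff_eq_0[of Q "e (Suc i)"]
      by (simp add: P_def degree_add_eq_left degree_monom_eq)
  qed
  moreover have "[int_eval (w(Suc i := x)) G = poly P x] (mod int p)" for x
  proof -
    let ?w = "w(Suc i := x)"
    have "[int_eval ?w G = int_eval ?w (mconst g * (\<Prod>j\<in>{i<..m}. mvar j ^ e j) + G')] (mod int p)"
      unfolding G by (rule int_eval_reduce)
    also have "int_eval ?w (mconst g * (\<Prod>j\<in>{i<..m}. mvar j ^ e j) + G') =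
        g * (\<Prod>j\<in>{i<..m}. ?w j ^ e j) + poly Q x"
      by (simp add: int_eval_add int_eval_mconst_mult int_eval_power_product Q(2) del: fun_upd_apply)
    also have "(\<Prod>j\<in>{i<..m}. ?w j ^ e j) = x ^ e (Suc i) * (\<Prod>j\<in>{Suc i<..m}. w j ^ e j)"
      unfolding split by (subst prod.insert) (auto intro!: prod.cong)
    also have "g * (x ^ e (Suc i) * (\<Prod>j\<in>{Suc i<..m}. w j ^ e j)) + poly Q x = poly P x"
      by (simp add: P_def poly_monom c_def)
    finally show ?thesis .
  qed
  ultimately show ?thesis using c by auto
qed

lemma poly_systems_triangular_step:
  assumes p: "prime p" and F: "F \<in> poly_systems p S m"
  shows "\<exists>G H. triangular_step p m (\<lambda>i. S $$ (i, Suc i)) (system_map p m F) G H"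
proof -
  obtain gm hm where m: "gm \<in> Fp_units p" "F m = reduce p (mconst gm * mvar m + mconst hm)"
    using F by (auto simp: poly_systems_def)
  define R where "R i G H \<longleftrightarrow> (\<forall>w. [system_map p m F w i = w i * G w + H w] (mod int p)) \<and>
      (\<forall>w w'. (\<forall>j\<in>{i<..m}. w j = w' j) \<longrightarrow> G w = G w' \<and> H w = H w') \<and>
      (i = m \<longrightarrow> (\<forall>w. \<not> int p dvd G w)) \<and>
      (i < m \<longrightarrow> (\<forall>w. (\<forall>j\<in>{Suc i<..m}. \<not> int p dvd w j) \<longrightarrow>
        (\<exists>P. degree P = S $$ (i, Suc i) \<and> \<not> int p dvd lead_coeff P \<and>
             (\<forall>x. [G (w(Suc i := x)) = poly P x] (mod int p)))))" for i G H
  have "\<exists>G H. R i G H" if "i \<le> m" for i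
  proof (cases "i = m")
    case True
    have "[system_map p m F w i = w i * gm + hm] (mod int p)" for w
    proof -
      have "[system_map p m F w i = int_eval w (F m)] (mod int p)"
        using True by (simp add: system_map_def poly_eval_int_eval cong_def)
      also have "[int_eval w (F m) = int_eval w (mconst gm * mvar m + mconst hm)] (mod int p)"
        unfolding m by (rule int_eval_reduce)
      also have "int_eval w (mconst gm * mvar m + mconst hm) = w i * gm + hm"
        using True by (simp add: int_eval_add int_eval_mconst_mult int_eval_mvar int_eval_mconst)
      finally show ?thesis .
    qed
    then show ?thesis
      unfolding R_def using True not_dvd_of_Fp_units[OF m(1)]
      by (intro exI[of _ "\<lambda>_. gm"] exI[of _ "\<lambda>_. hm"]) auto
  next
    case False
    with that have i: "i < m" by simp
    with F obtain g G G' H where *: "g \<in> Fp_units p" "G \<in> Fp_poly p {i<..m}"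
      "H \<in> Fp_poly p {i<..m}" "F i = reduce p (mvar i * G + H)"
      "G = reduce p (mconst g * (\<Prod>j\<in>{i<..m}. mvar j ^ (S $$ (i, j))) + G')"
      "\<forall>j\<in>{i<..m}. deg_in j G' < ereal (real (S $$ (i, j)))"
      unfolding poly_systems_def by blast
    have "[system_map p m F w i = w i * int_eval w G + int_eval w H] (mod int p)" for w
    proof -
      have "[system_map p m F w i = int_eval w (F i)] (mod int p)"
        using i by (simp add: system_map_def poly_eval_int_eval cong_def)
      also have "[int_eval w (F i) = int_eval w (mvar i * G + H)] (mod int p)"
        unfolding *(4) by (rule int_eval_reduce)
      also have "int_eval w (mvar i * G + H) = w i * int_eval w G + int_eval w H"
        by (simp add: int_eval_add int_eval_mvar_mult)
      finally show ?thesis .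
    qed
    moreover have "int_eval w G = int_eval w' G \<and> int_eval w H = int_eval w' H"
      if "\<forall>j\<in>{i<..m}. w j = w' j" for w w'
      using that *(2,3) by (auto intro: int_eval_cong)
    moreover have "\<exists>P. degree P = S $$ (i, Suc i) \<and> \<not> int p dvd lead_coeff P \<and>
             (\<forall>x. [int_eval (w(Suc i := x)) G = poly P x] (mod int p))"
      if "\<forall>j\<in>{Suc i<..m}. \<not> int p dvd w j" for w
      using *(6) i that by (intro leading_form_restriction[OF p i *(1,5)]) auto
    ultimately show ?thesis
      unfolding R_def using False by (intro exI[of _ "\<lambda>w. int_eval w G"] exI[of _ "\<lambda>w. int_eval w H"]) auto
  qed
  then have "\<forall>i\<in>{..m}. \<exists>G H. R i G H" by simp
  then obtain G where "\<forall>i\<in>{..m}. \<exists>H. R i (G i) H"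
    by (rule bchoice[THEN exE])
  then obtain H where "\<forall>i\<in>{..m}. R i (G i) (H i)"
    by (rule bchoice[THEN exE])
  then have R: "R i (G i) (H i)" if "i \<le> m" for i
    using that by simp
  note parts = R[unfolded R_def]
  have "\<forall>i\<le>m. \<forall>w. [system_map p m F w i = w i * G i w + H i w] (mod int p)"
    using parts[THEN conjunct1] by simp
  moreover have "\<forall>i\<le>m. \<forall>w w'. (\<forall>j\<in>{i<..m}. w j = w' j) \<longrightarrow> G i w = G i w' \<and> H i w = H i w'"
    by (intro allI impI) (rule parts[THEN conjunct2, THEN conjunct1, THEN spec, THEN spec, THEN mp])
  moreover have "\<forall>w. \<not> int p dvd G m w"
    using parts[of m, THEN conjunct2, THEN conjunct2, THEN conjunct1] by simp
  moreover have "\<forall>i<m. \<forall>w. (\<forall>j\<in>{Suc i<..m}. \<not> int p dvd w j) \<longrightarrow>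
        (\<exists>P. degree P = S $$ (i, Suc i) \<and> \<not> int p dvd lead_coeff P \<and>
             (\<forall>x. [G i (w(Suc i := x)) = poly P x] (mod int p)))"
    by (intro allI impI)
       (rule parts[OF less_imp_le, THEN conjunct2, THEN conjunct2, THEN conjunct2, THEN mp, THEN spec, THEN mp])
  ultimately have "triangular_step p m (\<lambda>i. S $$ (i, Suc i)) (system_map p m F) G H"
    unfolding triangular_step_def by (intro conjI)
  then show ?thesis by (intro exI)
qed

section \<open>States, lines and the dynamics of triangular systems\<close>

lemma finite_Fp_vectors [simp]: "finite (Fp_vectors p m)"
  unfolding Fp_vectors_def by (intro finite_PiE) auto

lemma card_Fp_vectors: "card (Fp_vectors p m) = p ^ (m + 1)"
  by (simp add: Fp_vectors_def card_PiE)

lemma Fp_vectors_nth: "w \<in> Fp_vectors p m \<Longrightarrow> i \<le> m \<Longrightarrow> w i \<in> Fp p"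
  by (auto simp: Fp_vectors_def)

lemma Fp_cong_imp_eq: "x \<in> Fp p \<Longrightarrow> y \<in> Fp p \<Longrightarrow> [x = y] (mod int p) \<Longrightarrow> x = y"
  by (simp add: Fp_def cong_def)

lemma Fp_dvd_iff: "x \<in> Fp p \<Longrightarrow> int p dvd x \<longleftrightarrow> x = 0"
  by (auto simp: Fp_def zdvd_not_zless dest: zdvd_imp_le)

lemma cong_poly:
  fixes P :: "int poly"
  assumes "[x = y] (mod n)"
  shows "[poly P x = poly P y] (mod n)"
  by (induction P) (auto intro!: cong_add cong_mult assms)

text \<open>
  The lines in direction \<open>i\<close> partition the space into \<open>p ^ m\<close> classes. All counts of exceptional
  states below go through this bound.
\<close>

lemma card_le_of_line_bound:
  assumes p: "0 < p" and i: "i \<le> m" and A: "A \<subseteq> Fp_vectors p m"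
    and line: "\<And>w. w \<in> Fp_vectors p m \<Longrightarrow> card {x \<in> Fp p. w(i := x) \<in> A} \<le> r"
  shows "card A \<le> r * p ^ m"
proof -
  define U where "U = ({..m} - {i}) \<rightarrow>\<^sub>E Fp p"
  have finU: "finite U" unfolding U_def by (intro finite_PiE) auto
  have cardU: "card U = p ^ m"
    using i by (simp add: U_def card_PiE)
  have "A \<subseteq> (\<Union>u\<in>U. (\<lambda>x. u(i := x)) ` {x \<in> Fp p. u(i := x) \<in> A})"
  proof
    fix w assume w: "w \<in> A"
    define u where "u = w(i := undefined)"
    have "w \<in> Fp_vectors p m" using w A by auto
    then have "u \<in> U" "w i \<in> Fp p" "w = u(i := w i)"
      using i by (auto simp: u_def U_def Fp_vectors_def PiE_def extensional_def)
    with w show "w \<in> (\<Union>u\<in>U. (\<lambda>x. u(i := x)) ` {x \<in> Fp p. u(i := x) \<in> A})"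
      by (metis (mono_tags, lifting) UN_I image_eqI mem_Collect_eq)
  qed
  then have "card A \<le> card (\<Union>u\<in>U. (\<lambda>x. u(i := x)) ` {x \<in> Fp p. u(i := x) \<in> A})"
    using finU by (intro card_mono finite_UN_I) auto
  also have "\<dots> \<le> (\<Sum>u\<in>U. card ((\<lambda>x. u(i := x)) ` {x \<in> Fp p. u(i := x) \<in> A}))"
    using finU by (rule card_UN_le)
  also have "\<dots> \<le> (\<Sum>u\<in>U. r)"
  proof (rule sum_mono)
    fix u assume u: "u \<in> U"
    have "u(i := 0) \<in> Fp_vectors p m"
      using u p i by (auto simp: U_def Fp_vectors_def Fp_def PiE_def extensional_def)
    from line[OF this] have "card {x \<in> Fp p. u(i := x) \<in> A} \<le> r" by simp
    moreover have "card ((\<lambda>x. u(i := x)) ` {x \<in> Fp p. u(i := x) \<in> A}) \<le>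
        card {x \<in> Fp p. u(i := x) \<in> A}"
      by (rule card_image_le) simp
    ultimately show "card ((\<lambda>x. u(i := x)) ` {x \<in> Fp p. u(i := x) \<in> A}) \<le> r" by simp
  qed
  also have "\<dots> = r * p ^ m" by (simp add: cardU)
  finally show ?thesis .
qed

lemma card_coordinate_zero:
  assumes "0 < p" "i \<le> m"
  shows "card {w \<in> Fp_vectors p m. w i = 0} \<le> p ^ m"
proof -
  have "card {w \<in> Fp_vectors p m. w i = 0} \<le> 1 * p ^ m"
  proof (rule card_le_of_line_bound[OF assms])
    fix w
    have "{x \<in> Fp p. w(i := x) \<in> {w \<in> Fp_vectors p m. w i = 0}} \<subseteq> {0}" by auto
    then have "card {x \<in> Fp p. w(i := x) \<in> {w \<in> Fp_vectors p m. w i = 0}} \<le> card {0 :: int}"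
      by (rule card_mono[rotated]) simp
    also have "card {0 :: int} = 1" by simp
    finally show "card {x \<in> Fp p. w(i := x) \<in> {w \<in> Fp_vectors p m. w i = 0}} \<le> 1" .
  qed auto
  then show ?thesis by simp
qed

text \<open>
  Step number \<open>Suc k\<close> has multipliers \<open>G (Suc k) i\<close> and translations \<open>H (Suc k) i\<close>; there is no
  step number 0.
\<close>

locale triangular_iteration =
  fixes p m :: nat and s :: "nat \<Rightarrow> nat" and F :: "nat \<Rightarrow> nat \<Rightarrow> int_mpoly"
    and G H :: "nat \<Rightarrow> nat \<Rightarrow> (nat \<Rightarrow> int) \<Rightarrow> int"
  assumes p: "prime p"
    and s: "\<And>i. i < m \<Longrightarrow> 0 < s i"
    and step: "\<And>k. triangular_step p m s (system_map p m (F (Suc k))) (G (Suc k)) (H (Suc k))"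
    and perm: "\<And>k. permutation_system p m (F (Suc k))"
begin

abbreviation "V \<equiv> Fp_vectors p m"
abbreviation "orb \<equiv> orbit p m F"

lemma p_pos: "0 < p" using p by (simp add: prime_gt_0_nat)

lemma prime_int: "prime (int p)" using p by simp

lemma step_value:
  assumes "i \<le> m"
  shows "system_map p m (F (Suc k)) w i = (w i * G (Suc k) i w + H (Suc k) i w) mod int p"
proof -
  have "[system_map p m (F (Suc k)) w i = w i * G (Suc k) i w + H (Suc k) i w] (mod int p)"
    using step[of k] assms unfolding triangular_step_def by blast
  moreover have "system_map p m (F (Suc k)) w i mod int p = system_map p m (F (Suc k)) w i"
    using assms by (simp add: system_map_def poly_eval_def)
  ultimately show ?thesis by (simp add: cong_def)
qed

lemma step_dependence:
  assumes "i \<le> m" "\<And>j. i < j \<Longrightarrow> j \<le> m \<Longrightarrow> w j = w' j"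
  shows "G (Suc k) i w = G (Suc k) i w'" "H (Suc k) i w = H (Suc k) i w'"
proof -
  have "\<forall>j\<in>{i<..m}. w j = w' j" using assms(2) by simp
  then show "G (Suc k) i w = G (Suc k) i w'" "H (Suc k) i w = H (Suc k) i w'"
    using step[of k] assms(1) unfolding triangular_step_def by blast+
qed

lemma step_leading:
  assumes "i < m" "\<And>j. Suc i < j \<Longrightarrow> j \<le> m \<Longrightarrow> \<not> int p dvd w j"
  shows "\<exists>P. degree P = s i \<and> \<not> int p dvd lead_coeff P \<and>
    (\<forall>x. [G (Suc k) i (w(Suc i := x)) = poly P x] (mod int p))"
proof -
  have "\<forall>j\<in>{Suc i<..m}. \<not> int p dvd w j" using assms(2) by simp
  then show ?thesis
    using step[of k] assms(1) unfolding triangular_step_def by blast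
qed

lemma step_last: "\<not> int p dvd G (Suc k) m w"
  using step[of k] unfolding triangular_step_def by blast

lemma orbit_bij: "bij_betw (\<lambda>w. orb w k) V V"
proof (induction k)
  case 0
  then show ?case by (simp add: bij_betw_def)
next
  case (Suc k)
  have "bij_betw (system_map p m (F (Suc k)) \<circ> (\<lambda>w. orb w k)) V V"
    using Suc perm[of k] unfolding permutation_system_def by (rule bij_betw_trans)
  then show ?case by (simp add: comp_def)
qed

lemma orbit_in: "w \<in> V \<Longrightarrow> orb w k \<in> V"
  using orbit_bij[of k] by (auto simp: bij_betw_def)

lemma orbit_agree:
  assumes "\<And>j. i \<le> j \<Longrightarrow> j \<le> m \<Longrightarrow> w j = w' j" "i \<le> j" "j \<le> m"
  shows "orb w k j = orb w' k j"
  using assms(2,3)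
proof (induction k arbitrary: j)
  case 0
  then show ?case using assms(1) by simp
next
  case (Suc k)
  have "G (Suc k) j (orb w k) = G (Suc k) j (orb w' k)"
    "H (Suc k) j (orb w k) = H (Suc k) j (orb w' k)"
    using Suc by (auto intro!: step_dependence)
  then show ?case using Suc by (simp add: step_value)
qed

definition multiplier :: "nat \<Rightarrow> nat \<Rightarrow> (nat \<Rightarrow> int) \<Rightarrow> int" where
  "multiplier k i w = (\<Prod>j<k. G (Suc j) i (orb w j))"

text \<open>
  The multipliers met along the way are unchanged when coordinate \<open>i\<close> of the initial state varies,
  because they depend only on coordinates above \<open>i\<close>, and these evolve without knowing
  coordinate \<open>i\<close>. So a composition of affine maps results.
\<close>

lemma orbit_affine:
  assumes "i \<le> m"
  shows "\<exists>R. \<forall>x. [orb (w(i := x)) k i = x * multiplier k i w + R] (mod int p)"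
proof (induction k)
  case 0
  show ?case by (intro exI[of _ 0]) (simp add: multiplier_def)
next
  case (Suc k)
  then obtain R where R: "\<And>x. [orb (w(i := x)) k i = x * multiplier k i w + R] (mod int p)"
    by blast
  define g h where "g = G (Suc k) i (orb w k)" and "h = H (Suc k) i (orb w k)"
  have "[orb (w(i := x)) (Suc k) i = x * multiplier (Suc k) i w + (R * g + h)] (mod int p)" for x
  proof -
    have agree: "orb (w(i := x)) k j = orb w k j" if "i < j" "j \<le> m" for j
      using that by (intro orbit_agree[of "Suc i"]) auto
    have "G (Suc k) i (orb (w(i := x)) k) = g" "H (Suc k) i (orb (w(i := x)) k) = h"
      unfolding g_def h_def by (intro step_dependence assms agree; assumption)+
    then have "[orb (w(i := x)) (Suc k) i = orb (w(i := x)) k i * g + h] (mod int p)"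
      using assms by (simp add: step_value cong_def)
    also have "[orb (w(i := x)) k i * g + h = (x * multiplier k i w + R) * g + h] (mod int p)"
      by (intro cong_add cong_mult R cong_refl)
    also have "(x * multiplier k i w + R) * g + h = x * multiplier (Suc k) i w + (R * g + h)"
      by (simp add: multiplier_def g_def algebra_simps)
    finally show ?thesis .
  qed
  then show ?case by blast
qed

text \<open>
  On these states some coordinate \<open>i < m\<close> is merely translated by \<open>k\<close> steps, and its
  displacement carries no information about the state.
\<close>

definition unit_multiplier :: "nat \<Rightarrow> (nat \<Rightarrow> int) set" where
  "unit_multiplier k = {w \<in> V. \<exists>i<m. [multiplier k i w = 1] (mod int p)}"

lemma displacement_determines_coordinate:
  assumes i: "i < m" and V: "w \<in> V" "w' \<in> V"
    and M: "\<not> [multiplier k i w = 1] (mod int p)"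
    and agree: "\<And>j. i < j \<Longrightarrow> j \<le> m \<Longrightarrow> w j = w' j"
    and d: "[orb w k i - w i = orb w' k i - w' i] (mod int p)"
  shows "w i = w' i"
proof -
  obtain R where R: "\<And>x. [orb (w(i := x)) k i = x * multiplier k i w + R] (mod int p)"
    using orbit_affine[of i w k] i by auto
  have "orb w' k i = orb (w(i := w' i)) k i"
    using i agree by (intro orbit_agree[of i]) auto
  with R[of "w' i"] have 1: "[orb w' k i = w' i * multiplier k i w + R] (mod int p)" by simp
  have 2: "[orb w k i = w i * multiplier k i w + R] (mod int p)"
    using R[of "w i"] by simp
  have "[orb w k i - w i = (w i * multiplier k i w + R) - w i] (mod int p)"
    by (intro cong_diff 2 cong_refl)
  moreover have "[orb w' k i - w' i = (w' i * multiplier k i w + R) - w' i] (mod int p)"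
    by (intro cong_diff 1 cong_refl)
  ultimately have "[(w i * multiplier k i w + R) - w i = (w' i * multiplier k i w + R) - w' i] (mod int p)"
    using d by (meson cong_sym cong_trans)
  then have "int p dvd (w i - w' i) * (multiplier k i w - 1)"
    by (simp add: cong_iff_dvd_diff algebra_simps)
  with M have "int p dvd w i - w' i"
    by (simp add: prime_dvd_mult_iff[OF prime_int] cong_iff_dvd_diff)
  then show ?thesis
    using V i by (intro Fp_cong_imp_eq[of _ p]) (auto simp: Fp_vectors_nth cong_iff_dvd_diff)
qed

text \<open>
  Downward induction on the coordinates: once the coordinates above \<open>i\<close> agree, the displacement in
  coordinate \<open>i\<close> is \<open>(M - 1) * w i + R\<close> with the same \<open>M\<close> and \<open>R\<close> and determines \<open>w i\<close>. Only the last
  coordinate remains free.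
\<close>

lemma card_displacement_fibre:
  "card {w \<in> V - unit_multiplier k. \<forall>i<m. [orb w k i - w i = d i] (mod int p)} \<le> p"
proof -
  let ?A = "{w \<in> V - unit_multiplier k. \<forall>i<m. [orb w k i - w i = d i] (mod int p)}"
  have "inj_on (\<lambda>w. w m) ?A"
  proof (rule inj_onI)
    fix w w' assume w: "w \<in> ?A" "w' \<in> ?A" and m: "w m = w' m"
    have "w i = w' i" if "i \<le> m" for i
      using that
    proof (induction "m - i" arbitrary: i rule: less_induct)
      case less
      show ?case
      proof (cases "i = m")
        case True
        then show ?thesis using m by simp
      next
        case False
        with less have i: "i < m" by simp
        have "[orb w k i - w i = d i] (mod int p)" "[orb w' k i - w' i = d i] (mod int p)"
          using w i by auto
        then have "[orb w k i - w i = orb w' k i - w' i] (mod int p)"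
          by (meson cong_sym cong_trans)
        moreover have "\<not> [multiplier k i w = 1] (mod int p)"
          using w i by (auto simp: unit_multiplier_def)
        moreover have "w j = w' j" if "i < j" "j \<le> m" for j
          using less(1)[of j] that by simp
        moreover have "w \<in> V" "w' \<in> V" using w by auto
        ultimately show ?thesis
          using displacement_determines_coordinate[OF i, of w w' k] by blast
      qed
    qed
    then show "w = w'"
      using w by (auto simp: Fp_vectors_def intro: PiE_ext)
  qed
  then have "card ?A \<le> card (Fp p)"
    by (rule card_inj_on_le) (auto intro: Fp_vectors_nth)
  then show ?thesis by simp
qed

text \<open>
  Bijectivity of the steps: an event about the state at time \<open>k\<close> is as rare as the same event about
  the initial state.
\<close>

lemma card_orbit_preimage: "card {w \<in> V. Q (orb w k)} = card {w \<in> V. Q w}"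
proof -
  have image: "(\<lambda>w. orb w k) ` V = V"
    using orbit_bij[of k] by (rule bij_betw_imp_surj_on)
  have "(\<lambda>w. orb w k) ` {w \<in> V. Q (orb w k)} = {w \<in> V. Q w}"
    using Compr_image_eq[of "\<lambda>w. orb w k" V Q] unfolding image by simp
  moreover have "inj_on (\<lambda>w. orb w k) {w \<in> V. Q (orb w k)}"
    using bij_betw_imp_inj_on[OF orbit_bij[of k]] by (rule inj_on_subset) auto
  note card_image[OF this]
  ultimately show ?thesis by simp
qed

lemma nonzero_coordinate: "w \<in> V \<Longrightarrow> j \<le> m \<Longrightarrow> w j \<noteq> 0 \<Longrightarrow> \<not> int p dvd w j"
  using Fp_vectors_nth[of w p m j] Fp_dvd_iff[of "w j" p] by simp

lemma card_some_coordinate_zero: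
  "card {w \<in> V. \<exists>j\<in>{c<..m}. w j = 0} \<le> m * p ^ m"
proof -
  have "{w \<in> V. \<exists>j\<in>{c<..m}. w j = 0} = (\<Union>j\<in>{c<..m}. {w \<in> V. w j = 0})" by auto
  also have "card \<dots> \<le> (\<Sum>j\<in>{c<..m}. card {w \<in> V. w j = 0})"
    by (rule card_UN_le) simp
  also have "\<dots> \<le> (\<Sum>j\<in>{c<..m}. p ^ m)"
    by (intro sum_mono card_coordinate_zero p_pos) auto
  also have "\<dots> \<le> m * p ^ m" by simp
  finally show ?thesis .
qed

text \<open>
  If some coordinate above \<open>Suc i\<close> vanishes, the state is discarded; on the other lines in
  direction \<open>Suc i\<close> the multiplier has at most \<open>s i\<close> zeros.
\<close>

lemma card_step_multiplier_zero:
  assumes "i \<le> m"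
  shows "card {w \<in> V. int p dvd G (Suc k) i w} \<le> (m + sum s {..<m}) * p ^ m"
proof (cases "i = m")
  case True
  then have "{w \<in> V. int p dvd G (Suc k) i w} = {}"
    using step_last by simp
  then show ?thesis by (metis card.empty le0)
next
  case False
  with assms have i: "i < m" by simp
  let ?Z = "{w \<in> V. \<exists>j\<in>{Suc i<..m}. w j = 0}"
  let ?A = "{w \<in> V. (\<forall>j\<in>{Suc i<..m}. w j \<noteq> 0) \<and> int p dvd G (Suc k) i w}"
  have "card ?A \<le> s i * p ^ m"
  proof (rule card_le_of_line_bound[of _ "Suc i"])
    fix w assume w: "w \<in> V"
    show "card {x \<in> Fp p. w(Suc i := x) \<in> ?A} \<le> s i"
    proof (cases "\<forall>j\<in>{Suc i<..m}. w j \<noteq> 0")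
      case True
      then have unit: "\<not> int p dvd w j" if "Suc i < j" "j \<le> m" for j
        using nonzero_coordinate[OF w, of j] that by simp
      obtain P where P: "degree P = s i" "\<not> int p dvd lead_coeff P"
        "\<And>x. [G (Suc k) i (w(Suc i := x)) = poly P x] (mod int p)"
        using step_leading[of i w k, OF i unit] by blast
      have "{x \<in> Fp p. w(Suc i := x) \<in> ?A} \<subseteq> {x \<in> Fp p. int p dvd poly P x}"
        using P(3)[THEN cong_dvd_iff] by auto
      then have "card {x \<in> Fp p. w(Suc i := x) \<in> ?A} \<le> card {x \<in> Fp p. int p dvd poly P x}"
        by (intro card_mono) auto
      also have "\<dots> \<le> s i"
        using card_roots_mod_prime[OF p P(2)] P(1) by simp
      finally show ?thesis .
    next
      case False
      then have "{x \<in> Fp p. w(Suc i := x) \<in> ?A} = {}" by auto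
      then show ?thesis by (metis card.empty le0)
    qed
  qed (use i p_pos in auto)
  moreover have "card ?Z \<le> m * p ^ m" by (rule card_some_coordinate_zero)
  moreover have "card {w \<in> V. int p dvd G (Suc k) i w} \<le> card (?Z \<union> ?A)"
    by (intro card_mono) auto
  moreover have "card (?Z \<union> ?A) \<le> card ?Z + card ?A" by (rule card_Un_le)
  moreover have "s i * p ^ m \<le> sum s {..<m} * p ^ m"
    using i by (intro mult_right_mono member_le_sum) auto
  ultimately show ?thesis unfolding add_mult_distrib by linarith
qed

text \<open>
  If the orbit avoids this for \<open>c = Suc i\<close>, then along it the multipliers \<open>G i\<close> have unit leading
  coefficients in the variable \<open>Suc i\<close>, and coordinate \<open>Suc i\<close> depends on its initial value through a
  nonconstant affine map.
\<close>

definition degenerate :: "nat \<Rightarrow> nat \<Rightarrow> (nat \<Rightarrow> int) \<Rightarrow> bool" where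
  "degenerate k c w \<longleftrightarrow> (\<exists>j<k. (\<exists>i\<in>{c<..m}. orb w j i = 0) \<or> int p dvd G (Suc j) c (orb w j))"

lemma card_degenerate:
  assumes "c \<le> m"
  shows "card {w \<in> V. degenerate k c w} \<le> k * ((2 * m + sum s {..<m}) * p ^ m)"
proof -
  let ?D = "\<lambda>j. {w \<in> V. (\<exists>i\<in>{c<..m}. orb w j i = 0) \<or> int p dvd G (Suc j) c (orb w j)}"
  have D: "card (?D j) \<le> (2 * m + sum s {..<m}) * p ^ m" for j
  proof -
    have "card (?D j) = card {w \<in> V. (\<exists>i\<in>{c<..m}. w i = 0) \<or> int p dvd G (Suc j) c w}"
      by (rule card_orbit_preimage)
    also have "\<dots> \<le> card ({w \<in> V. \<exists>i\<in>{c<..m}. w i = 0} \<union> {w \<in> V. int p dvd G (Suc j) c w})"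
      by (intro card_mono) auto
    also have "\<dots> \<le> card {w \<in> V. \<exists>i\<in>{c<..m}. w i = 0} + card {w \<in> V. int p dvd G (Suc j) c w}"
      by (rule card_Un_le)
    also have "\<dots> \<le> m * p ^ m + (m + sum s {..<m}) * p ^ m"
      by (intro add_mono card_some_coordinate_zero card_step_multiplier_zero assms)
    finally show ?thesis by (simp add: algebra_simps)
  qed
  have "{w \<in> V. degenerate k c w} = (\<Union>j<k. ?D j)" by (auto simp: degenerate_def)
  then have "card {w \<in> V. degenerate k c w} = card (\<Union>j<k. ?D j)" by (rule arg_cong)
  also have "\<dots> \<le> (\<Sum>j<k. card (?D j))" by (rule card_UN_le) simp
  also have "\<dots> \<le> (\<Sum>j<k. (2 * m + sum s {..<m}) * p ^ m)" by (intro sum_mono D)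
  finally show ?thesis by simp
qed

text \<open>
  Each factor is a polynomial of degree \<open>s i\<close> in coordinate \<open>Suc i\<close> of the state at time \<open>j\<close>, and that
  coordinate is a nonconstant affine function of its initial value. Degrees and unit leading
  coefficients survive the substitution and the product, so no cancellation is possible.
\<close>

lemma multiplier_as_polynomial:
  assumes i: "i < m" and k: "0 < k" and w: "w \<in> V" and nd: "\<not> degenerate k (Suc i) w"
  shows "\<exists>T. degree T = k * s i \<and> \<not> int p dvd lead_coeff T \<and>
    (\<forall>x. [multiplier k i (w(Suc i := x)) = poly T x] (mod int p))"
proof -
  have "\<exists>P. degree P = s i \<and> \<not> int p dvd lead_coeff P \<and>
      (\<forall>x. [G (Suc j) i ((orb w j)(Suc i := x)) = poly P x] (mod int p))" if "j < k" for j
  proof -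
    have unit: "\<not> int p dvd orb w j l" if "Suc i < l" "l \<le> m" for l
      using that nd \<open>j < k\<close> by (intro nonzero_coordinate orbit_in[OF w]) (auto simp: degenerate_def)
    show ?thesis by (rule step_leading[of i "orb w j" j, OF i unit])
  qed
  then have "\<forall>j\<in>{..<k}. \<exists>P. degree P = s i \<and> \<not> int p dvd lead_coeff P \<and>
      (\<forall>x. [G (Suc j) i ((orb w j)(Suc i := x)) = poly P x] (mod int p))" by simp
  then obtain P where "\<forall>j\<in>{..<k}. degree (P j) = s i \<and> \<not> int p dvd lead_coeff (P j) \<and>
      (\<forall>x. [G (Suc j) i ((orb w j)(Suc i := x)) = poly (P j) x] (mod int p))"
    by (rule bchoice[THEN exE])
  then have P: "degree (P j) = s i" "\<not> int p dvd lead_coeff (P j)"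
    "[G (Suc j) i ((orb w j)(Suc i := x)) = poly (P j) x] (mod int p)" if "j < k" for j x
    using that by (blast dest: bspec[of _ _ j])+
  have "\<forall>j. \<exists>R. \<forall>x. [orb (w(Suc i := x)) j (Suc i) = x * multiplier j (Suc i) w + R] (mod int p)"
    using i by (intro allI orbit_affine) simp
  then obtain R where R': "\<forall>j x. [orb (w(Suc i := x)) j (Suc i) = x * multiplier j (Suc i) w + R j] (mod int p)"
    by (rule choice[THEN exE])
  note R = R'[THEN spec, THEN spec]
  have M: "\<not> int p dvd multiplier j (Suc i) w" if "j < k" for j
    using nd that by (auto simp: multiplier_def degenerate_def prime_dvd_prod_iff[OF _ prime_int])
  define L where "L j = [:R j, multiplier j (Suc i) w:]" for j
  have L: "degree (L j) = 1" "lead_coeff (L j) = multiplier j (Suc i) w" if "j < k" for j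
    using M[OF that] by (auto simp: L_def)
  define Q where "Q j = pcompose (P j) (L j)" for j
  have Q: "degree (Q j) = s i" "\<not> int p dvd lead_coeff (Q j)" if "j < k" for j
  proof -
    show "degree (Q j) = s i" by (simp add: Q_def degree_pcompose L P that)
    have "lead_coeff (Q j) = lead_coeff (P j) * multiplier j (Suc i) w ^ s i"
      using lead_coeff_comp[of "L j" "P j"] L[OF that] P(1)[OF that] unfolding Q_def by simp
    then show "\<not> int p dvd lead_coeff (Q j)"
      using P(2)[OF that] M[OF that] prime_dvd_power[OF prime_int]
      by (auto simp: prime_dvd_mult_iff[OF prime_int])
  qed
  define T where "T = (\<Prod>j<k. Q j)"
  have "degree T = (\<Sum>j<k. degree (Q j))"
    unfolding T_def using Q by (intro degree_prod_eq_sum_degree) fastforce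
  then have "degree T = k * s i" using Q by simp
  moreover have "\<not> int p dvd lead_coeff T"
    using Q by (auto simp: T_def lead_coeff_prod prime_dvd_prod_iff[OF _ prime_int])
  moreover have "[multiplier k i (w(Suc i := x)) = poly T x] (mod int p)" for x
  proof -
    have "[G (Suc j) i (orb (w(Suc i := x)) j) = poly (Q j) x] (mod int p)" if j: "j < k" for j
    proof -
      let ?y = "orb (w(Suc i := x)) j (Suc i)"
      have agree: "orb (w(Suc i := x)) j l = orb w j l" if "Suc i < l" "l \<le> m" for l
        using that by (intro orbit_agree[of "Suc (Suc i)"]) auto
      have eq: "G (Suc j) i (orb (w(Suc i := x)) j) = G (Suc j) i ((orb w j)(Suc i := ?y))"
        using i agree by (intro step_dependence) auto
      have "[G (Suc j) i (orb (w(Suc i := x)) j) = poly (P j) ?y] (mod int p)"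
        unfolding eq by (rule P(3)[OF j])
      moreover have "poly (P j) (x * multiplier j (Suc i) w + R j) = poly (Q j) x"
        by (simp add: Q_def L_def poly_pcompose algebra_simps)
      then have "[poly (P j) ?y = poly (Q j) x] (mod int p)"
        using cong_poly[OF R[of x j], of "P j"] by (simp only:)
      ultimately show ?thesis by (rule cong_trans)
    qed
    then show ?thesis unfolding multiplier_def T_def poly_prod by (intro cong_prod) simp
  qed
  ultimately show ?thesis by blast
qed

text \<open>
  Here \<open>0 < s i\<close> enters: the multiplier is a polynomial of positive degree, and subtracting 1 does not
  change its leading coefficient.
\<close>

lemma card_multiplier_one:
  assumes i: "i < m" and k: "0 < k"
  shows "card {w \<in> V. \<not> degenerate k (Suc i) w \<and> [multiplier k i w = 1] (mod int p)} \<le> (k * s i) * p ^ m"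
    (is "card ?A \<le> _")
proof (rule card_le_of_line_bound[of _ "Suc i"])
  fix w assume w: "w \<in> V"
  have deg_upd: "degenerate k (Suc i) (w(Suc i := x)) \<longleftrightarrow> degenerate k (Suc i) w" for x
  proof -
    have agree: "orb (w(Suc i := x)) j l = orb w j l" if "Suc i < l" "l \<le> m" for j l
      using that by (intro orbit_agree[of "Suc (Suc i)"]) auto
    then have "G (Suc j) (Suc i) (orb (w(Suc i := x)) j) = G (Suc j) (Suc i) (orb w j)" for j
      using i by (intro step_dependence) auto
    with agree show ?thesis by (auto simp: degenerate_def)
  qed
  show "card {x \<in> Fp p. w(Suc i := x) \<in> ?A} \<le> k * s i"
  proof (cases "degenerate k (Suc i) w")
    case True
    then have "{x \<in> Fp p. w(Suc i := x) \<in> ?A} = {}" using deg_upd by auto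
    then show ?thesis by (metis card.empty le0)
  next
    case False
    obtain T where T: "degree T = k * s i" "\<not> int p dvd lead_coeff T"
      "\<And>x. [multiplier k i (w(Suc i := x)) = poly T x] (mod int p)"
      using multiplier_as_polynomial[OF i k w False] by blast
    \<comment> \<open>The multiplier equals 1 exactly at the roots of \<open>T - 1\<close>.\<close>
    have deg: "degree [:- 1:] < degree T" using T(1) k s[OF i] by simp
    have *: "degree (T + [:- 1:]) = k * s i" "\<not> int p dvd lead_coeff (T + [:- 1:])"
      using T deg degree_add_eq_left[OF deg] lead_coeff_add_le[of "[:- 1:]" T]
      by (auto simp: add.commute)
    have "{x \<in> Fp p. w(Suc i := x) \<in> ?A} \<subseteq> {x \<in> Fp p. int p dvd poly (T + [:- 1:]) x}"
    proof safe
      fix x assume "[multiplier k i (w(Suc i := x)) = 1] (mod int p)"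
      with T(3)[of x] have "[poly T x = 1] (mod int p)" by (meson cong_sym cong_trans)
      then show "int p dvd poly (T + [:- 1:]) x" by (simp add: cong_iff_dvd_diff)
    qed
    then have "card {x \<in> Fp p. w(Suc i := x) \<in> ?A} \<le> card {x \<in> Fp p. int p dvd poly (T + [:- 1:]) x}"
      by (intro card_mono) auto
    also have "\<dots> \<le> k * s i" using card_roots_mod_prime[OF p *(2)] *(1) by simp
    finally show ?thesis .
  qed
qed (use i p_pos in auto)

lemma card_unit_multiplier:
  assumes k: "0 < k"
  shows "card (unit_multiplier k) \<le> (m * (2 * m + 2 * sum s {..<m})) * k * p ^ m"
proof -
  let ?B = "\<lambda>i. {w \<in> V. [multiplier k i w = 1] (mod int p)}"
  have "card (?B i) \<le> (2 * m + 2 * sum s {..<m}) * k * p ^ m" if i: "i < m" for i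
  proof -
    let ?A = "{w \<in> V. \<not> degenerate k (Suc i) w \<and> [multiplier k i w = 1] (mod int p)}"
    let ?D = "{w \<in> V. degenerate k (Suc i) w}"
    have "card (?B i) \<le> card (?A \<union> ?D)" by (intro card_mono) auto
    also have "\<dots> \<le> card ?A + card ?D" by (rule card_Un_le)
    also have "\<dots> \<le> (k * s i) * p ^ m + k * ((2 * m + sum s {..<m}) * p ^ m)"
      using i k by (intro add_mono card_multiplier_one card_degenerate) auto
    also have "\<dots> \<le> (k * sum s {..<m}) * p ^ m + k * ((2 * m + sum s {..<m}) * p ^ m)"
      using i by (intro add_mono mult_right_mono mult_left_mono member_le_sum) auto
    finally show ?thesis by (simp add: algebra_simps)
  qed
  then have "(\<Sum>i<m. card (?B i)) \<le> (\<Sum>i<m. (2 * m + 2 * sum s {..<m}) * k * p ^ m)"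
    by (intro sum_mono) auto
  moreover have "unit_multiplier k = (\<Union>i<m. ?B i)" by (auto simp: unit_multiplier_def)
  moreover have "card (\<Union>i<m. ?B i) \<le> (\<Sum>i<m. card (?B i))" by (rule card_UN_le) simp
  ultimately show ?thesis by (simp add: algebra_simps)
qed

end

section \<open>Dyadic cells and prefixes\<close>

text \<open>
  The index of the dyadic cell of level \<open>l\<close> that contains \<open>y\<close>, when \<open>{0..<P}\<close> is cut at the multiples of
  \<open>P / 2 ^ l\<close>. The cells are nested although \<open>P\<close> need not be a power of two. With \<open>P = 2 ^ J\<close> the same
  function cuts the time axis.
\<close>

definition cell :: "int \<Rightarrow> nat \<Rightarrow> int \<Rightarrow> int" where
  "cell P l y = (y * 2 ^ l) div P"

text \<open>
  The prefix \<open>{0..<a}\<close> consists of at most one whole cell of each level \<open>l \<le> J\<close>, present when the index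
  of the cell containing \<open>a\<close> is odd, and of a remainder inside one cell of level \<open>J\<close>. The remainder
  serves as the piece of level \<open>J + 1\<close>.
\<close>

definition piece :: "int \<Rightarrow> nat \<Rightarrow> int \<Rightarrow> nat \<Rightarrow> int \<Rightarrow> real" where
  "piece P J a l y =
     (if l \<le> J then of_bool (odd (cell P l a) \<and> cell P l y = cell P l a - 1)
      else of_bool (y < a \<and> cell P J y = cell P J a))"

lemma cell_halve: "0 < P \<Longrightarrow> cell P l y = cell P (Suc l) y div 2"
proof -
  assume "0 < P"
  have "cell P (Suc l) y div 2 = (2 * (y * 2 ^ l)) div (2 * P)"
    by (simp add: cell_def zdiv_zmult2_eq mult.commute[of 2 P] algebra_simps)
  then show ?thesis by (simp add: cell_def)
qed

lemma cell_mono: "0 < P \<Longrightarrow> x \<le> y \<Longrightarrow> cell P l x \<le> cell P l y"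
  unfolding cell_def by (intro zdiv_mono1 mult_right_mono) auto

lemma cell_0: "0 \<le> y \<Longrightarrow> y < P \<Longrightarrow> cell P 0 y = 0"
  by (simp add: cell_def)

lemma cell_range:
  assumes "0 \<le> y" "y < P"
  shows "0 \<le> cell P l y" "cell P l y < 2 ^ l"
proof -
  show "0 \<le> cell P l y" using assms by (simp add: cell_def pos_imp_zdiv_nonneg_iff)
  have "y * 2 ^ l < P * 2 ^ l" using assms by simp
  moreover have "P * cell P l y \<le> y * 2 ^ l"
    using assms mult_div_mod_eq[of P "y * 2 ^ l"] pos_mod_sign[of P "y * 2 ^ l"]
    unfolding cell_def by linarith
  ultimately have "P * cell P l y < P * 2 ^ l" by linarith
  then show "cell P l y < 2 ^ l" using assms by simp
qed

text \<open>
  Passing from level \<open>J\<close> to level \<open>J + 1\<close> appends a binary digit to the index of the cell containing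
  \<open>a\<close>; exactly one further cell fits below \<open>a\<close> if this digit is 1, and none otherwise.
\<close>

lemma prefix_dyadic:
  assumes P: "0 < P" and y: "0 \<le> y" "y < P" and a: "0 \<le> a" "a \<le> P"
  shows "of_bool (cell P J y < cell P J a) =
    (\<Sum>l\<le>J. of_bool (odd (cell P l a) \<and> cell P l y = cell P l a - 1) :: real)"
proof (induction J)
  case 0
  have "cell P 0 a = (if a = P then 1 else 0)" using a P by (auto simp: cell_def)
  then show ?case using cell_0[OF y] by simp
next
  case (Suc J)
  have "of_bool (cell P (Suc J) y < cell P (Suc J) a) =
      (of_bool (cell P J y < cell P J a) +
       of_bool (odd (cell P (Suc J) a) \<and> cell P (Suc J) y = cell P (Suc J) a - 1) :: real)"
  proof -
    let ?u = "cell P (Suc J) y" and ?v = "cell P (Suc J) a"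
    have "?u < ?v \<longleftrightarrow> ?u div 2 < ?v div 2 \<or> (odd ?v \<and> ?u = ?v - 1)" by presburger
    moreover have "\<not> (?u div 2 < ?v div 2 \<and> odd ?v \<and> ?u = ?v - 1)" by presburger
    ultimately show ?thesis using cell_halve[OF P, of J y] cell_halve[OF P, of J a] by auto
  qed
  with Suc show ?case by simp
qed

lemma prefix_pieces:
  assumes P: "0 < P" and y: "0 \<le> y" "y < P" and a: "0 \<le> a" "a \<le> P"
  shows "of_bool (y < a) = (\<Sum>l\<le>Suc J. piece P J a l y)"
proof -
  have "(\<Sum>l\<le>Suc J. piece P J a l y) =
      of_bool (cell P J y < cell P J a) + of_bool (y < a \<and> cell P J y = cell P J a)"
    by (simp add: piece_def prefix_dyadic[OF assms])
  also have "\<dots> = of_bool (y < a)"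
    using cell_mono[OF P, of a y J] cell_mono[OF P, of y a J]
    by (cases "y < a") auto
  finally show ?thesis by simp
qed

definition piece_index :: "int \<Rightarrow> nat \<Rightarrow> int \<Rightarrow> nat \<Rightarrow> int" where
  "piece_index P J a l = (if l \<le> J then cell P l a - 1 else cell P J a)"

lemma piece_nonneg: "0 \<le> piece P J a l y"
  by (simp add: piece_def)

lemma piece_le_cell: "piece P J a l y \<le> of_bool (cell P (min l J) y = piece_index P J a l)"
  by (auto simp: piece_def piece_index_def min_def)

lemma piece_eq_cell:
  "l \<le> J \<Longrightarrow> piece P J a l y =
    of_bool (odd (cell P l a)) * of_bool (cell P (min l J) y = piece_index P J a l)"
  by (auto simp: piece_def piece_index_def min_def)

lemma card_cell:
  assumes P: "0 < P"
  shows "real (card {y \<in> {0..<P}. cell P J y = b}) \<le> real_of_int P / 2 ^ J + 1"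
proof (cases "{y \<in> {0..<P}. cell P J y = b} = {}")
  case True
  then show ?thesis using P by (metis card.empty of_nat_0 add_nonneg_nonneg divide_nonneg_nonneg
    of_int_0_le_iff less_imp_le zero_le_numeral zero_le_power zero_le_one)
next
  case False
  let ?A = "{y \<in> {0..<P}. cell P J y = b}"
  have fin: "finite ?A" by (rule finite_subset[of _ "{0..<P}"]) auto
  define z where "z = Min ?A"
  have z: "z \<in> ?A" unfolding z_def using fin False by (rule Min_in)
  have "?A \<subseteq> {z..z + P div 2 ^ J}"
  proof
    fix y assume y: "y \<in> ?A"
    then have "z \<le> y" unfolding z_def using fin by (intro Min_le)
    have "cell P J y = cell P J z" using y z by simp
    then have "y * 2 ^ J = P * cell P J z + (y * 2 ^ J) mod P"
      using mult_div_mod_eq[of P "y * 2 ^ J"] by (simp add: cell_def)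
    moreover have "z * 2 ^ J = P * cell P J z + (z * 2 ^ J) mod P"
      using mult_div_mod_eq[of P "z * 2 ^ J"] by (simp add: cell_def)
    moreover have "(y * 2 ^ J) mod P < P" "0 \<le> (z * 2 ^ J) mod P" using P by simp_all
    ultimately have "y * 2 ^ J - z * 2 ^ J < P" by linarith
    then have "(y - z) * 2 ^ J \<le> P" by (simp add: algebra_simps)
    then have "((y - z) * 2 ^ J) div 2 ^ J \<le> P div 2 ^ J" by (rule zdiv_mono1) simp
    then have "y - z \<le> P div 2 ^ J" by simp
    with \<open>z \<le> y\<close> show "y \<in> {z..z + P div 2 ^ J}" by simp
  qed
  then have "card ?A \<le> card {z..z + P div 2 ^ J}" by (intro card_mono) auto
  also have "\<dots> = nat (P div 2 ^ J + 1)" by simp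
  finally have le: "card ?A \<le> nat (P div 2 ^ J + 1)" .
  have "0 \<le> P div 2 ^ J" using P by (simp add: pos_imp_zdiv_nonneg_iff)
  with le have "int (card ?A) \<le> P div 2 ^ J + 1" by linarith
  then have "real_of_int (int (card ?A)) \<le> real_of_int (P div 2 ^ J + 1)"
    by (simp only: of_int_le_iff)
  then have "real (card ?A) \<le> real_of_int (P div 2 ^ J) + 1" by simp
  also have "real_of_int (P div 2 ^ J) \<le> real_of_int P / 2 ^ J"
    using real_of_int_div4[of P "2 ^ J"] by simp
  finally show ?thesis by simp
qed

text \<open>
  An interval seen after translation modulo \<open>P\<close> is an arc that may wrap around, yet four prefixes
  suffice: a translated prefix is the sum of the first two minus \<open>{0..<P - t}\<close>, and this last prefix
  cancels in the difference.
\<close>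

lemma interval_prefixes:
  fixes P y t a b :: int
  assumes "0 < P" "0 \<le> y" "y < P" "0 \<le> t" "t < P" "0 \<le> a" "a \<le> b" "b \<le> P"
  shows "of_bool ((y + t) mod P \<in> {a..<b}) =
    (of_bool (y < max 0 (b - t)) + of_bool (y < min P (P - t + b))
     - of_bool (y < max 0 (a - t)) - of_bool (y < min P (P - t + a)) :: real)"
proof (cases "y + t < P")
  case True
  then have "(y + t) mod P = y + t" using assms by (intro mod_pos_pos_trivial) auto
  then show ?thesis using assms True by auto
next
  case False
  have "(y + t) mod P = (y + t - P) mod P" by simp
  also have "\<dots> = y + t - P" using assms False by (intro mod_pos_pos_trivial) auto
  finally show ?thesis using assms False by auto
qed


definition mean :: "int \<Rightarrow> (int \<Rightarrow> real) \<Rightarrow> real" where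
  "mean P f = (\<Sum>y\<in>{0..<P}. f y) / real_of_int P"

lemma mean_prefix:
  assumes "0 < P" "0 \<le> a" "a \<le> P"
  shows "mean P (\<lambda>y. of_bool (y < a)) = real_of_int a / real_of_int P"
proof -
  have "(\<Sum>y\<in>{0..<P}. of_bool (y < a) :: real) = real (card ({0..<P} \<inter> {y. y < a}))"
    by (simp add: sum.inter_restrict[symmetric] of_bool_def if_distrib sum.If_cases)
  also have "{0..<P} \<inter> {y. y < a} = {0..<a}" using assms by auto
  finally show ?thesis using assms by (simp add: mean_def)
qed

lemma mean_interval:
  assumes "0 < P" "0 \<le> t" "t < P" "0 \<le> a" "a \<le> b" "b \<le> P"
  shows "mean P (\<lambda>y. of_bool ((y + t) mod P \<in> {a..<b})) = real_of_int (b - a) / real_of_int P"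
proof -
  have "mean P (\<lambda>y. of_bool ((y + t) mod P \<in> {a..<b})) =
      mean P (\<lambda>y. of_bool (y < max 0 (b - t))) + mean P (\<lambda>y. of_bool (y < min P (P - t + b)))
     - mean P (\<lambda>y. of_bool (y < max 0 (a - t))) - mean P (\<lambda>y. of_bool (y < min P (P - t + a)))"
    unfolding mean_def diff_divide_distrib[symmetric] add_divide_distrib[symmetric]
      sum.distrib[symmetric] sum_subtractf[symmetric]
    using assms by (intro arg_cong2[where f = "(/)"] sum.cong refl interval_prefixes) auto
  also have "\<dots> = real_of_int (b - a) / real_of_int P"
    using assms by (simp add: mean_prefix diff_divide_distrib[symmetric] add_divide_distrib[symmetric]
       divide_right_mono max_def min_def del: of_int_diff of_int_add) 
  finally show ?thesis .
qed

lemma card_cell_mean: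
  assumes P: "0 < P"
  shows "mean P (\<lambda>y. of_bool (cell P J y = b)) \<le> 1 / 2 ^ J + 1 / real_of_int P"
proof -
  have "(\<Sum>y\<in>{0..<P}. of_bool (cell P J y = b) :: real) = real (card {y \<in> {0..<P}. cell P J y = b})"
    by (simp add: of_bool_def sum.inter_filter[symmetric])
  with card_cell[OF P, of J b] show ?thesis
    using P by (simp add: mean_def field_simps)
qed

lemma prod_of_bool:
  fixes m :: nat
  shows "(\<Prod>c<m. of_bool (Q c) :: real) = of_bool (\<forall>c<m. Q c)"
  by (induction m) (auto simp: less_Suc_eq)

lemma sum_of_bool_card: "finite A \<Longrightarrow> (\<Sum>a\<in>A. of_bool (Q a) :: real) = real (card {a \<in> A. Q a})"
  by (simp add: of_bool_def sum.If_cases Int_def)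

section \<open>Deviations of point counts\<close>

text \<open>
  Deviation of the points \<open>y n\<close> from uniform distribution on the residues modulo \<open>P\<close>, tested with a
  product function \<open>f\<close> in space and a weight \<open>\<phi>\<close> in time. Keeping both general makes it multilinear,
  so that decompositions of indicator functions turn into decompositions of deviations.
\<close>

definition deviation :: "nat \<Rightarrow> nat \<Rightarrow> int \<Rightarrow> (nat \<Rightarrow> nat \<Rightarrow> int) \<Rightarrow> (nat \<Rightarrow> real) \<Rightarrow> (nat \<Rightarrow> int \<Rightarrow> real) \<Rightarrow> real" where
  "deviation L m P y \<phi> f = (\<Sum>n<L. \<phi> n * ((\<Prod>c<m. f c (y n c)) - (\<Prod>c<m. mean P (f c))))"

lemma deviation_cong:
  assumes "\<And>n. n < L \<Longrightarrow> \<phi> n = \<psi> n" "\<And>c u. c < m \<Longrightarrow> 0 \<le> u \<Longrightarrow> u < P \<Longrightarrow> f c u = g c u"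
    and "\<And>n c. n < L \<Longrightarrow> c < m \<Longrightarrow> y n c \<in> {0..<P}"
  shows "deviation L m P y \<phi> f = deviation L m P y \<psi> g"
proof -
  have "mean P (f c) = mean P (g c)" if "c < m" for c
    unfolding mean_def using assms(2) that by (intro arg_cong2[where f = "(/)"] sum.cong) auto
  then have "(\<Prod>c<m. mean P (f c)) = (\<Prod>c<m. mean P (g c))" by (intro prod.cong) auto
  moreover have "(\<Prod>c<m. f c (y n c)) = (\<Prod>c<m. g c (y n c))" if "n < L" for n
    using assms(2,3) that by (intro prod.cong) auto
  ultimately show ?thesis unfolding deviation_def using assms(1) by (intro sum.cong) auto
qed

lemma deviation_sum_time:
  "deviation L m P y (\<lambda>n. \<Sum>i\<in>I. \<phi> i n) f = (\<Sum>i\<in>I. deviation L m P y (\<phi> i) f)"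
  unfolding deviation_def by (subst sum.swap) (simp add: sum_distrib_right)

lemma deviation_scale:
  "deviation L m P y (\<lambda>n. a * \<phi> n) (\<lambda>c u. \<sigma> c * f c u) = a * (\<Prod>c<m. \<sigma> c) * deviation L m P y \<phi> f"
proof -
  have "mean P (\<lambda>u. \<sigma> c * f c u) = \<sigma> c * mean P (f c)" for c
    by (simp add: mean_def sum_distrib_left)
  then show ?thesis
    by (simp add: deviation_def prod.distrib sum_distrib_left algebra_simps)
qed

lemma deviation_sum_space:
  assumes K: "finite K"
  shows "deviation L m P y \<phi> (\<lambda>c u. \<Sum>k\<in>K. g c k u) =
    (\<Sum>k\<in>{..<m} \<rightarrow>\<^sub>E K. deviation L m P y \<phi> (\<lambda>c. g c (k c)))"
proof -
  have "mean P (\<lambda>u. \<Sum>k\<in>K. g c k u) = (\<Sum>k\<in>K. mean P (g c k))" for c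
    unfolding mean_def by (subst sum.swap) (simp add: sum_divide_distrib)
  then have "(\<Prod>c<m. mean P (\<lambda>u. \<Sum>k\<in>K. g c k u)) =
      (\<Sum>k\<in>{..<m} \<rightarrow>\<^sub>E K. \<Prod>c<m. mean P (g c (k c)))"
    using K by (simp add: prod_sum_PiE)
  moreover have "(\<Prod>c<m. \<Sum>k\<in>K. g c k (y n c)) = (\<Sum>k\<in>{..<m} \<rightarrow>\<^sub>E K. \<Prod>c<m. g c (k c) (y n c))" for n
    using K by (simp add: prod_sum_PiE)
  ultimately show ?thesis
    unfolding deviation_def sum_subtractf[symmetric]
    by (simp add: sum_subtractf[symmetric] sum_distrib_left) (rule sum.swap)
qed

text \<open>
  The root of the sum of the squared deviations over all cells of one level \<open>i\<close> in time and one
  multi-level \<open>l\<close> in space. It dominates each of these deviations and, unlike their maximum, has a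
  computable mean square.
\<close>

definition energy :: "nat \<Rightarrow> nat \<Rightarrow> int \<Rightarrow> (nat \<Rightarrow> nat \<Rightarrow> int) \<Rightarrow> nat \<Rightarrow> (nat \<Rightarrow> nat) \<Rightarrow> real" where
  "energy J m P y i l = sqrt (\<Sum>t\<in>{0..<2 ^ i}. \<Sum>B\<in>(\<Pi>\<^sub>E c\<in>{..<m}. {0..<2 ^ l c}).
     (deviation (2 ^ J) m P y (\<lambda>n. of_bool (cell (2 ^ J) i (int n) = t))
        (\<lambda>c u. of_bool (cell P (l c) u = B c)))\<^sup>2)"

lemma energy_nonneg: "0 \<le> energy J m P y i l"
  unfolding energy_def by (intro real_sqrt_ge_zero sum_nonneg) auto

text \<open>
  The indices \<open>t\<close> and \<open>B\<close> are arbitrary, since the pieces of a prefix may carry an index outside the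
  range of the cells; such a cell is empty and has deviation 0.
\<close>

lemma deviation_cell_le_energy:
  assumes m: "0 < m" and y: "\<And>n c. n < 2 ^ J \<Longrightarrow> c < m \<Longrightarrow> y n c \<in> {0..<P}"
  shows "\<bar>deviation (2 ^ J) m P y (\<lambda>n. of_bool (cell (2 ^ J) i (int n) = t))
        (\<lambda>c u. of_bool (cell P (l c) u = B c))\<bar> \<le> energy J m P y i l"
proof -
  let ?d = "\<lambda>t B. deviation (2 ^ J) m P y (\<lambda>n. of_bool (cell (2 ^ J) i (int n) = t))
        (\<lambda>c u. of_bool (cell P (l c) u = B c))"
  let ?R = "\<Pi>\<^sub>E c\<in>{..<m}. {0..<2 ^ l c} :: int set"
  consider "t \<notin> {0..<2 ^ i}" | c where "c < m" "B c \<notin> {0..<2 ^ l c}"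
    | "t \<in> {0..<2 ^ i}" "\<And>c. c < m \<Longrightarrow> B c \<in> {0..<2 ^ l c}"
    by blast
  then show ?thesis
  proof cases
    case 1
    have "cell (2 ^ J) i (int n) \<noteq> t" if "n < 2 ^ J" for n
    proof -
      have "int n < 2 ^ J" using that by (metis of_nat_less_iff of_nat_numeral of_nat_power)
      with cell_range[of "int n" "2 ^ J" i] 1 show ?thesis by auto
    qed
    then have "?d t B = 0" unfolding deviation_def by (intro sum.neutral) auto
    then show ?thesis using energy_nonneg by simp
  next
    case 2
    have no: "cell P (l c) u \<noteq> B c" if "0 \<le> u" "u < P" for u
      using cell_range[OF that, of "l c"] 2 by auto
    have mean: "(\<Prod>c<m. mean P (\<lambda>u. of_bool (cell P (l c) u = B c))) = 0"
      using 2(1) no by (intro prod_zero) (auto simp: mean_def intro!: bexI[of _ c])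
    have point: "(\<Prod>c<m. of_bool (cell P (l c) (y n c) = B c)) = (0::real)" if "n \<in> {..<2 ^ J}" for n
      using 2(1) no y[of n c] that by (intro prod_zero) (auto intro!: bexI[of _ c])
    have "?d t B = 0" unfolding deviation_def mean
      by (intro sum.neutral ballI) (simp only: point diff_self mult_zero_right)
    then show ?thesis using energy_nonneg by simp
  next
    case 3
    \<comment> \<open>Only the values of \<open>B\<close> below \<open>m\<close> matter; the energy sums over extensional index functions.\<close>
    let ?B = "restrict B {..<m}"
    have B: "?B \<in> ?R" using 3(2) by auto
    have fin: "finite ?R" by (intro finite_PiE) auto
    have "?d t B = ?d t ?B" by (intro deviation_cong y) auto
    then have "(?d t B)\<^sup>2 \<le> (\<Sum>B\<in>?R. (?d t B)\<^sup>2)"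
      using member_le_sum[OF B, of "\<lambda>B. (?d t B)\<^sup>2"] fin by simp
    also have "\<dots> \<le> (\<Sum>t\<in>{0..<2 ^ i}. \<Sum>B\<in>?R. (?d t B)\<^sup>2)"
      using 3(1) by (intro member_le_sum[of t _ "\<lambda>t. \<Sum>B\<in>?R. (?d t B)\<^sup>2"]) (auto intro: sum_nonneg)
    finally show ?thesis unfolding energy_def by (rule real_le_rsqrt[of "\<bar>_\<bar>", simplified])
  qed
qed

lemma deviation_prefix_cell_le_energy:
  assumes m: "0 < m" and y: "\<And>n c. n < 2 ^ J \<Longrightarrow> c < m \<Longrightarrow> y n c \<in> {0..<P}" and N: "N \<le> 2 ^ J"
  shows "\<bar>deviation (2 ^ J) m P y (\<lambda>n. of_bool (n < N)) (\<lambda>c u. of_bool (cell P (l c) u = B c))\<bar>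
    \<le> (\<Sum>i\<le>J. energy J m P y i l)"
proof -
  let ?f = "\<lambda>c u. of_bool (cell P (l c) u = B c) :: real"
  let ?t = "\<lambda>i. cell (2 ^ J) i (int N)"
  have N': "int N \<le> 2 ^ J" using N by (metis of_nat_le_iff of_nat_numeral of_nat_power)
  have "deviation (2 ^ J) m P y (\<lambda>n. of_bool (n < N)) ?f =
      deviation (2 ^ J) m P y (\<lambda>n. \<Sum>i\<le>J. of_bool (odd (?t i)) * of_bool (cell (2 ^ J) i (int n) = ?t i - 1)) ?f"
  proof (rule deviation_cong)
    fix n :: nat assume "n < 2 ^ J"
    then have n: "int n < 2 ^ J" by (metis of_nat_less_iff of_nat_numeral of_nat_power)
    have "of_bool (n < N) = (of_bool (cell (2 ^ J) J (int n) < cell (2 ^ J) J (int N)) :: real)"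
      by (simp add: cell_def)
    also have "\<dots> = (\<Sum>i\<le>J. of_bool (odd (?t i) \<and> cell (2 ^ J) i (int n) = ?t i - 1))"
      using n N' by (intro prefix_dyadic) auto
    finally show "of_bool (n < N) = (\<Sum>i\<le>J. of_bool (odd (?t i)) *
        of_bool (cell (2 ^ J) i (int n) = ?t i - 1) :: real)"
      by (simp add: of_bool_conj)
  qed (use y in auto)
  also have "\<dots> = (\<Sum>i\<le>J. of_bool (odd (?t i)) *
      deviation (2 ^ J) m P y (\<lambda>n. of_bool (cell (2 ^ J) i (int n) = ?t i - 1)) ?f)"
    unfolding deviation_sum_time using deviation_scale[of _ m P y _ _ "\<lambda>_. 1" ?f] by simp
  finally have eq: "deviation (2 ^ J) m P y (\<lambda>n. of_bool (n < N)) ?f = (\<Sum>i\<le>J. of_bool (odd (?t i)) *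
      deviation (2 ^ J) m P y (\<lambda>n. of_bool (cell (2 ^ J) i (int n) = ?t i - 1)) ?f)" .
  have "\<bar>deviation (2 ^ J) m P y (\<lambda>n. of_bool (n < N)) ?f\<bar> \<le> (\<Sum>i\<le>J. \<bar>of_bool (odd (?t i)) *
      deviation (2 ^ J) m P y (\<lambda>n. of_bool (cell (2 ^ J) i (int n) = ?t i - 1)) ?f\<bar>)"
    unfolding eq by (rule sum_abs)
  also have "\<dots> \<le> (\<Sum>i\<le>J. energy J m P y i l)"
  proof (rule sum_mono)
    fix i
    show "\<bar>of_bool (odd (?t i)) *
      deviation (2 ^ J) m P y (\<lambda>n. of_bool (cell (2 ^ J) i (int n) = ?t i - 1)) ?f\<bar> \<le> energy J m P y i l"
      using deviation_cell_le_energy[OF m y, where i = i and t = "?t i - 1" and l = l and B = B] energy_nonneg[of J m P y i l]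
      by (cases "odd (?t i)") auto
  qed
  finally show ?thesis .
qed

lemma mean_nonneg: "0 < P \<Longrightarrow> (\<And>u. 0 \<le> f u) \<Longrightarrow> 0 \<le> mean P f"
  by (simp add: mean_def sum_nonneg)

lemma mean_mono: "0 < P \<Longrightarrow> (\<And>u. f u \<le> g u) \<Longrightarrow> mean P f \<le> mean P g"
  by (simp add: mean_def divide_right_mono sum_mono)

lemma mean_of_bool_le_1: "0 < P \<Longrightarrow> mean P (\<lambda>u. of_bool (Q u)) \<le> 1"
proof -
  assume P: "0 < P"
  have "mean P (\<lambda>u. of_bool (Q u)) \<le> mean P (\<lambda>_. 1)" using P by (intro mean_mono) auto
  also have "\<dots> = 1" using P by (simp add: mean_def)
  finally show ?thesis .
qed

text \<open>
  Whole cells are controlled by the energy. If one factor is a remainder, the product is squeezed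
  between 0 and the product of the enclosing cells, one of which has level \<open>J\<close> and relative size at most
  \<open>1 / 2 ^ J + 1 / P\<close>; over at most \<open>2 ^ J \<le> P\<close> times its expected count is at most 2, and the error is
  at most twice that.
\<close>

lemma deviation_pieces_bound:
  assumes m: "0 < m" and y: "\<And>n c. n < 2 ^ J \<Longrightarrow> c < m \<Longrightarrow> y n c \<in> {0..<P}" and N: "N \<le> 2 ^ J"
    and P: "2 ^ J \<le> P"
  shows "\<bar>deviation (2 ^ J) m P y (\<lambda>n. of_bool (n < N)) (\<lambda>c. piece P J (a c) (l c))\<bar>
    \<le> 4 + (\<Sum>i\<le>J. energy J m P y i (\<lambda>c. min (l c) J))"
proof -
  let ?\<phi> = "\<lambda>n. of_bool (n < N) :: real"
  let ?b = "\<lambda>c. piece_index P J (a c) (l c)"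
  let ?g = "\<lambda>c u. of_bool (cell P (min (l c) J) u = ?b c) :: real"
  let ?f = "\<lambda>c. piece P J (a c) (l c)"
  let ?E = "\<Sum>i\<le>J. energy J m P y i (\<lambda>c. min (l c) J)"
  have P0: "0 < P" using P by (rule less_le_trans[rotated]) simp
  have E: "\<bar>deviation (2 ^ J) m P y ?\<phi> ?g\<bar> \<le> ?E"
    by (rule deviation_prefix_cell_le_energy[OF m y N])
  show ?thesis
  proof (cases "\<forall>c<m. l c \<le> J")
    case True
    define \<kappa> :: "nat \<Rightarrow> real" where "\<kappa> c = of_bool (odd (cell P (l c) (a c)))" for c
    have "deviation (2 ^ J) m P y ?\<phi> ?f = deviation (2 ^ J) m P y (\<lambda>n. 1 * ?\<phi> n) (\<lambda>c u. \<kappa> c * ?g c u)"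
      using True y by (intro deviation_cong) (auto simp: piece_eq_cell \<kappa>_def)
    also have "\<dots> = 1 * (\<Prod>c<m. \<kappa> c) * deviation (2 ^ J) m P y ?\<phi> ?g" by (rule deviation_scale)
    finally have "\<bar>deviation (2 ^ J) m P y ?\<phi> ?f\<bar> = \<bar>\<Prod>c<m. \<kappa> c\<bar> * \<bar>deviation (2 ^ J) m P y ?\<phi> ?g\<bar>"
      by (simp add: abs_mult)
    moreover have "\<bar>\<Prod>c<m. \<kappa> c\<bar> \<le> 1"
      unfolding abs_prod by (intro prod_le_1) (auto simp: \<kappa>_def)
    then have "\<bar>\<Prod>c<m. \<kappa> c\<bar> * \<bar>deviation (2 ^ J) m P y ?\<phi> ?g\<bar> \<le> 1 * \<bar>deviation (2 ^ J) m P y ?\<phi> ?g\<bar>"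
      by (rule mult_right_mono) simp
    ultimately show ?thesis using E energy_nonneg by linarith
  next
    case False
    then obtain c where c: "c < m" "J < l c" by auto
    define \<mu> where "\<mu> = (\<Prod>c<m. mean P (?f c))"
    define \<mu>' where "\<mu>' = (\<Prod>c<m. mean P (?g c))"
    define A where "A n = (\<Prod>c<m. ?f c (y n c))" for n
    define A' where "A' n = (\<Prod>c<m. ?g c (y n c))" for n
    have A: "0 \<le> A n" "A n \<le> A' n" for n
      unfolding A_def A'_def by (intro prod_nonneg prod_mono conjI ballI piece_nonneg piece_le_cell)+
    have \<mu>: "0 \<le> \<mu>" "\<mu> \<le> \<mu>'"
      unfolding \<mu>_def \<mu>'_def
      by (intro prod_nonneg prod_mono conjI ballI mean_nonneg mean_mono P0 piece_nonneg piece_le_cell)+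
    have "\<mu>' = mean P (?g c) * (\<Prod>c\<in>{..<m} - {c}. mean P (?g c))"
      unfolding \<mu>'_def using c by (subst prod.remove[of _ c]) auto
    moreover have "\<dots> \<le> mean P (?g c) * 1"
      by (intro mult_left_mono prod_le_1 conjI mean_nonneg mean_of_bool_le_1 P0) auto
    moreover have "mean P (?g c) \<le> 1 / 2 ^ J + 1 / real_of_int P"
      using card_cell_mean[OF P0, of J "?b c"] c by (simp add: min_def)
    ultimately have \<mu>'_le: "\<mu>' \<le> 1 / 2 ^ J + 1 / real_of_int P" by linarith
    have NR: "real N \<le> 2 ^ J" using N by (metis of_nat_le_iff of_nat_numeral of_nat_power)
    have PR: "2 ^ J \<le> real_of_int P" using P by (metis of_int_le_iff of_int_numeral of_int_power)
    have "real N * \<mu>' \<le> 2 ^ J * (1 / 2 ^ J + 1 / real_of_int P)"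
      using \<mu> by (intro mult_mono[OF NR \<mu>'_le]) auto
    moreover have "2 ^ J * (1 / 2 ^ J + 1 / real_of_int P) = 1 + 2 ^ J / real_of_int P"
      by (simp add: distrib_left)
    moreover have "2 ^ J / real_of_int P \<le> 1"
      using PR P0 by (simp add: divide_le_eq)
    ultimately have N\<mu>: "real N * \<mu>' \<le> 2" by linarith
    have restr: "(\<Sum>n<2 ^ J. ?\<phi> n * h n) = (\<Sum>n<N. h n)" for h :: "nat \<Rightarrow> real"
    proof -
      have set: "{n \<in> {..<2 ^ J}. n < N} = {..<N}" using N by auto
      have "(\<Sum>n<2 ^ J. ?\<phi> n * h n) = (\<Sum>n<2 ^ J. if n < N then h n else 0)"
        by (intro sum.cong) auto
      also have "\<dots> = (\<Sum>n\<in>{n \<in> {..<2 ^ J}. n < N}. h n)"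
        by (rule sum.inter_filter[symmetric]) simp
      finally show ?thesis unfolding set .
    qed
    have deviation_f: "deviation (2 ^ J) m P y ?\<phi> ?f = (\<Sum>n<N. A n - \<mu>)"
      unfolding deviation_def A_def \<mu>_def by (rule restr)
    have deviation_g: "deviation (2 ^ J) m P y ?\<phi> ?g = (\<Sum>n<N. A' n - \<mu>')"
      unfolding deviation_def A'_def \<mu>'_def by (rule restr)
    have "\<bar>\<Sum>n<N. A n - \<mu>\<bar> \<le> (\<Sum>n<N. \<bar>A n - \<mu>\<bar>)" by (rule sum_abs)
    also have "\<dots> \<le> (\<Sum>n<N. (A' n - \<mu>') + 2 * \<mu>')"
    proof (rule sum_mono)
      fix n show "\<bar>A n - \<mu>\<bar> \<le> (A' n - \<mu>') + 2 * \<mu>'" using A[of n] \<mu> by linarith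
    qed
    also have "\<dots> = (\<Sum>n<N. A' n - \<mu>') + 2 * (real N * \<mu>')"
      by (simp add: sum_subtractf sum.distrib)
    finally show ?thesis using E N\<mu> unfolding deviation_f deviation_g by linarith
  qed
qed

text \<open>
  The bound holds for every translation \<open>\<tau>\<close>, while the left-hand side does not depend on \<open>\<tau>\<close>. This is
  what allows averaging over \<open>\<tau>\<close> later. The index \<open>k\<close> selects in every coordinate one of four prefixes
  and one of its pieces.
\<close>

lemma box_count_le_energy:
  fixes x :: "nat \<Rightarrow> nat \<Rightarrow> int" and a b \<tau> :: "nat \<Rightarrow> int"
  assumes m: "0 < m" and N: "N \<le> 2 ^ J" and P: "2 ^ J \<le> P"
    and x: "\<And>n c. n < 2 ^ J \<Longrightarrow> c < m \<Longrightarrow> x n c \<in> {0..<P}"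
    and \<tau>: "\<And>c. c < m \<Longrightarrow> \<tau> c \<in> {0..<P}"
    and ab: "\<And>c. c < m \<Longrightarrow> 0 \<le> a c \<and> a c \<le> b c \<and> b c \<le> P"
  shows "\<bar>real (card {n. n < N \<and> (\<forall>c<m. x n c \<in> {a c..<b c})})
      - real N * (\<Prod>c<m. real_of_int (b c - a c) / real_of_int P)\<bar> \<le>
    (\<Sum>k\<in>{..<m} \<rightarrow>\<^sub>E ({..<4::nat} \<times> {..Suc J}).
       4 + (\<Sum>i\<le>J. energy J m P (\<lambda>n c. (x n c - \<tau> c) mod P) i (\<lambda>c. min (snd (k c)) J)))"
proof -
  define y where "y = (\<lambda>n c. (x n c - \<tau> c) mod P)"
  have P0: "0 < P" using P by (rule less_le_trans[rotated]) simp
  have y: "y n c \<in> {0..<P}" for n c using P0 by (simp add: y_def)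
  \<comment> \<open>The end points and the signs of the four prefixes that make up a translated interval.\<close>
  define e where "e c s = (if s = 0 then max 0 (b c - \<tau> c) else if s = 1 then min P (P - \<tau> c + b c)
    else if s = 2 then max 0 (a c - \<tau> c) else min P (P - \<tau> c + a c))" for c and s :: nat
  define \<sigma> :: "nat \<Rightarrow> real" where "\<sigma> s = (if s < 2 then 1 else - 1)" for s
  let ?\<phi> = "\<lambda>n. of_bool (n < N) :: real"
  let ?K = "{..<4::nat} \<times> {..Suc J}"
  let ?f = "\<lambda>c u. of_bool ((u + \<tau> c) mod P \<in> {a c..<b c}) :: real"
  have f_pieces: "?f c u = (\<Sum>k\<in>?K. \<sigma> (fst k) * piece P J (e c (fst k)) (snd k) u)"
    if "c < m" "0 \<le> u" "u < P" for c u
  proof -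
    have e: "0 \<le> e c s \<and> e c s \<le> P" for s
      using ab[OF that(1)] \<tau>[OF that(1)] by (auto simp: e_def)
    have "(\<Sum>k\<in>?K. \<sigma> (fst k) * piece P J (e c (fst k)) (snd k) u) =
        (\<Sum>s<4. \<Sum>l\<le>Suc J. \<sigma> s * piece P J (e c s) l u)"
      by (subst sum.cartesian_product) (simp add: case_prod_beta)
    also have "\<dots> = (\<Sum>s<4. \<sigma> s * (\<Sum>l\<le>Suc J. piece P J (e c s) l u))"
      by (simp only: sum_distrib_left)
    also have "\<dots> = (\<Sum>s<4. \<sigma> s * of_bool (u < e c s))"
    proof (rule sum.cong[OF refl])
      fix s
      have "of_bool (u < e c s) = (\<Sum>l\<le>Suc J. piece P J (e c s) l u)"
        using e[of s] that by (intro prefix_pieces P0) auto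
      then show "\<sigma> s * (\<Sum>l\<le>Suc J. piece P J (e c s) l u) = \<sigma> s * of_bool (u < e c s)"
        by (simp only:)
    qed
    also have "\<dots> = ?f c u"
      using ab[OF that(1)] \<tau>[OF that(1)] that P0
      by (subst interval_prefixes) (auto simp: numeral_eq_Suc \<sigma>_def e_def)
    finally show ?thesis by simp
  qed
  have deviation: "deviation (2 ^ J) m P y ?\<phi> ?f = real (card {n. n < N \<and> (\<forall>c<m. x n c \<in> {a c..<b c})})
      - real N * (\<Prod>c<m. real_of_int (b c - a c) / real_of_int P)"
  proof -
    let ?v = "\<Prod>c<m. real_of_int (b c - a c) / real_of_int P"
    have mean: "(\<Prod>c<m. mean P (?f c)) = ?v"
      using ab \<tau> P0 by (intro prod.cong mean_interval) auto
    have unshift: "(y n c + \<tau> c) mod P = x n c" if "n < 2 ^ J" "c < m" for n c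
      using x[OF that] by (simp add: y_def mod_simps)
    have "deviation (2 ^ J) m P y ?\<phi> ?f =
        (\<Sum>n<2 ^ J. of_bool (n < N \<and> (\<forall>c<m. x n c \<in> {a c..<b c})) - ?\<phi> n * ?v)"
      unfolding deviation_def mean
    proof (rule sum.cong[OF refl])
      fix n assume n: "n \<in> {..<(2::nat) ^ J}"
      have "(\<Prod>c<m. ?f c (y n c)) = of_bool (\<forall>c<m. (y n c + \<tau> c) mod P \<in> {a c..<b c})"
        by (rule prod_of_bool)
      moreover have "(\<forall>c<m. (y n c + \<tau> c) mod P \<in> {a c..<b c}) \<longleftrightarrow> (\<forall>c<m. x n c \<in> {a c..<b c})"
        using unshift n by simp
      ultimately show "?\<phi> n * ((\<Prod>c<m. ?f c (y n c)) - ?v) =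
          of_bool (n < N \<and> (\<forall>c<m. x n c \<in> {a c..<b c})) - ?\<phi> n * ?v"
        by (simp only: right_diff_distrib of_bool_conj)
    qed
    moreover have "(\<Sum>n<2 ^ J. of_bool (n < N \<and> (\<forall>c<m. x n c \<in> {a c..<b c})) :: real) =
        real (card {n. n < N \<and> (\<forall>c<m. x n c \<in> {a c..<b c})})"
    proof -
      have set: "{n \<in> {..<2 ^ J}. n < N \<and> (\<forall>c<m. x n c \<in> {a c..<b c})} =
          {n. n < N \<and> (\<forall>c<m. x n c \<in> {a c..<b c})}" using N by auto
      show ?thesis unfolding set[symmetric] by (rule sum_of_bool_card) simp
    qed
    moreover have "(\<Sum>n<2 ^ J. ?\<phi> n * ?v) = real N * ?v"
    proof -
      have set: "{n \<in> {..<2 ^ J}. n < N} = {..<N}" using N by auto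
      have "(\<Sum>n<2 ^ J. ?\<phi> n) = real (card {n \<in> {..<2 ^ J}. n < N})"
        by (rule sum_of_bool_card) simp
      then have "(\<Sum>n<2 ^ J. ?\<phi> n) = real N" unfolding set by simp
      then show ?thesis by (simp only: sum_distrib_right[symmetric])
    qed
    ultimately show ?thesis by (simp only: sum_subtractf)
  qed
  have "deviation (2 ^ J) m P y ?\<phi> ?f =
      deviation (2 ^ J) m P y ?\<phi> (\<lambda>c u. \<Sum>k\<in>?K. \<sigma> (fst k) * piece P J (e c (fst k)) (snd k) u)"
    using f_pieces y by (intro deviation_cong) auto
  also have "\<dots> = (\<Sum>k\<in>{..<m} \<rightarrow>\<^sub>E ?K.
      deviation (2 ^ J) m P y ?\<phi> (\<lambda>c u. \<sigma> (fst (k c)) * piece P J (e c (fst (k c))) (snd (k c)) u))"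
    by (rule deviation_sum_space) simp
  finally have eq: "deviation (2 ^ J) m P y ?\<phi> ?f = (\<Sum>k\<in>{..<m} \<rightarrow>\<^sub>E ?K.
      deviation (2 ^ J) m P y ?\<phi> (\<lambda>c u. \<sigma> (fst (k c)) * piece P J (e c (fst (k c))) (snd (k c)) u))" .
  have "\<bar>deviation (2 ^ J) m P y ?\<phi> ?f\<bar> \<le> (\<Sum>k\<in>{..<m} \<rightarrow>\<^sub>E ?K.
      \<bar>deviation (2 ^ J) m P y ?\<phi> (\<lambda>c u. \<sigma> (fst (k c)) * piece P J (e c (fst (k c))) (snd (k c)) u)\<bar>)"
    unfolding eq by (rule sum_abs)
  also have "\<dots> \<le> (\<Sum>k\<in>{..<m} \<rightarrow>\<^sub>E ?K. 4 + (\<Sum>i\<le>J. energy J m P y i (\<lambda>c. min (snd (k c)) J)))"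
  proof (rule sum_mono)
    fix k :: "nat \<Rightarrow> nat \<times> nat"
    have "\<bar>\<Prod>c<m. \<sigma> (fst (k c))\<bar> = 1" unfolding abs_prod by (intro prod.neutral) (simp add: \<sigma>_def)
    then have "\<bar>deviation (2 ^ J) m P y ?\<phi> (\<lambda>c u. \<sigma> (fst (k c)) * piece P J (e c (fst (k c))) (snd (k c)) u)\<bar> =
      \<bar>deviation (2 ^ J) m P y ?\<phi> (\<lambda>c. piece P J (e c (fst (k c))) (snd (k c)))\<bar>"
      using deviation_scale[of "2 ^ J" m P y 1 ?\<phi> "\<lambda>c. \<sigma> (fst (k c))" "\<lambda>c. piece P J (e c (fst (k c))) (snd (k c))"]
      by (simp add: abs_mult)
    also have "\<dots> \<le> 4 + (\<Sum>i\<le>J. energy J m P y i (\<lambda>c. min (snd (k c)) J))"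
      using y by (intro deviation_pieces_bound m N P) auto
    finally show "\<bar>deviation (2 ^ J) m P y ?\<phi> (\<lambda>c u. \<sigma> (fst (k c)) * piece P J (e c (fst (k c))) (snd (k c)) u)\<bar>
      \<le> 4 + (\<Sum>i\<le>J. energy J m P y i (\<lambda>c. min (snd (k c)) J))" .
  qed
  finally show ?thesis unfolding deviation y_def[symmetric] .
qed

section \<open>The second moment over random translations\<close>

lemma sum_shift_indicator:
  fixes x P :: int
  assumes P: "0 < P" and B: "B \<subseteq> {0..<P}"
  shows "(\<Sum>t\<in>{0..<P}. of_bool ((x - t) mod P \<in> B) :: real) = real (card B)"
proof -
  have inv: "(x - (x - t) mod P) mod P = t" if "t \<in> {0..<P}" for t
    using that by (simp add: mod_simps)
  have "bij_betw (\<lambda>t. (x - t) mod P) {t \<in> {0..<P}. (x - t) mod P \<in> B} B"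
    by (rule bij_betw_byWitness[where f' = "\<lambda>t. (x - t) mod P"]) (use B P inv in \<open>auto simp: subset_iff\<close>)
  then have "card {t \<in> {0..<P}. (x - t) mod P \<in> B} = card B" by (rule bij_betw_same_card)
  moreover have "(\<Sum>t\<in>{0..<P}. of_bool ((x - t) mod P \<in> B) :: real) =
      real (card {t \<in> {0..<P}. (x - t) mod P \<in> B})"
    by (rule sum_of_bool_card) simp
  ultimately show ?thesis by simp
qed

lemma sum_shift_pair_le:
  fixes x x' P :: int
  assumes P: "0 < P" and B: "B \<subseteq> {0..<P}"
  shows "(\<Sum>t\<in>{0..<P}. of_bool ((x - t) mod P \<in> B) * of_bool ((x' - t) mod P \<in> B) :: real) \<le>
    (\<Sum>b\<in>B \<times> B. of_bool ([x - x' = fst b - snd b] (mod P)))"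
proof -
  have finB: "finite B" using B by (rule finite_subset) simp
  let ?A = "{t \<in> {0..<P}. (x - t) mod P \<in> B \<and> (x' - t) mod P \<in> B}"
  let ?D = "{b \<in> B \<times> B. [x - x' = fst b - snd b] (mod P)}"
  have "inj_on (\<lambda>t. ((x - t) mod P, (x' - t) mod P)) ?A"
  proof (rule inj_onI)
    fix t u assume tu: "t \<in> ?A" "u \<in> ?A"
      and "((x - t) mod P, (x' - t) mod P) = ((x - u) mod P, (x' - u) mod P)"
    then have "(x - t) mod P = (x - u) mod P" by simp
    then have "(x - (x - t) mod P) mod P = (x - (x - u) mod P) mod P" by simp
    then show "t = u" using tu by (simp add: mod_simps)
  qed
  moreover have "(\<lambda>t. ((x - t) mod P, (x' - t) mod P)) ` ?A \<subseteq> ?D"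
    by (auto simp: cong_def mod_simps)
  moreover have "finite ?D" using finB by simp
  ultimately have "card ?A \<le> card ?D" by (rule card_inj_on_le)
  moreover have "(\<Sum>t\<in>{0..<P}. of_bool ((x - t) mod P \<in> B) * of_bool ((x' - t) mod P \<in> B) :: real) =
      real (card ?A)"
  proof -
    have "(\<Sum>t\<in>{0..<P}. of_bool ((x - t) mod P \<in> B) * of_bool ((x' - t) mod P \<in> B) :: real) =
      (\<Sum>t\<in>{0..<P}. of_bool ((x - t) mod P \<in> B \<and> (x' - t) mod P \<in> B))"
      by (simp add: of_bool_conj)
    also have "\<dots> = real (card ?A)" by (rule sum_of_bool_card) simp
    finally show ?thesis .
  qed
  moreover have "(\<Sum>b\<in>B \<times> B. of_bool ([x - x' = fst b - snd b] (mod P)) :: real) = real (card ?D)"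
    using finB by (intro sum_of_bool_card) simp
  ultimately show ?thesis by simp
qed

lemma sum_of_bool_mult:
  assumes "finite A"
  shows "(\<Sum>a\<in>A. of_bool (Q a) * h a :: real) = (\<Sum>a\<in>{a \<in> A. Q a}. h a)"
proof -
  have "(\<Sum>a\<in>A. of_bool (Q a) * h a) = (\<Sum>a\<in>A. if Q a then h a else 0)"
    by (intro sum.cong) auto
  also have "\<dots> = (\<Sum>a\<in>{a \<in> A. Q a}. h a)"
    using assms by (rule sum.inter_filter[symmetric])
  finally show ?thesis .
qed

text \<open>
  Outside a set of at most \<open>\<beta>\<close> parameters, no value of the difference of the points number \<open>n\<close> and
  \<open>n'\<close> is attained more than \<open>q\<close> times. For \<open>card V = q * P ^ m\<close> this is uniform distribution of the
  differences up to \<open>\<beta>\<close> exceptions.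
\<close>

definition few_collisions ::
  "'v set \<Rightarrow> ('v \<Rightarrow> nat \<Rightarrow> nat \<Rightarrow> int) \<Rightarrow> nat \<Rightarrow> int \<Rightarrow> real \<Rightarrow> real \<Rightarrow> nat \<Rightarrow> nat \<Rightarrow> bool" where
  "few_collisions V x m P q \<beta> n n' \<longleftrightarrow> (\<exists>Bad\<subseteq>V. real (card Bad) \<le> \<beta> \<and>
     (\<forall>d. real (card {v \<in> V - Bad. \<forall>c<m. [x v n c - x v n' c = d c] (mod P)}) \<le> q))"

definition box_indicator :: "nat \<Rightarrow> int \<Rightarrow> (nat \<Rightarrow> int set) \<Rightarrow> (nat \<Rightarrow> int) \<Rightarrow> (nat \<Rightarrow> int) \<Rightarrow> real" where
  "box_indicator m P B u \<tau> = (\<Prod>c<m. of_bool ((u c - \<tau> c) mod P \<in> B c))"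

lemma box_indicator_01: "0 \<le> box_indicator m P B u \<tau>" "box_indicator m P B u \<tau> \<le> 1"
  by (simp_all add: box_indicator_def prod_of_bool)

lemma box_indicator_square: "box_indicator m P B u \<tau> * box_indicator m P B u \<tau> = box_indicator m P B u \<tau>"
  by (auto simp: box_indicator_def prod_of_bool)

lemma sum_box_indicator:
  assumes P: "0 < P" and B: "\<And>c. c < m \<Longrightarrow> B c \<subseteq> {0..<P}"
  shows "(\<Sum>\<tau>\<in>{..<m} \<rightarrow>\<^sub>E {0..<P}. box_indicator m P B u \<tau>) = (\<Prod>c<m. real (card (B c)))"
proof -
  have "(\<Sum>\<tau>\<in>{..<m} \<rightarrow>\<^sub>E {0..<P}. box_indicator m P B u \<tau>) =
      (\<Prod>c<m. \<Sum>t\<in>{0..<P}. of_bool ((u c - t) mod P \<in> B c))"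
    unfolding box_indicator_def by (subst prod_sum_PiE) auto
  also have "\<dots> = (\<Prod>c<m. real (card (B c)))"
    using P B by (intro prod.cong sum_shift_indicator) auto
  finally show ?thesis .
qed

text \<open>
  If both points lie in the translated box, at positions \<open>b\<close> and \<open>b'\<close>, their difference is \<open>b - b'\<close> and
  the translation is determined by \<open>b\<close>. For each of the \<open>W\<^sup>2\<close> pairs of positions, where \<open>W\<close> is the volume of
  the box, at most \<open>q\<close> good parameters have this difference. A bad parameter admits at most
  \<open>W\<close> translations.
\<close>

lemma sum_pair_box_indicator:
  fixes x :: "'v \<Rightarrow> nat \<Rightarrow> nat \<Rightarrow> int"
  assumes V: "finite V" and P: "0 < P" and B: "\<And>c. c < m \<Longrightarrow> B c \<subseteq> {0..<P}" and q: "0 \<le> q"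
    and coll: "few_collisions V x m P q \<beta> n n'"
  shows "(\<Sum>v\<in>V. \<Sum>\<tau>\<in>{..<m} \<rightarrow>\<^sub>E {0..<P}. box_indicator m P B (x v n) \<tau> * box_indicator m P B (x v n') \<tau>)
    \<le> q * (\<Prod>c<m. real (card (B c)))\<^sup>2 + \<beta> * (\<Prod>c<m. real (card (B c)))"
proof -
  obtain Bad where Bad: "Bad \<subseteq> V" "real (card Bad) \<le> \<beta>"
    "\<And>d. real (card {v \<in> V - Bad. \<forall>c<m. [x v n c - x v n' c = d c] (mod P)}) \<le> q"
    using coll unfolding few_collisions_def by blast
  define W where "W = (\<Prod>c<m. real (card (B c)))"
  have W: "0 \<le> W" by (simp add: W_def prod_nonneg)
  define \<Theta> where "\<Theta> = ({..<m} \<rightarrow>\<^sub>E {0..<P})"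
  define S where "S v = (\<Sum>\<tau>\<in>\<Theta>. box_indicator m P B (x v n) \<tau> * box_indicator m P B (x v n') \<tau>)" for v
  define K where "K = (\<Pi>\<^sub>E c\<in>{..<m}. B c \<times> B c)"
  have finB: "finite (B c)" if "c < m" for c using B[OF that] by (rule finite_subset) simp
  have finK: "finite K" unfolding K_def using finB by (intro finite_PiE) auto
  have bad: "S v \<le> W" for v
  proof -
    have "S v \<le> (\<Sum>\<tau>\<in>\<Theta>. box_indicator m P B (x v n) \<tau> * 1)"
      unfolding S_def by (intro sum_mono mult_left_mono box_indicator_01)
    also have "\<dots> = W" using sum_box_indicator[OF P B] by (simp add: W_def \<Theta>_def)
    finally show ?thesis .
  qed
  have good: "S v \<le> (\<Sum>k\<in>K. of_bool (\<forall>c<m. [x v n c - x v n' c = fst (k c) - snd (k c)] (mod P)))" for v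
  proof -
    have "S v = (\<Prod>c<m. \<Sum>t\<in>{0..<P}. of_bool ((x v n c - t) mod P \<in> B c) * of_bool ((x v n' c - t) mod P \<in> B c))"
      unfolding S_def \<Theta>_def box_indicator_def by (subst prod_sum_PiE) (auto simp: prod.distrib)
    also have "\<dots> \<le> (\<Prod>c<m. \<Sum>b\<in>B c \<times> B c. of_bool ([x v n c - x v n' c = fst b - snd b] (mod P)))"
      using P B by (intro prod_mono conjI sum_shift_pair_le sum_nonneg) auto
    also have "\<dots> = (\<Sum>k\<in>K. \<Prod>c<m. of_bool ([x v n c - x v n' c = fst (k c) - snd (k c)] (mod P)))"
      unfolding K_def using finB by (subst prod_sum_PiE) auto
    finally show ?thesis by (simp add: prod_of_bool)
  qed
  have "(\<Sum>v\<in>V. S v) = (\<Sum>v\<in>V - Bad. S v) + (\<Sum>v\<in>Bad. S v)"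
    using Bad(1) V by (intro sum.subset_diff)
  moreover have "(\<Sum>v\<in>Bad. S v) \<le> \<beta> * W"
  proof -
    have "(\<Sum>v\<in>Bad. S v) \<le> (\<Sum>v\<in>Bad. W)" by (intro sum_mono bad)
    also have "\<dots> \<le> \<beta> * W" using Bad(2) W by (simp add: mult_right_mono)
    finally show ?thesis .
  qed
  moreover have "(\<Sum>v\<in>V - Bad. S v) \<le> q * W\<^sup>2"
  proof -
    let ?I = "\<lambda>v k. of_bool (\<forall>c<m. [x v n c - x v n' c = fst (k c) - snd (k c)] (mod P)) :: real"
    have "(\<Sum>v\<in>V - Bad. S v) \<le> (\<Sum>v\<in>V - Bad. \<Sum>k\<in>K. ?I v k)"
      by (intro sum_mono good)
    also have "\<dots> = (\<Sum>k\<in>K. \<Sum>v\<in>V - Bad. ?I v k)"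
      by (rule sum.swap)
    also have "\<dots> \<le> (\<Sum>k\<in>K. q)"
    proof (rule sum_mono)
      fix k :: "nat \<Rightarrow> int \<times> int"
      have "(\<Sum>v\<in>V - Bad. ?I v k) =
          real (card {v \<in> V - Bad. \<forall>c<m. [x v n c - x v n' c = fst (k c) - snd (k c)] (mod P)})"
        using V by (intro sum_of_bool_card) simp
      then show "(\<Sum>v\<in>V - Bad. ?I v k) \<le> q"
        using Bad(3)[of "\<lambda>c. fst (k c) - snd (k c)"] by (simp only:)
    qed
    also have "\<dots> = q * W\<^sup>2"
      by (simp add: K_def card_PiE W_def card_cartesian_product power2_eq_square prod.distrib)
    finally show ?thesis .
  qed
  ultimately have "(\<Sum>v\<in>V. S v) \<le> q * W\<^sup>2 + \<beta> * W" by linarith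
  then show ?thesis unfolding S_def \<Theta>_def W_def .
qed

text \<open>
  In the expansion of the square the terms of order \<open>W\<^sup>2\<close> cancel: the off-diagonal pairs give at most
  \<open>q * W\<^sup>2\<close> each, and \<open>q\<close> is exactly the density for which this matches the square of the mean. What remains
  is the diagonal and the bad parameters, both linear in \<open>W\<close>.
\<close>

lemma second_moment_box:
  fixes x :: "'v \<Rightarrow> nat \<Rightarrow> nat \<Rightarrow> int"
  assumes V: "finite V" and T: "finite T" and P: "0 < P" and B: "\<And>c. c < m \<Longrightarrow> B c \<subseteq> {0..<P}"
    and q: "0 \<le> q" and \<beta>: "0 \<le> \<beta>" and cardV: "real (card V) = q * real_of_int P ^ m"
    and coll: "\<And>n n'. n \<in> T \<Longrightarrow> n' \<in> T \<Longrightarrow> n \<noteq> n' \<Longrightarrow> few_collisions V x m P q \<beta> n n'"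
  defines "W \<equiv> \<Prod>c<m. real (card (B c))"
  shows "(\<Sum>v\<in>V. \<Sum>\<tau>\<in>{..<m} \<rightarrow>\<^sub>E {0..<P}.
      (\<Sum>n\<in>T. box_indicator m P B (x v n) \<tau> - W / real_of_int P ^ m)\<^sup>2)
    \<le> real (card T) * W * (real (card V) + real (card T) * \<beta>)"
proof -
  define \<Theta> where "\<Theta> = ({..<m} \<rightarrow>\<^sub>E {0..<P})"
  define \<mu> where "\<mu> = W / real_of_int P ^ m"
  define t where "t = real (card T)"
  let ?e = "\<lambda>v n \<tau>. box_indicator m P B (x v n) \<tau>"
  have W: "0 \<le> W" by (simp add: W_def prod_nonneg)
  have card\<Theta>: "real (card \<Theta>) = real_of_int P ^ m"
    using P by (simp add: \<Theta>_def card_PiE)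
  have first: "(\<Sum>\<tau>\<in>\<Theta>. ?e v n \<tau>) = W" for v n
    using sum_box_indicator[OF P B] by (simp add: \<Theta>_def W_def)
  have expand: "(\<Sum>n\<in>T. ?e v n \<tau> - \<mu>)\<^sup>2 =
      (\<Sum>n\<in>T. \<Sum>n'\<in>T. ?e v n \<tau> * ?e v n' \<tau>) - 2 * \<mu> * t * (\<Sum>n\<in>T. ?e v n \<tau>) + (t * \<mu>)\<^sup>2" for v \<tau>
  proof -
    have "(\<Sum>n\<in>T. ?e v n \<tau> - \<mu>) = (\<Sum>n\<in>T. ?e v n \<tau>) - t * \<mu>"
      by (simp add: sum_subtractf t_def)
    moreover have "(s - t * \<mu>)\<^sup>2 = s * s - 2 * \<mu> * t * s + (t * \<mu>)\<^sup>2" for s :: real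
      by (simp add: power2_eq_square algebra_simps)
    ultimately show ?thesis by (simp only: sum_product)
  qed
  define Q2 where "Q2 = (\<Sum>v\<in>V. \<Sum>\<tau>\<in>\<Theta>. \<Sum>n\<in>T. \<Sum>n'\<in>T. ?e v n \<tau> * ?e v n' \<tau>)"
  have "(\<Sum>v\<in>V. \<Sum>\<tau>\<in>\<Theta>. \<Sum>n\<in>T. ?e v n \<tau>) = (\<Sum>v\<in>V. \<Sum>n\<in>T. \<Sum>\<tau>\<in>\<Theta>. ?e v n \<tau>)"
    by (intro sum.cong refl sum.swap)
  also have "\<dots> = real (card V) * t * W"
    by (simp add: first t_def)
  finally have linear: "(\<Sum>v\<in>V. \<Sum>\<tau>\<in>\<Theta>. \<Sum>n\<in>T. ?e v n \<tau>) = real (card V) * t * W" .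
  have const: "(\<Sum>v\<in>V. \<Sum>\<tau>\<in>\<Theta>. (t * \<mu>)\<^sup>2) = real (card V) * real_of_int P ^ m * (t * \<mu>)\<^sup>2"
    using card\<Theta> by simp
  have "(\<Sum>v\<in>V. \<Sum>\<tau>\<in>\<Theta>. (\<Sum>n\<in>T. ?e v n \<tau> - \<mu>)\<^sup>2) =
      Q2 - 2 * \<mu> * t * (\<Sum>v\<in>V. \<Sum>\<tau>\<in>\<Theta>. \<Sum>n\<in>T. ?e v n \<tau>) + (\<Sum>v\<in>V. \<Sum>\<tau>\<in>\<Theta>. (t * \<mu>)\<^sup>2)"
    unfolding expand Q2_def by (simp only: sum.distrib sum_subtractf sum_distrib_left)
  then have total: "(\<Sum>v\<in>V. \<Sum>\<tau>\<in>\<Theta>. (\<Sum>n\<in>T. ?e v n \<tau> - \<mu>)\<^sup>2) =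
      Q2 - 2 * \<mu> * t * (real (card V) * t * W) + real (card V) * real_of_int P ^ m * (t * \<mu>)\<^sup>2"
    unfolding linear const .
  have "Q2 = (\<Sum>v\<in>V. \<Sum>n\<in>T. \<Sum>\<tau>\<in>\<Theta>. \<Sum>n'\<in>T. ?e v n \<tau> * ?e v n' \<tau>)"
    unfolding Q2_def by (intro sum.cong refl sum.swap)
  also have "\<dots> = (\<Sum>n\<in>T. \<Sum>v\<in>V. \<Sum>\<tau>\<in>\<Theta>. \<Sum>n'\<in>T. ?e v n \<tau> * ?e v n' \<tau>)"
    by (rule sum.swap)
  also have "\<dots> = (\<Sum>n\<in>T. \<Sum>v\<in>V. \<Sum>n'\<in>T. \<Sum>\<tau>\<in>\<Theta>. ?e v n \<tau> * ?e v n' \<tau>)"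
    by (intro sum.cong refl sum.swap)
  also have "\<dots> = (\<Sum>n\<in>T. \<Sum>n'\<in>T. \<Sum>v\<in>V. \<Sum>\<tau>\<in>\<Theta>. ?e v n \<tau> * ?e v n' \<tau>)"
    by (intro sum.cong refl sum.swap)
  also have "\<dots> \<le> (\<Sum>n\<in>T. \<Sum>n'\<in>T. (if n' = n then real (card V) * W else 0) + (q * W\<^sup>2 + \<beta> * W))"
  proof (intro sum_mono)
    fix n n' assume n: "n \<in> T" "n' \<in> T"
    have nonneg: "0 \<le> q * W\<^sup>2 + \<beta> * W" using q \<beta> W by simp
    show "(\<Sum>v\<in>V. \<Sum>\<tau>\<in>\<Theta>. ?e v n \<tau> * ?e v n' \<tau>) \<le>
        (if n' = n then real (card V) * W else 0) + (q * W\<^sup>2 + \<beta> * W)"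
    proof (cases "n' = n")
      case True
      then show ?thesis using nonneg by (simp add: box_indicator_square first)
    next
      case False
      then have "few_collisions V x m P q \<beta> n n'" using n by (intro coll) auto
      from sum_pair_box_indicator[OF V P B q this]
      show ?thesis using False by (simp add: \<Theta>_def W_def)
    qed
  qed
  also have "\<dots> = t * (real (card V) * W) + t * (t * (q * W\<^sup>2 + \<beta> * W))"
    using T by (simp add: sum.distrib t_def distrib_left)
  finally have Q2: "Q2 \<le> t * (real (card V) * W) + t * (t * (q * W\<^sup>2 + \<beta> * W))" .
  have "real (card V) * \<mu> = q * W" "real (card V) * real_of_int P ^ m * \<mu>\<^sup>2 = q * W\<^sup>2"
    using P by (simp_all add: cardV \<mu>_def power2_eq_square)
  moreover have "t * (real (card V) * W) + t * (t * (q * W\<^sup>2 + \<beta> * W)) - 2 * \<mu> * t * (real (card V) * t * W)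
    + real (card V) * real_of_int P ^ m * (t * \<mu>)\<^sup>2 =
    t * W * (real (card V) + t * \<beta>) + t\<^sup>2 * (q * W\<^sup>2 - 2 * W * (real (card V) * \<mu>)
      + (real (card V) * real_of_int P ^ m * \<mu>\<^sup>2))"
    by (simp add: algebra_simps power2_eq_square)
  ultimately have "t * (real (card V) * W) + t * (t * (q * W\<^sup>2 + \<beta> * W)) - 2 * \<mu> * t * (real (card V) * t * W)
    + real (card V) * real_of_int P ^ m * (t * \<mu>)\<^sup>2 = t * W * (real (card V) + t * \<beta>)"
    by (simp add: power2_eq_square)
  with total Q2 have "(\<Sum>v\<in>V. \<Sum>\<tau>\<in>\<Theta>. (\<Sum>n\<in>T. ?e v n \<tau> - \<mu>)\<^sup>2) \<le> t * W * (real (card V) + t * \<beta>)"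
    by linarith
  then show ?thesis unfolding \<Theta>_def \<mu>_def t_def .
qed

lemma sum_card_fibres:
  assumes "finite A" "finite R" "\<And>a. a \<in> A \<Longrightarrow> f a \<in> R"
  shows "(\<Sum>t\<in>R. real (card {a \<in> A. f a = t})) = real (card A)"
proof -
  have "(\<Sum>t\<in>R. \<Sum>a\<in>{a \<in> A. f a = t}. 1 :: real) = (\<Sum>a\<in>A. 1)"
    using assms by (intro sum.group) auto
  then show ?thesis by simp
qed

text \<open>
  The bound of \<open>second_moment_box\<close> is linear in the volume of the box and in the number of times up to
  the factor \<open>1 + C\<close>, so it adds up over the cells of a level to the volume of the whole space and
  the length of the whole time interval.
\<close>

lemma sum_energy_square:
  fixes x :: "'v \<Rightarrow> nat \<Rightarrow> nat \<Rightarrow> int"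
  assumes V: "finite V" and P: "0 < P"
    and q: "0 \<le> q" and \<beta>: "0 \<le> \<beta>" and cardV: "real (card V) = q * real_of_int P ^ m"
    and coll: "\<And>n n'. n < 2 ^ J \<Longrightarrow> n' < 2 ^ J \<Longrightarrow> n \<noteq> n' \<Longrightarrow> few_collisions V x m P q \<beta> n n'"
    and C: "2 ^ J * \<beta> \<le> C * real (card V)"
  shows "(\<Sum>v\<in>V. \<Sum>\<tau>\<in>{..<m} \<rightarrow>\<^sub>E {0..<P}. (energy J m P (\<lambda>n c. (x v n c - \<tau> c) mod P) i l)\<^sup>2)
    \<le> (1 + C) * 2 ^ J * (real (card V) * real_of_int P ^ m)"
proof -
  define \<Theta> where "\<Theta> = ({..<m} \<rightarrow>\<^sub>E {0..<P})"
  define R where "R = (\<Pi>\<^sub>E c\<in>{..<m}. {0..<2 ^ l c} :: int set)"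
  define Tm where "Tm t = {n \<in> {..<2 ^ J}. cell (2 ^ J) i (int n) = t}" for t
  define Bx where "Bx b c = {u \<in> {0..<P}. cell P (l c) u = b c}" for b :: "nat \<Rightarrow> int" and c
  define W where "W b = (\<Prod>c<m. real (card (Bx b c)))" for b
  have Bx: "Bx b c \<subseteq> {0..<P}" for b c by (auto simp: Bx_def)
  have W: "0 \<le> W b" for b by (simp add: W_def prod_nonneg)
  have deviation: "deviation (2 ^ J) m P (\<lambda>n c. (x v n c - \<tau> c) mod P) (\<lambda>n. of_bool (cell (2 ^ J) i (int n) = t))
        (\<lambda>c u. of_bool (cell P (l c) u = b c)) =
      (\<Sum>n\<in>Tm t. box_indicator m P (Bx b) (x v n) \<tau> - W b / real_of_int P ^ m)" for v \<tau> t b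
  proof -
    have "mean P (\<lambda>u. of_bool (cell P (l c) u = b c)) = real (card (Bx b c)) / real_of_int P" for c
      by (simp only: mean_def sum_of_bool_card[OF finite_atLeastLessThan_int] Bx_def)
    then have means: "(\<Prod>c<m. mean P (\<lambda>u. of_bool (cell P (l c) u = b c))) = W b / real_of_int P ^ m"
      by (simp add: W_def prod_dividef)
    have points: "(\<Prod>c<m. of_bool (cell P (l c) ((x v n c - \<tau> c) mod P) = b c)) =
        box_indicator m P (Bx b) (x v n) \<tau>" for n
      unfolding box_indicator_def using P by (intro prod.cong) (auto simp: Bx_def)
    show ?thesis
      by (simp only: deviation_def Tm_def means points sum_of_bool_mult[OF finite_lessThan])
  qed
  have "(\<Sum>v\<in>V. \<Sum>\<tau>\<in>\<Theta>. (energy J m P (\<lambda>n c. (x v n c - \<tau> c) mod P) i l)\<^sup>2) =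
      (\<Sum>v\<in>V. \<Sum>\<tau>\<in>\<Theta>. \<Sum>t\<in>{0..<2 ^ i}. \<Sum>b\<in>R.
        (\<Sum>n\<in>Tm t. box_indicator m P (Bx b) (x v n) \<tau> - W b / real_of_int P ^ m)\<^sup>2)"
    unfolding energy_def deviation R_def by (simp add: sum_nonneg)
  also have "\<dots> = (\<Sum>t\<in>{0..<2 ^ i}. \<Sum>b\<in>R. \<Sum>v\<in>V. \<Sum>\<tau>\<in>\<Theta>.
        (\<Sum>n\<in>Tm t. box_indicator m P (Bx b) (x v n) \<tau> - W b / real_of_int P ^ m)\<^sup>2)"
    (is "(\<Sum>v\<in>V. \<Sum>\<tau>\<in>\<Theta>. \<Sum>t\<in>?I. \<Sum>b\<in>R. ?h v \<tau> t b) = _")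
  proof -
    have "(\<Sum>v\<in>V. \<Sum>\<tau>\<in>\<Theta>. \<Sum>t\<in>?I. \<Sum>b\<in>R. ?h v \<tau> t b) = (\<Sum>v\<in>V. \<Sum>t\<in>?I. \<Sum>\<tau>\<in>\<Theta>. \<Sum>b\<in>R. ?h v \<tau> t b)"
      by (intro sum.cong refl sum.swap)
    also have "\<dots> = (\<Sum>t\<in>?I. \<Sum>v\<in>V. \<Sum>\<tau>\<in>\<Theta>. \<Sum>b\<in>R. ?h v \<tau> t b)"
      by (rule sum.swap)
    also have "\<dots> = (\<Sum>t\<in>?I. \<Sum>v\<in>V. \<Sum>b\<in>R. \<Sum>\<tau>\<in>\<Theta>. ?h v \<tau> t b)"
      by (intro sum.cong refl sum.swap)
    also have "\<dots> = (\<Sum>t\<in>?I. \<Sum>b\<in>R. \<Sum>v\<in>V. \<Sum>\<tau>\<in>\<Theta>. ?h v \<tau> t b)"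
      by (intro sum.cong refl sum.swap)
    finally show ?thesis .
  qed
  also have "\<dots> \<le> (\<Sum>t\<in>{0..<2 ^ i}. \<Sum>b\<in>R. real (card (Tm t)) * W b * ((1 + C) * real (card V)))"
  proof (intro sum_mono)
    fix t b
    have "card (Tm t) \<le> card {..<(2::nat) ^ J}" by (intro card_mono) (auto simp: Tm_def)
    then have "card (Tm t) \<le> 2 ^ J" by simp
    then have "real (card (Tm t)) \<le> 2 ^ J" by (metis of_nat_le_iff of_nat_numeral of_nat_power)
    then have "real (card (Tm t)) * \<beta> \<le> 2 ^ J * \<beta>" using \<beta> by (rule mult_right_mono)
    then have *: "real (card V) + real (card (Tm t)) * \<beta> \<le> (1 + C) * real (card V)"
      using C by (simp add: algebra_simps)
    have "(\<Sum>v\<in>V. \<Sum>\<tau>\<in>\<Theta>. ?h v \<tau> t b) \<le> real (card (Tm t)) * W b * (real (card V) + real (card (Tm t)) * \<beta>)"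
      unfolding \<Theta>_def W_def
      by (rule second_moment_box[OF V _ P Bx q \<beta> cardV]) (auto simp: Tm_def intro: coll)
    also have "\<dots> \<le> real (card (Tm t)) * W b * ((1 + C) * real (card V))"
      using W by (intro mult_left_mono * ) auto
    finally show "(\<Sum>v\<in>V. \<Sum>\<tau>\<in>\<Theta>. ?h v \<tau> t b) \<le> real (card (Tm t)) * W b * ((1 + C) * real (card V))" .
  qed
  also have "\<dots> = (\<Sum>t\<in>{0..<2 ^ i}. real (card (Tm t))) * (\<Sum>b\<in>R. W b) * ((1 + C) * real (card V))"
    by (simp only: sum_distrib_left sum_distrib_right) (rule sum.swap)
  finally have total: "(\<Sum>v\<in>V. \<Sum>\<tau>\<in>\<Theta>. (energy J m P (\<lambda>n c. (x v n c - \<tau> c) mod P) i l)\<^sup>2) \<le>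
    (\<Sum>t\<in>{0..<2 ^ i}. real (card (Tm t))) * (\<Sum>b\<in>R. W b) * ((1 + C) * real (card V))" .
  have T_sum: "(\<Sum>t\<in>{0..<2 ^ i}. real (card (Tm t))) = 2 ^ J"
  proof -
    have "cell (2 ^ J) i (int n) \<in> {0..<2 ^ i}" if "n \<in> {..<2 ^ J}" for n
    proof -
      have "int n < 2 ^ J" using that by (metis lessThan_iff of_nat_less_iff of_nat_numeral of_nat_power)
      then show ?thesis using cell_range[of "int n" "2 ^ J" i] by simp
    qed
    then show ?thesis unfolding Tm_def by (subst sum_card_fibres) auto
  qed
  have W_sum: "(\<Sum>b\<in>R. W b) = real_of_int P ^ m"
  proof -
    have "(\<Sum>b\<in>R. W b) = (\<Prod>c<m. \<Sum>j\<in>{0..<2 ^ l c}. real (card {u \<in> {0..<P}. cell P (l c) u = j}))"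
      unfolding W_def R_def Bx_def by (subst prod_sum_PiE) auto
    also have "\<dots> = (\<Prod>c<m. real (card {0..<P}))"
      using cell_range by (intro prod.cong sum_card_fibres) auto
    finally show ?thesis using P by simp
  qed
  show ?thesis using total unfolding T_sum W_sum \<Theta>_def by (simp only: mult_ac)
qed

lemma sum_energy:
  fixes x :: "'v \<Rightarrow> nat \<Rightarrow> nat \<Rightarrow> int"
  assumes V: "finite V" and P: "0 < P"
    and q: "0 \<le> q" and \<beta>: "0 \<le> \<beta>" and cardV: "real (card V) = q * real_of_int P ^ m"
    and coll: "\<And>n n'. n < 2 ^ J \<Longrightarrow> n' < 2 ^ J \<Longrightarrow> n \<noteq> n' \<Longrightarrow> few_collisions V x m P q \<beta> n n'"
    and C: "2 ^ J * \<beta> \<le> C * real (card V)"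
  shows "(\<Sum>v\<in>V. \<Sum>\<tau>\<in>{..<m} \<rightarrow>\<^sub>E {0..<P}. energy J m P (\<lambda>n c. (x v n c - \<tau> c) mod P) i l)
    \<le> sqrt ((1 + C) * 2 ^ J) * (real (card V) * real_of_int P ^ m)"
proof -
  define \<Theta> where "\<Theta> = ({..<m} \<rightarrow>\<^sub>E {0..<P})"
  define M where "M = (\<lambda>(v, \<tau>). energy J m P (\<lambda>n c. (x v n c - \<tau> c) mod P) i l)"
  define n where "n = real (card V) * real_of_int P ^ m"
  have n: "0 \<le> n" using P by (simp add: n_def)
  have card: "real (card (V \<times> \<Theta>)) = n"
    using P by (simp add: \<Theta>_def n_def card_cartesian_product card_PiE)
  have prod: "(\<Sum>z\<in>V \<times> \<Theta>. g (M z)) =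
     (\<Sum>v\<in>V. \<Sum>\<tau>\<in>\<Theta>. g (energy J m P (\<lambda>n c. (x v n c - \<tau> c) mod P) i l))" for g :: "real \<Rightarrow> real"
    by (simp add: M_def sum.cartesian_product case_prod_beta)
  have "(\<Sum>z\<in>V \<times> \<Theta>. M z)\<^sup>2 \<le> (\<Sum>z\<in>V \<times> \<Theta>. (M z)\<^sup>2) * real (card (V \<times> \<Theta>))"
    by (rule sum_squared_le_sum_of_squares)
  moreover have "(\<Sum>z\<in>V \<times> \<Theta>. (M z)\<^sup>2) \<le> (1 + C) * 2 ^ J * n"
    unfolding prod[of "\<lambda>z. z\<^sup>2"] unfolding \<Theta>_def n_def by (rule sum_energy_square[OF assms])
  then have "(\<Sum>z\<in>V \<times> \<Theta>. (M z)\<^sup>2) * real (card (V \<times> \<Theta>)) \<le> (1 + C) * 2 ^ J * n * n"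
    unfolding card using n by (rule mult_right_mono)
  ultimately have "(\<Sum>z\<in>V \<times> \<Theta>. M z)\<^sup>2 \<le> (1 + C) * 2 ^ J * n * n" by (rule order_trans)
  then have "(\<Sum>z\<in>V \<times> \<Theta>. M z) \<le> sqrt ((1 + C) * 2 ^ J * n * n)" by (rule real_le_rsqrt)
  also have "\<dots> = sqrt ((1 + C) * 2 ^ J) * n" using n by (simp add: real_sqrt_mult mult.assoc)
  finally show ?thesis unfolding prod[of "\<lambda>z. z"] unfolding \<Theta>_def n_def .
qed

section \<open>Maximal discrepancy of a family of sequences\<close>

definition local_discrepancy_bound ::
  "nat \<Rightarrow> nat \<Rightarrow> int \<Rightarrow> (nat \<Rightarrow> nat \<Rightarrow> int) \<Rightarrow> real \<Rightarrow> bool" where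
  "local_discrepancy_bound m L P x Z \<longleftrightarrow> (\<forall>N\<le>L. \<forall>a b. (\<forall>c<m. 0 \<le> a c \<and> a c \<le> b c \<and> b c \<le> P) \<longrightarrow>
     \<bar>real (card {n. n < N \<and> (\<forall>c<m. x n c \<in> {a c..<b c})})
      - real N * (\<Prod>c<m. real_of_int (b c - a c) / real_of_int P)\<bar> \<le> Z)"

text \<open>
  The majorant \<open>Z v\<close> is the mean of the bound of \<open>box_count_le_energy\<close> over all translations. There are
  \<open>(4 * (J + 2)) ^ m\<close> choices of pieces in space and \<open>J + 1\<close> levels in time, and each energy has mean at
  most \<open>sqrt ((1 + C) * 2 ^ J)\<close>.
\<close>

lemma mean_maximal_discrepancy:
  fixes x :: "'v \<Rightarrow> nat \<Rightarrow> nat \<Rightarrow> int"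
  assumes m: "0 < m" and V: "finite V" and P: "2 ^ J \<le> P"
    and x: "\<And>v n c. v \<in> V \<Longrightarrow> n < 2 ^ J \<Longrightarrow> c < m \<Longrightarrow> x v n c \<in> {0..<P}"
    and q: "0 \<le> q" and \<beta>: "0 \<le> \<beta>" and cardV: "real (card V) = q * real_of_int P ^ m"
    and coll: "\<And>n n'. n < 2 ^ J \<Longrightarrow> n' < 2 ^ J \<Longrightarrow> n \<noteq> n' \<Longrightarrow> few_collisions V x m P q \<beta> n n'"
    and C: "2 ^ J * \<beta> \<le> C * real (card V)" "0 \<le> C"
  shows "\<exists>Z. (\<forall>v\<in>V. local_discrepancy_bound m (2 ^ J) P (x v) (Z v)) \<and>
    (\<Sum>v\<in>V. Z v) \<le> 8 ^ m * (4 + sqrt (1 + C)) * (real J + 1) ^ (m + 1) * sqrt (2 ^ J) * real (card V)"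
proof -
  have P0: "0 < P" using P by (rule less_le_trans[rotated]) simp
  define \<Theta> where "\<Theta> = ({..<m} \<rightarrow>\<^sub>E {0..<P})"
  define K where "K = ({..<m} \<rightarrow>\<^sub>E ({..<4::nat} \<times> {..Suc J}))"
  define En where "En v \<tau> k i = energy J m P (\<lambda>n c. (x v n c - \<tau> c) mod P) i (\<lambda>c. min (snd (k c)) J)"
    for v \<tau> i and k :: "nat \<Rightarrow> nat \<times> nat"
  define Z where "Z v = (\<Sum>\<tau>\<in>\<Theta>. \<Sum>k\<in>K. 4 + (\<Sum>i\<le>J. En v \<tau> k i)) / real_of_int P ^ m" for v
  have card\<Theta>: "real (card \<Theta>) = real_of_int P ^ m"
    using P0 by (simp add: \<Theta>_def card_PiE)
  have "local_discrepancy_bound m (2 ^ J) P (x v) (Z v)" if v: "v \<in> V" for v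
    unfolding local_discrepancy_bound_def
  proof (intro allI impI)
    fix N a b assume N: "N \<le> (2::nat) ^ J" and ab: "\<forall>c<m. 0 \<le> a c \<and> a c \<le> b c \<and> b c \<le> P"
    let ?D = "\<bar>real (card {n. n < N \<and> (\<forall>c<m. x v n c \<in> {a c..<b c})})
      - real N * (\<Prod>c<m. real_of_int (b c - a c) / real_of_int P)\<bar>"
    have "(\<Sum>\<tau>\<in>\<Theta>. ?D) \<le> (\<Sum>\<tau>\<in>\<Theta>. \<Sum>k\<in>K. 4 + (\<Sum>i\<le>J. En v \<tau> k i))"
      unfolding K_def En_def
      using ab by (intro sum_mono box_count_le_energy m N P x v) (auto simp: \<Theta>_def)
    then have "real_of_int P ^ m * ?D \<le> (\<Sum>\<tau>\<in>\<Theta>. \<Sum>k\<in>K. 4 + (\<Sum>i\<le>J. En v \<tau> k i))"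
      by (simp add: card\<Theta>)
    then show "?D \<le> Z v" using P0 by (simp add: Z_def pos_le_divide_eq mult.commute)
  qed
  moreover have "(\<Sum>v\<in>V. Z v) \<le>
      8 ^ m * (4 + sqrt (1 + C)) * (real J + 1) ^ (m + 1) * sqrt (2 ^ J) * real (card V)"
  proof -
    let ?n = "real (card V) * real_of_int P ^ m"
    let ?s = "sqrt ((1 + C) * 2 ^ J)"
    have "(\<Sum>v\<in>V. Z v) * real_of_int P ^ m = (\<Sum>v\<in>V. \<Sum>\<tau>\<in>\<Theta>. \<Sum>k\<in>K. 4 + (\<Sum>i\<le>J. En v \<tau> k i))"
      using P0 by (simp add: Z_def sum_divide_distrib[symmetric])
    also have "\<dots> = (\<Sum>v\<in>V. \<Sum>k\<in>K. \<Sum>\<tau>\<in>\<Theta>. 4 + (\<Sum>i\<le>J. En v \<tau> k i))"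
      by (intro sum.cong refl sum.swap)
    also have "\<dots> = (\<Sum>k\<in>K. \<Sum>v\<in>V. \<Sum>\<tau>\<in>\<Theta>. 4 + (\<Sum>i\<le>J. En v \<tau> k i))"
      by (rule sum.swap)
    also have "\<dots> \<le> (\<Sum>k\<in>K. (4 + (real J + 1) * ?s) * ?n)"
    proof (rule sum_mono)
      fix k
      have "(\<Sum>v\<in>V. \<Sum>\<tau>\<in>\<Theta>. 4 + (\<Sum>i\<le>J. En v \<tau> k i)) = 4 * ?n + (\<Sum>v\<in>V. \<Sum>\<tau>\<in>\<Theta>. \<Sum>i\<le>J. En v \<tau> k i)"
        by (simp add: sum.distrib card\<Theta>)
      moreover have "(\<Sum>v\<in>V. \<Sum>\<tau>\<in>\<Theta>. \<Sum>i\<le>J. En v \<tau> k i) \<le> (real J + 1) * ?s * ?n"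
      proof -
      have "(\<Sum>v\<in>V. \<Sum>\<tau>\<in>\<Theta>. \<Sum>i\<le>J. En v \<tau> k i) = (\<Sum>v\<in>V. \<Sum>i\<le>J. \<Sum>\<tau>\<in>\<Theta>. En v \<tau> k i)"
        by (intro sum.cong refl sum.swap)
      also have "\<dots> = (\<Sum>i\<le>J. \<Sum>v\<in>V. \<Sum>\<tau>\<in>\<Theta>. En v \<tau> k i)"
        by (rule sum.swap)
      also have "\<dots> \<le> (\<Sum>i\<le>J. ?s * ?n)"
        unfolding En_def \<Theta>_def by (intro sum_mono sum_energy[OF V P0 q \<beta> cardV coll C(1)])
      also have "\<dots> = (real J + 1) * ?s * ?n" by simp
      finally show ?thesis .
      qed
      ultimately show "(\<Sum>v\<in>V. \<Sum>\<tau>\<in>\<Theta>. 4 + (\<Sum>i\<le>J. En v \<tau> k i)) \<le> (4 + (real J + 1) * ?s) * ?n"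
        by (simp add: algebra_simps)
    qed
    also have "\<dots> = real (card K) * ((4 + (real J + 1) * ?s) * ?n)" by simp
    finally have "(\<Sum>v\<in>V. Z v) \<le> real (card K) * ((4 + (real J + 1) * ?s) * real (card V))"
      using P0 by (simp add: mult.assoc[symmetric])
    also have cardK: "real (card K) = (4 * (real J + 2)) ^ m"
      by (simp add: K_def card_PiE card_cartesian_product add.commute)
    also have "(4 * (real J + 2)) ^ m * ((4 + (real J + 1) * ?s) * real (card V)) \<le>
       (8 * (real J + 1)) ^ m * (((4 + sqrt (1 + C)) * ((real J + 1) * sqrt (2 ^ J))) * real (card V))"
    proof (rule mult_mono)
      show "(4 * (real J + 2)) ^ m \<le> (8 * (real J + 1)) ^ m"
        by (rule power_mono) auto
      have "1 * 1 \<le> (real J + 1) * sqrt (2 ^ J)" by (intro mult_mono) auto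
      moreover have "?s = sqrt (1 + C) * sqrt (2 ^ J)" by (rule real_sqrt_mult)
      ultimately have "4 + (real J + 1) * ?s \<le> (4 + sqrt (1 + C)) * ((real J + 1) * sqrt (2 ^ J))"
        by (simp add: algebra_simps)
      then show "(4 + (real J + 1) * ?s) * real (card V) \<le>
          ((4 + sqrt (1 + C)) * ((real J + 1) * sqrt (2 ^ J))) * real (card V)"
        by (rule mult_right_mono) simp
    qed (use C(2) in auto)
    also have "\<dots> = 8 ^ m * (4 + sqrt (1 + C)) * (real J + 1) ^ (m + 1) * sqrt (2 ^ J) * real (card V)"
      by (simp only: power_mult_distrib power_add power_one_right mult_ac)
    finally show ?thesis .
  qed
  ultimately show ?thesis by blast
qed

section \<open>Discrepancy of orbits on blocks of consecutive times\<close>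

lemma few_collisions_sym:
  assumes "few_collisions V x m P q \<beta> n n'"
  shows "few_collisions V x m P q \<beta> n' n"
proof -
  obtain Bad where Bad: "Bad \<subseteq> V" "real (card Bad) \<le> \<beta>"
    "\<And>d. real (card {v \<in> V - Bad. \<forall>c<m. [x v n c - x v n' c = d c] (mod P)}) \<le> q"
    using assms unfolding few_collisions_def by blast
  have "[x v n' c - x v n c = d c] (mod P) \<longleftrightarrow> [x v n c - x v n' c = - d c] (mod P)" for v c d
    using cong_minus_minus_iff[of "x v n c - x v n' c" "- d c" P] by simp
  then have "real (card {v \<in> V - Bad. \<forall>c<m. [x v n' c - x v n c = d c] (mod P)}) \<le> q" for d
    using Bad(3)[of "\<lambda>c. - d c"] by (simp only:)
  then show ?thesis unfolding few_collisions_def using Bad(1,2) by blast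
qed

lemma orbit_shift: "orbit p m F v (n + k) = orbit p m (\<lambda>j. F (n + j)) (orbit p m F v n) k"
  by (induction k) auto

definition discrepancy_constant :: "nat \<Rightarrow> nat \<Rightarrow> real" where
  "discrepancy_constant m K = 8 ^ m * (4 + sqrt (1 + real K))"

lemma discrepancy_constant_pos: "0 < discrepancy_constant m K"
  unfolding discrepancy_constant_def by (intro mult_pos_pos add_pos_nonneg) auto

context triangular_iteration
begin

abbreviation "collision_constant \<equiv> m * (2 * m + 2 * sum s {..<m})"

lemma shift: "triangular_iteration p m s (\<lambda>j. F (n + j)) (\<lambda>j. G (n + j)) (\<lambda>j. H (n + j))"
  using p s step[of "n + _"] perm[of "n + _"] by unfold_locales simp_all

text \<open>
  The state at time \<open>n\<close> runs through all states as the initial value does, so the pair of times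
  \<open>n < n'\<close> reduces to the displacement after \<open>n' - n\<close> steps of the shifted sequence of systems.
\<close>

lemma few_collisions_orbit_less:
  assumes "n < n'" "n' < L"
  shows "few_collisions V orb m (int p) (real p) (real (collision_constant * L * p ^ m)) n n'"
proof -
  define k where "k = n' - n"
  interpret sh: triangular_iteration p m s "\<lambda>j. F (n + j)" "\<lambda>j. G (n + j)" "\<lambda>j. H (n + j)"
    by (rule shift)
  have n': "n' = n + k" and k: "0 < k" "k \<le> L" using assms by (auto simp: k_def)
  have orb': "orb v n' = sh.orb (orb v n) k" for v
    unfolding n' by (rule orbit_shift)
  define Bad where "Bad = {v \<in> V. orb v n \<in> sh.unit_multiplier k}"
  have "card Bad = card {w \<in> V. w \<in> sh.unit_multiplier k}"
    unfolding Bad_def by (rule card_orbit_preimage)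
  also have "{w \<in> V. w \<in> sh.unit_multiplier k} = sh.unit_multiplier k"
    by (auto simp: sh.unit_multiplier_def)
  also have "card (sh.unit_multiplier k) \<le> collision_constant * k * p ^ m"
    by (rule sh.card_unit_multiplier[OF k(1)])
  also have "\<dots> \<le> collision_constant * L * p ^ m"
    using k(2) by (intro mult_right_mono mult_left_mono) auto
  finally have bad: "real (card Bad) \<le> real (collision_constant * L * p ^ m)"
    by (simp only: of_nat_le_iff)
  have "card {v \<in> V - Bad. \<forall>c<m. [orb v n c - orb v n' c = d c] (mod int p)} \<le> p" for d
  proof -
    let ?Q = "\<lambda>w. w \<notin> sh.unit_multiplier k \<and> (\<forall>c<m. [sh.orb w k c - w c = - d c] (mod int p))"
    have neg: "[orb v n c - orb v n' c = d c] (mod int p) \<longleftrightarrow>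
        [sh.orb (orb v n) k c - orb v n c = - d c] (mod int p)" for v c
      using cong_minus_minus_iff[of "orb v n c - orb v n' c" "d c" "int p"] by (simp add: orb')
    have "{v \<in> V - Bad. \<forall>c<m. [orb v n c - orb v n' c = d c] (mod int p)} = {v \<in> V. ?Q (orb v n)}"
      unfolding neg by (auto simp: Bad_def)
    then have "card {v \<in> V - Bad. \<forall>c<m. [orb v n c - orb v n' c = d c] (mod int p)} =
        card {v \<in> V. ?Q (orb v n)}" by (rule arg_cong)
    also have "\<dots> = card {w \<in> V. ?Q w}" by (rule card_orbit_preimage)
    also have "{w \<in> V. ?Q w} = {w \<in> V - sh.unit_multiplier k. \<forall>c<m. [sh.orb w k c - w c = - d c] (mod int p)}"
      by auto
    also have "card \<dots> \<le> p" by (rule sh.card_displacement_fibre)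
    finally show ?thesis .
  qed
  then show ?thesis
    unfolding few_collisions_def using bad by (intro exI[of _ Bad]) (auto simp: Bad_def)
qed

lemma few_collisions_orbit:
  assumes "n \<noteq> n'" "n < L" "n' < L"
  shows "few_collisions V orb m (int p) (real p) (real (collision_constant * L * p ^ m)) n n'"
  using assms few_collisions_orbit_less few_collisions_sym by (metis linorder_neqE_nat)

text \<open>
  The assumption on \<open>J\<close> is what makes the exceptional states harmless: there are \<open>O(2 ^ J * p ^ m)\<close> of them
  for each pair of times, and \<open>2 ^ J\<close> times this must be \<open>O(p ^ (m + 1))\<close>.
\<close>

lemma block_discrepancy:
  assumes m: "0 < m" and J: "2 ^ (2 * J) \<le> p"
  shows "\<exists>Z. (\<forall>v\<in>V. local_discrepancy_bound m (2 ^ J) (int p) (orb v) (Z v)) \<and>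
    (\<Sum>v\<in>V. Z v) \<le> discrepancy_constant m collision_constant * (real J + 1) ^ (m + 1) * sqrt (2 ^ J) * real p ^ (m + 1)"
proof -
  have "(2::nat) ^ J \<le> 2 ^ (2 * J)" by (rule power_increasing) auto
  with J have Jp: "2 ^ J \<le> p" by (rule order_trans[rotated])
  then have Jp': "2 ^ J \<le> int p" by (metis of_nat_le_iff of_nat_numeral of_nat_power)
  have "2 ^ J * (collision_constant * 2 ^ J * p ^ m) \<le> collision_constant * p ^ (m + 1)"
  proof -
    have square: "(2::nat) ^ (2 * J) = 2 ^ J * 2 ^ J" by (simp add: mult_2 power_add)
    have "2 ^ J * (collision_constant * 2 ^ J * p ^ m) = collision_constant * (2 ^ (2 * J) * p ^ m)"
      unfolding square by (simp only: mult_ac)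
    also have "\<dots> \<le> collision_constant * (p * p ^ m)"
      using J by (intro mult_left_mono mult_right_mono) auto
    finally show ?thesis by simp
  qed
  then have C: "2 ^ J * real (collision_constant * 2 ^ J * p ^ m) \<le> real collision_constant * real (card V)"
    unfolding card_Fp_vectors by (metis of_nat_le_iff of_nat_mult of_nat_numeral of_nat_power)
  have card_V: "real (card V) = real p * real_of_int (int p) ^ m"
    unfolding card_Fp_vectors by simp
  have range: "orb v n c \<in> {0..<int p}" if "v \<in> V" "c < m" for v n c
    using Fp_vectors_nth[OF orbit_in[OF that(1)], of c n] that(2) by (simp add: Fp_def)
  have "\<exists>Z. (\<forall>v\<in>V. local_discrepancy_bound m (2 ^ J) (int p) (orb v) (Z v)) \<and>
    (\<Sum>v\<in>V. Z v) \<le> 8 ^ m * (4 + sqrt (1 + real collision_constant)) * (real J + 1) ^ (m + 1) * sqrt (2 ^ J) * real (card V)"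
    by (rule mean_maximal_discrepancy[OF m _ Jp' range _ _ card_V few_collisions_orbit C])
       (auto simp del: of_nat_mult of_nat_power of_nat_add of_nat_sum)
  then show ?thesis by (simp only: discrepancy_constant_def card_Fp_vectors of_nat_power)
qed

end

lemma local_discrepancy_bound_nonneg: "local_discrepancy_bound m L P x Z \<Longrightarrow> 0 \<le> P \<Longrightarrow> 0 \<le> Z"
  unfolding local_discrepancy_bound_def
  by (drule spec[of _ 0], drule mp, simp, drule spec[of _ "\<lambda>_. 0"], drule spec[of _ "\<lambda>_. 0"]) simp

text \<open>
  Counts and expected counts are additive in time; a segment that ends inside the first part is
  covered by \<open>Z\<close> alone because \<open>Z'\<close> is nonnegative.
\<close>

lemma local_discrepancy_bound_append:
  assumes P: "0 \<le> P" and 1: "local_discrepancy_bound m L P x Z"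
    and 2: "local_discrepancy_bound m L' P (\<lambda>n. x (L + n)) Z'"
  shows "local_discrepancy_bound m (L + L') P x (Z + Z')"
  unfolding local_discrepancy_bound_def
proof (intro allI impI)
  fix N a b
  assume N: "N \<le> L + L'" and ab: "\<forall>c<m. 0 \<le> a c \<and> a c \<le> b c \<and> b c \<le> P"
  let ?v = "\<Prod>c<m. real_of_int (b c - a c) / real_of_int P"
  let ?B = "\<lambda>y. \<forall>c<m. y c \<in> {a c..<b c}"
  have D1: "\<bar>real (card {n. n < M \<and> ?B (x n)}) - real M * ?v\<bar> \<le> Z" if "M \<le> L" for M
    using 1 ab that unfolding local_discrepancy_bound_def by blast
  have D2: "\<bar>real (card {n. n < M \<and> ?B (x (L + n))}) - real M * ?v\<bar> \<le> Z'" if "M \<le> L'" for M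
    using 2 ab that unfolding local_discrepancy_bound_def by blast
  show "\<bar>real (card {n. n < N \<and> ?B (x n)}) - real N * ?v\<bar> \<le> Z + Z'"
  proof (cases "N \<le> L")
    case True
    with D1[of N] local_discrepancy_bound_nonneg[OF 2 P] show ?thesis by linarith
  next
    case False
    define M where "M = N - L"
    have M: "N = L + M" "M \<le> L'" using False N by (auto simp: M_def)
    have "{n. n < N \<and> ?B (x n)} = {n. n < L \<and> ?B (x n)} \<union> (+) L ` {n. n < M \<and> ?B (x (L + n))}"
    proof (intro equalityI subsetI)
      fix n assume n: "n \<in> {n. n < N \<and> ?B (x n)}"
      show "n \<in> {n. n < L \<and> ?B (x n)} \<union> (+) L ` {n. n < M \<and> ?B (x (L + n))}"
      proof (cases "n < L")
        case False
        then have "n = L + (n - L)" by simp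
        moreover have "n - L \<in> {n. n < M \<and> ?B (x (L + n))}" using n False M by auto
        ultimately show ?thesis by blast
      qed (use n in auto)
    qed (use M in auto)
    then have "card {n. n < N \<and> ?B (x n)} =
        card ({n. n < L \<and> ?B (x n)} \<union> (+) L ` {n. n < M \<and> ?B (x (L + n))})" by (rule arg_cong)
    also have "\<dots> = card {n. n < L \<and> ?B (x n)} + card ((+) L ` {n. n < M \<and> ?B (x (L + n))})"
      by (rule card_Un_disjoint) auto
    also have "card ((+) L ` {n. n < M \<and> ?B (x (L + n))}) = card {n. n < M \<and> ?B (x (L + n))}"
      by (rule card_image) simp
    finally have "real (card {n. n < N \<and> ?B (x n)}) - real N * ?v =
        (real (card {n. n < L \<and> ?B (x n)}) - real L * ?v) +
        (real (card {n. n < M \<and> ?B (x (L + n))}) - real M * ?v)"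
      by (simp add: M(1) distrib_right)
    with D1[of L] D2[OF M(2)] show ?thesis by linarith
  qed
qed

context triangular_iteration
begin

text \<open>
  The blocks are added one at a time. The state at the beginning of a block is uniformly
  distributed, so all blocks contribute the same mean.
\<close>

lemma blocks_discrepancy:
  assumes m: "0 < m" and J: "2 ^ (2 * J) \<le> p"
  shows "\<exists>Z. (\<forall>v\<in>V. local_discrepancy_bound m (B * 2 ^ J) (int p) (orb v) (Z v)) \<and>
    (\<Sum>v\<in>V. Z v) \<le> real B * (discrepancy_constant m collision_constant * (real J + 1) ^ (m + 1) * sqrt (2 ^ J) * real p ^ (m + 1))"
proof (induction B)
  case 0
  have "local_discrepancy_bound m 0 (int p) (orb v) 0" for v
    by (simp add: local_discrepancy_bound_def)
  then show ?case by (intro exI[of _ "\<lambda>_. 0"]) simp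
next
  case (Suc B)
  let ?A = "discrepancy_constant m collision_constant * (real J + 1) ^ (m + 1) * sqrt (2 ^ J) * real p ^ (m + 1)"
  obtain Z where Z: "\<And>v. v \<in> V \<Longrightarrow> local_discrepancy_bound m (B * 2 ^ J) (int p) (orb v) (Z v)"
    "(\<Sum>v\<in>V. Z v) \<le> real B * ?A" using Suc by blast
  define n where "n = B * 2 ^ J"
  interpret sh: triangular_iteration p m s "\<lambda>j. F (n + j)" "\<lambda>j. G (n + j)" "\<lambda>j. H (n + j)"
    by (rule shift)
  obtain Z' where Z': "\<And>w. w \<in> V \<Longrightarrow> local_discrepancy_bound m (2 ^ J) (int p) (sh.orb w) (Z' w)"
    "(\<Sum>w\<in>V. Z' w) \<le> ?A" using sh.block_discrepancy[OF m J] by blast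
  have bound: "local_discrepancy_bound m (Suc B * 2 ^ J) (int p) (orb v) (Z v + Z' (orb v n))" if v: "v \<in> V" for v
  proof -
    have "(\<lambda>k. orb v (n + k)) = sh.orb (orb v n)"
      by (intro ext orbit_shift)
    then have "local_discrepancy_bound m (n + 2 ^ J) (int p) (orb v) (Z v + Z' (orb v n))"
      using Z(1)[OF v] Z'(1)[OF orbit_in[OF v]]
      by (intro local_discrepancy_bound_append) (simp_all add: n_def)
    then show ?thesis by (simp add: n_def add.commute)
  qed
  have total: "(\<Sum>v\<in>V. Z v + Z' (orb v n)) \<le> real (Suc B) * ?A"
  proof -
    have "(\<Sum>v\<in>V. Z' (orb v n)) = (\<Sum>w\<in>V. Z' w)"
      by (rule sum.reindex_bij_betw[OF orbit_bij])
    then have "(\<Sum>v\<in>V. Z v + Z' (orb v n)) \<le> real B * ?A + ?A"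
      unfolding sum.distrib using Z(2) Z'(2) by linarith
    then show ?thesis by (simp only: of_nat_Suc distrib_right mult_1_left add.commute)
  qed
  show ?case
    by (rule exI[of _ "\<lambda>v. Z v + Z' (orb v n)"]) (intro conjI ballI bound total)
qed

end

section \<open>From block bounds to the discrepancy outside a small set\<close>

text \<open>
  A real box contains the same fractions with denominator \<open>p\<close> as the box whose corners are rounded up
  to such fractions; rounding changes every side by at most \<open>1 / p\<close> and the volume by at most \<open>m / p\<close>.
\<close>

lemma discrepancy_le_local:
  assumes p: "0 < p" and N: "0 < N" "N \<le> L" and Z: "local_discrepancy_bound m L (int p) x Z"
  shows "discrepancy m N (\<lambda>n i. real_of_int (x n i) / real p) \<le> Z / real N + real m / real p"
  unfolding discrepancy_def
proof (rule cSUP_least)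
  have "((\<lambda>_. 0), (\<lambda>_. 0)) \<in> {(\<alpha>, \<beta>). \<forall>i<m. 0 \<le> \<alpha> i \<and> \<alpha> i \<le> \<beta> i \<and> \<beta> i \<le> (1::real)}" by simp
  then show "{(\<alpha>, \<beta>). \<forall>i<m. 0 \<le> \<alpha> i \<and> \<alpha> i \<le> \<beta> i \<and> \<beta> i \<le> (1::real)} \<noteq> {}"
    unfolding ex_in_conv[symmetric] by (rule exI)
next
  fix z assume z: "z \<in> {(\<alpha>, \<beta>). \<forall>i<m. 0 \<le> \<alpha> i \<and> \<alpha> i \<le> \<beta> i \<and> \<beta> i \<le> (1::real)}"
  obtain \<alpha> \<beta> where \<alpha>\<beta>: "z = (\<alpha>, \<beta>)" by (cases z)
  have box: "0 \<le> \<alpha> i" "\<alpha> i \<le> \<beta> i" "\<beta> i \<le> 1" if "i < m" for i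
    using z that by (auto simp: \<alpha>\<beta>)
  define a where "a i = \<lceil>real p * \<alpha> i\<rceil>" for i
  define b where "b i = \<lceil>real p * \<beta> i\<rceil>" for i
  have ab: "0 \<le> a i" "a i \<le> b i" "b i \<le> int p" if "i < m" for i
  proof -
    have "0 \<le> real p * \<alpha> i" using box[OF that] by simp
    then show "0 \<le> a i" unfolding a_def using ceiling_mono[of 0 "real p * \<alpha> i"] by simp
    show "a i \<le> b i" unfolding a_def b_def using box[OF that] by (intro ceiling_mono mult_left_mono) auto
    show "b i \<le> int p" unfolding b_def using box[OF that] by (simp add: ceiling_le_iff mult_left_le)
  qed
  have mem: "real_of_int (x n i) / real p \<in> {\<alpha> i..<\<beta> i} \<longleftrightarrow> x n i \<in> {a i..<b i}" for n i
    using p by (simp add: a_def b_def ceiling_le_iff less_ceiling_iff field_simps)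
  let ?v = "\<Prod>i<m. real_of_int (b i - a i) / real p"
  let ?w = "\<Prod>i<m. \<beta> i - \<alpha> i"
  let ?k = "real (card {n. n < N \<and> (\<forall>i<m. x n i \<in> {a i..<b i})})"
  have "\<bar>?k - real N * ?v\<bar> \<le> Z"
    using Z N(2) ab unfolding local_discrepancy_bound_def by auto
  then have "\<bar>?k - real N * ?v\<bar> / real N \<le> Z / real N" by (rule divide_right_mono) simp
  moreover have rescale: "\<bar>?k - real N * ?v\<bar> / real N = \<bar>?k / real N - ?v\<bar>"
  proof -
    have "?k / real N - ?v = (?k - real N * ?v) / real N" using N by (simp add: diff_divide_distrib)
    then show ?thesis by simp
  qed
  ultimately have count: "\<bar>?k / real N - ?v\<bar> \<le> Z / real N" by (simp only:)
  have volume: "\<bar>?v - ?w\<bar> \<le> real m / real p"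
  proof -
    have "norm (?v - ?w) \<le> (\<Sum>i<m. norm (real_of_int (b i - a i) / real p - (\<beta> i - \<alpha> i)))"
    proof (rule norm_prod_diff)
      fix i assume "i \<in> {..<m}"
      then have i: "i < m" by simp
      have "real_of_int (b i - a i) \<le> real p" using ab[OF i] by linarith
      then show "norm (real_of_int (b i - a i) / real p) \<le> 1"
        using ab[OF i] p by (simp add: divide_le_eq)
      show "norm (\<beta> i - \<alpha> i) \<le> 1" using box[OF i] by simp
    qed
    also have "\<dots> \<le> (\<Sum>i<m. 1 / real p)"
    proof (rule sum_mono)
      fix i
      have "\<bar>real_of_int (b i - a i) - real p * (\<beta> i - \<alpha> i)\<bar> \<le> 1"
        unfolding a_def b_def right_diff_distrib by linarith
      moreover have "real_of_int (b i - a i) / real p - (\<beta> i - \<alpha> i) =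
          (real_of_int (b i - a i) - real p * (\<beta> i - \<alpha> i)) / real p"
        using p by (simp add: diff_divide_distrib)
      ultimately show "norm (real_of_int (b i - a i) / real p - (\<beta> i - \<alpha> i)) \<le> 1 / real p"
        using p by (simp add: divide_right_mono)
    qed
    finally show ?thesis by simp
  qed
  have "\<bar>?k / real N - ?w\<bar> \<le> \<bar>?k / real N - ?v\<bar> + \<bar>?v - ?w\<bar>" using abs_triangle_ineq[of "?k / real N - ?v" "?v - ?w"] by (simp only: diff_add_cancel add_diff_eq)
  also have "\<dots> \<le> Z / real N + real m / real p" by (rule add_mono[OF count volume])
  finally have "\<bar>?k / real N - ?w\<bar> \<le> Z / real N + real m / real p" .
  then show "(case z of (\<alpha>, \<beta>) \<Rightarrow>
      \<bar>real (card {n. n < N \<and> (\<forall>i<m. real_of_int (x n i) / real p \<in> {\<alpha> i..<\<beta> i})}) / real N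
        - (\<Prod>i<m. \<beta> i - \<alpha> i)\<bar>) \<le> Z / real N + real m / real p"
    by (simp only: \<alpha>\<beta> case_prod_conv mem)
qed

lemma card_exceeding:
  assumes "finite V" "\<And>v. v \<in> V \<Longrightarrow> 0 \<le> Z v" "(\<Sum>v\<in>V. Z v) \<le> A" "0 < t"
  shows "real (card {v \<in> V. t < Z v}) \<le> A / t"
proof -
  have "t * real (card {v \<in> V. t < Z v}) = (\<Sum>v\<in>{v \<in> V. t < Z v}. t)" by simp
  also have "\<dots> \<le> (\<Sum>v\<in>{v \<in> V. t < Z v}. Z v)" by (rule sum_mono) auto
  also have "\<dots> \<le> (\<Sum>v\<in>V. Z v)" using assms by (intro sum_mono2) auto
  finally show ?thesis using assms by (simp add: pos_le_divide_eq mult.commute)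
qed

text \<open>
  Both cases at once: the effective length of a segment is the minimum of \<open>N\<close> and \<open>p\<^sup>1\<^sup>/\<^sup>(\<^sup>m\<^sup>+\<^sup>1\<^sup>)\<close>.
\<close>

lemma disc_bound_min:
  assumes "0 < p" "0 < N"
  shows "disc_bound m N p =
    1 / sqrt (min (real N) (real p powr (1 / real (m + 1)))) * ln (real N) ^ (m + 1) * ln (real p)"
proof -
  have sq: "y powr (- 1 / 2) = 1 / sqrt y" if "0 < y" for y :: real
  proof -
    have "y powr (- 1 / 2) = y powr (- (1 / 2))" by simp
    also have "\<dots> = 1 / y powr (1 / 2)" using that by (simp add: powr_minus_divide)
    finally show ?thesis using that by (simp add: powr_half_sqrt)
  qed
  have root: "real p powr (- 1 / (2 * real (m + 1))) = (real p powr (1 / real (m + 1))) powr (- 1 / 2)"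
    by (simp add: powr_powr algebra_simps)
  have pos: "0 < real N" "0 < real p powr (1 / real (m + 1))" using assms by simp_all
  show ?thesis
  proof (cases "real N \<le> real p powr (1 / real (m + 1))")
    case True
    then show ?thesis by (simp only: disc_bound_def min_def if_True sq[OF pos(1)])
  next
    case False
    then show ?thesis by (simp only: disc_bound_def min_def if_False root sq[OF pos(2)])
  qed
qed


text \<open>
  For the scale \<open>2 ^ i \<le> N < 2 ^ Suc i\<close> the segment is covered by blocks of length \<open>2 ^ l i\<close> with
  \<open>l i = min (Suc i) g\<close>, where \<open>g\<close> is the largest exponent with \<open>2 ^ (g * (m + 1)) \<le> p\<close>. A state is
  exceptional if at some scale its majorant exceeds the bound for the mean by the factor \<open>ln p / \<epsilon>\<close>. There are at most \<open>(m + 1) * ln p / ln 2\<close> scales, which cancels the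
  \<open>ln p\<close> in Markov's inequality. The rounding error \<open>m / p\<close> is absorbed because every
  factor of the main term other than \<open>1 / sqrt (2 ^ l i)\<close> is bounded below.
\<close>

lemma (in triangular_iteration) exceptional_set:
  assumes m: "0 < m" and \<epsilon>: "0 < \<epsilon>" "\<epsilon> < 1"
  defines "D \<equiv> discrepancy_constant m collision_constant"
  shows "\<exists>E\<subseteq>V. real (card E) \<le> (real (m + 1) / ln 2) * (\<epsilon> * real p ^ (m + 1)) \<and>
    (\<forall>v\<in>V - E. \<forall>N. 2 \<le> N \<longrightarrow> N \<le> p ^ (m + 1) \<longrightarrow>
       discrepancy m N (\<lambda>n i. real_of_int (orb v n i) / real p)
         \<le> (sqrt 2 * (2 * D + real m / ln 2) * (3 / ln 2) ^ (m + 1)) * (1 / \<epsilon> * disc_bound m N p))"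
proof -
  have p2: "2 \<le> p" using p by (rule prime_ge_2_nat)
  have D: "0 < D" unfolding D_def by (rule discrepancy_constant_pos)
  have ln2: "0 < ln (2 :: real)" by simp
  have lnp: "ln 2 \<le> ln (real p)" using p2 by simp
  have lnp0: "0 < ln (real p)" using lnp ln2 by linarith
  \<comment> \<open>The block length \<open>2 ^ g\<close> is comparable to \<open>p\<^sup>1\<^sup>/\<^sup>(\<^sup>m\<^sup>+\<^sup>1\<^sup>)\<close>.\<close>
  define g where "g = Max {l. (2::nat) ^ (l * (m + 1)) \<le> p}"
  have fin: "finite {l. (2::nat) ^ (l * (m + 1)) \<le> p}"
  proof (rule finite_subset)
    show "{l. (2::nat) ^ (l * (m + 1)) \<le> p} \<subseteq> {..p}"
    proof
      fix l assume "l \<in> {l. (2::nat) ^ (l * (m + 1)) \<le> p}"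
      then have le: "(2::nat) ^ (l * (m + 1)) \<le> p" by simp
      have "l \<le> l * (m + 1)" by simp
      also have "\<dots> < 2 ^ (l * (m + 1))" by (rule less_exp)
      finally show "l \<in> {..p}" using le by simp
    qed
  qed simp
  have "0 \<in> {l. (2::nat) ^ (l * (m + 1)) \<le> p}" using p2 by simp
  then have "{l. (2::nat) ^ (l * (m + 1)) \<le> p} \<noteq> {}" by blast
  with fin have "g \<in> {l. (2::nat) ^ (l * (m + 1)) \<le> p}"
    unfolding g_def by (rule Max_in)
  then have g: "(2::nat) ^ (g * (m + 1)) \<le> p" by simp
  have g_max: "p < 2 ^ (Suc g * (m + 1))"
  proof (rule ccontr)
    assume "\<not> p < 2 ^ (Suc g * (m + 1))"
    then have "Suc g \<in> {l. (2::nat) ^ (l * (m + 1)) \<le> p}" by simp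
    then have "Suc g \<le> g" unfolding g_def using fin by (rule Max_ge[rotated])
    then show False by simp
  qed
  define l where "l i = min (Suc i) g" for i
  have l_p: "2 ^ (2 * l i) \<le> p" for i
  proof -
    have "2 * l i \<le> g * (m + 1)"
    proof -
      have "2 * l i \<le> (m + 1) * g" using m by (intro mult_mono) (auto simp: l_def)
      then show ?thesis by (simp add: mult.commute)
    qed
    then have "(2::nat) ^ (2 * l i) \<le> 2 ^ (g * (m + 1))" by (rule power_increasing) simp
    with g show ?thesis by (rule order_trans[rotated])
  qed
  define A where "A i = real (2 ^ (Suc i - l i)) * (D * (real (l i) + 1) ^ (m + 1) * sqrt (2 ^ l i))" for i
  have A: "0 < A i" for i unfolding A_def using D by (intro mult_pos_pos) auto
  have "\<forall>i. \<exists>Z. (\<forall>v\<in>V. local_discrepancy_bound m (2 ^ Suc i) (int p) (orb v) (Z v)) \<and>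
      (\<Sum>v\<in>V. Z v) \<le> A i * real p ^ (m + 1)"
  proof
    fix i
    have "(2::nat) ^ (Suc i - l i) * 2 ^ l i = 2 ^ Suc i"
      unfolding power_add[symmetric] by (simp add: l_def)
    with blocks_discrepancy[OF m l_p[of i], of "2 ^ (Suc i - l i)"]
    show "\<exists>Z. (\<forall>v\<in>V. local_discrepancy_bound m (2 ^ Suc i) (int p) (orb v) (Z v)) \<and>
      (\<Sum>v\<in>V. Z v) \<le> A i * real p ^ (m + 1)"
      unfolding A_def D_def by (simp only: mult.assoc)
  qed
  then obtain Z where Z: "\<forall>i. (\<forall>v\<in>V. local_discrepancy_bound m (2 ^ Suc i) (int p) (orb v) (Z i v)) \<and>
      (\<Sum>v\<in>V. Z i v) \<le> A i * real p ^ (m + 1)"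
    by (rule choice[THEN exE])
  define I where "I = {i. 1 \<le> i \<and> (2::nat) ^ i \<le> p ^ (m + 1)}"
  define X where "X i = {v \<in> V. A i * ln (real p) / \<epsilon> < Z i v}" for i
  define E where "E = (\<Union>i\<in>I. X i)"
  have I_le: "real i \<le> real (m + 1) * ln (real p) / ln 2" if "i \<in> I" for i
  proof -
    have "real (2 ^ i) \<le> real (p ^ (m + 1))" using that unfolding I_def by (simp only: of_nat_le_iff mem_Collect_eq)
    then have "(2::real) ^ i \<le> real p ^ (m + 1)" by simp
    then have "ln ((2::real) ^ i) \<le> ln (real p ^ (m + 1))" using p2 by (subst ln_le_cancel_iff) auto
    then have "real i * ln 2 \<le> real (m + 1) * ln (real p)" using p2 by (simp only: ln_realpow)
    then show ?thesis using ln2 by (simp add: pos_le_divide_eq)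
  qed
  have I_sub: "I \<subseteq> {1..nat \<lfloor>real (m + 1) * ln (real p) / ln 2\<rfloor>}"
    using I_le by (auto simp: I_def le_nat_floor)
  have cardI: "real (card I) \<le> real (m + 1) * ln (real p) / ln 2"
  proof -
    have "card I \<le> nat \<lfloor>real (m + 1) * ln (real p) / ln 2\<rfloor>"
      using card_mono[OF _ I_sub] by simp
    moreover have "0 \<le> real (m + 1) * ln (real p) / ln 2"
      using lnp0 ln2 by (intro divide_nonneg_nonneg mult_nonneg_nonneg) auto
    ultimately show ?thesis by linarith
  qed
  have finI: "finite I" using I_sub by (rule finite_subset) simp
  have cardX: "real (card (X i)) \<le> \<epsilon> * real p ^ (m + 1) / ln (real p)" for i
  proof -
    have "real (card (X i)) \<le> (A i * real p ^ (m + 1)) / (A i * ln (real p) / \<epsilon>)"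
      unfolding X_def
    proof (rule card_exceeding)
      show "0 \<le> Z i v" if "v \<in> V" for v
        using Z that by (intro local_discrepancy_bound_nonneg[of m "2 ^ Suc i" "int p" "orb v"]) auto
      show "0 < A i * ln (real p) / \<epsilon>" using A[of i] lnp0 \<epsilon> by (intro divide_pos_pos mult_pos_pos) auto
      show "(\<Sum>v\<in>V. Z i v) \<le> A i * real p ^ (m + 1)" using Z by blast
    qed simp
    also have "\<dots> = \<epsilon> * real p ^ (m + 1) / ln (real p)"
      using A[of i] \<epsilon> by (simp add: field_simps)
    finally show ?thesis .
  qed
  have cardE: "real (card E) \<le> (real (m + 1) / ln 2) * (\<epsilon> * real p ^ (m + 1))"
  proof -
    have "card E \<le> (\<Sum>i\<in>I. card (X i))" unfolding E_def using finI by (rule card_UN_le)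
    then have "real (card E) \<le> real (\<Sum>i\<in>I. card (X i))" by (simp only: of_nat_le_iff)
    also have "\<dots> = (\<Sum>i\<in>I. real (card (X i)))" by simp
    also have "\<dots> \<le> (\<Sum>i\<in>I. \<epsilon> * real p ^ (m + 1) / ln (real p))" by (intro sum_mono cardX)
    also have "\<dots> = real (card I) * (\<epsilon> * real p ^ (m + 1) / ln (real p))" by simp
    also have "\<dots> \<le> (real (m + 1) * ln (real p) / ln 2) * (\<epsilon> * real p ^ (m + 1) / ln (real p))"
      using \<epsilon> lnp0 by (intro mult_right_mono cardI) auto
    also have "\<dots> = (real (m + 1) / ln 2) * (\<epsilon> * real p ^ (m + 1))"
    proof -
      have "ln (real p) \<noteq> 0" using lnp ln2 by linarith
      then show ?thesis by simp
    qed
    finally show ?thesis .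
  qed
  have main: "discrepancy m N (\<lambda>n i. real_of_int (orb v n i) / real p)
      \<le> (sqrt 2 * (2 * D + real m / ln 2) * (3 / ln 2) ^ (m + 1)) * (1 / \<epsilon> * disc_bound m N p)"
    if v: "v \<in> V - E" and N: "2 \<le> N" "N \<le> p ^ (m + 1)" for v N
  proof -
    obtain i where i: "(2::nat) ^ i \<le> N" "N < 2 ^ Suc i"
      using ex_power_ivl1[of 2 N] N(1) by auto
    have "i \<noteq> 0" using i(2) N(1) by (cases i) auto
    then have i1: "1 \<le> i" by simp
    have "i \<in> I" using i1 i(1) N(2) by (auto simp: I_def)
    then have "v \<notin> X i" using v by (auto simp: E_def)
    then have Zv: "Z i v \<le> A i * ln (real p) / \<epsilon>" using v by (simp add: X_def not_less)
    have "local_discrepancy_bound m (2 ^ Suc i) (int p) (orb v) (Z i v)" using Z v by blast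
    then have disc: "discrepancy m N (\<lambda>n i. real_of_int (orb v n i) / real p) \<le> Z i v / real N + real m / real p"
      using i(2) N(1) p2 by (intro discrepancy_le_local) auto
    \<comment> \<open>\<open>\<Lambda>\<close> dominates the number \<open>l i + 1\<close> of levels: \<open>l i + 1 \<le> i + 2 \<le> 3 * i\<close> and \<open>i \<le> log 2 N\<close>.\<close>
    define r where "r = sqrt (2 ^ l i)"
    have r: "1 \<le> r" "r * r = 2 ^ l i" by (simp_all add: r_def)
    define \<Lambda> where "\<Lambda> = 3 / ln 2 * ln (real N)"
    have Ni: "2 ^ i \<le> real N" using i(1) by (metis of_nat_le_iff of_nat_numeral of_nat_power)
    have "ln ((2::real) ^ i) \<le> ln (real N)" using Ni N(1) by (subst ln_le_cancel_iff) auto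
    then have "real i * ln 2 \<le> ln (real N)" by (simp add: ln_realpow)
    then have "real i \<le> ln (real N) / ln 2" using ln2 by (simp add: pos_le_divide_eq)
    moreover have "real (l i) + 1 \<le> 3 * real i" using i1 by (simp add: l_def min_def)
    ultimately have \<Lambda>: "real (l i) + 1 \<le> \<Lambda>" by (simp add: \<Lambda>_def)
    have \<Lambda>1: "1 \<le> \<Lambda>" using \<Lambda> by linarith
    define Q where "Q = \<Lambda> ^ (m + 1) * ln (real p) / \<epsilon> / r"
    have first: "Z i v / real N \<le> 2 * D * Q"
    proof -
      have A_le: "A i / real N \<le> 2 * D * \<Lambda> ^ (m + 1) / r"
      proof -
        have "(2::real) ^ (Suc i - l i) * 2 ^ l i = 2 ^ Suc i"
          unfolding power_add[symmetric] by (simp add: l_def)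
        then have pow: "(2::real) ^ (Suc i - l i) * (r * r) = 2 * 2 ^ i" by (simp add: r)
        have "A i * r = (2 ^ (Suc i - l i) * (r * r)) * (D * (real (l i) + 1) ^ (m + 1))"
          unfolding A_def r_def[symmetric] by (simp only: of_nat_power of_nat_numeral mult_ac)
        also have "\<dots> = 2 * 2 ^ i * (D * (real (l i) + 1) ^ (m + 1))" unfolding pow ..
        also have "\<dots> \<le> 2 * real N * (D * \<Lambda> ^ (m + 1))"
          using D \<Lambda> Ni by (intro mult_mono power_mono) auto
        finally have "A i * r \<le> 2 * D * \<Lambda> ^ (m + 1) * real N" by (simp only: mult_ac)
        then show ?thesis using r N(1) by (simp add: divide_le_eq le_divide_eq mult.commute)
      qed
      have "Z i v / real N \<le> (A i * ln (real p) / \<epsilon>) / real N" using Zv by (rule divide_right_mono) simp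
      also have "\<dots> = (A i / real N) * (ln (real p) / \<epsilon>)" by simp
      also have "\<dots> \<le> (2 * D * \<Lambda> ^ (m + 1) / r) * (ln (real p) / \<epsilon>)"
        using lnp0 \<epsilon> by (intro mult_right_mono A_le) auto
      also have "\<dots> = 2 * D * Q" by (simp add: Q_def mult_ac)
      finally show ?thesis .
    qed
    have second: "real m / real p \<le> real m / ln 2 * Q"
    proof -
      have "r \<le> r * r" using r(1) by simp
      also have "\<dots> \<le> 2 ^ (2 * l i)" unfolding r(2) by (rule power_increasing) auto
      also have "\<dots> \<le> real p" using l_p[of i] by (metis of_nat_le_iff of_nat_numeral of_nat_power)
      finally have rp: "1 / real p \<le> 1 / r" using r(1) by (simp add: frac_le)
      define R where "R = \<Lambda> ^ (m + 1) * (ln (real p) / ln 2)"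
      have "1 * 1 \<le> R" unfolding R_def
        using \<Lambda>1 lnp ln2 by (intro mult_mono one_le_power) (auto simp: le_divide_eq)
      moreover have "1 \<le> 1 / \<epsilon>" using \<epsilon> by simp
      ultimately have "1 * 1 \<le> R * (1 / \<epsilon>)"
        by (intro mult_mono) auto
      then have "1 / real p * 1 \<le> 1 / r * (R * (1 / \<epsilon>))"
        using rp r(1) by (intro mult_mono) auto
      then have "1 / real p \<le> Q / ln 2" by (simp add: Q_def R_def mult.commute mult.left_commute)
      then have "real m * (1 / real p) \<le> real m * (Q / ln 2)" by (rule mult_left_mono) simp
      then show ?thesis by simp
    qed
    define Y where "Y = min (real N) (real p powr (1 / real (m + 1)))"
    have Y0: "0 < Y" using N(1) p2 by (simp add: Y_def)
    \<comment> \<open>The block length is the effective length up to a factor 2, by the maximality of \<open>g\<close>.\<close>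
    have Y: "Y \<le> 2 * 2 ^ l i"
    proof (cases "Suc i \<le> g")
      case True
      have "real N \<le> 2 ^ Suc i" using i(2) by (metis less_imp_le of_nat_le_iff of_nat_numeral of_nat_power)
      then show ?thesis using True by (simp add: Y_def l_def min_def)
    next
      case False
      have "real p \<le> (2 ^ Suc g) ^ (m + 1)"
        using g_max unfolding power_mult by (metis less_imp_le of_nat_le_iff of_nat_numeral of_nat_power)
      then have "real p powr (1 / real (m + 1)) \<le> ((2 ^ Suc g) ^ (m + 1)) powr (1 / real (m + 1))"
        by (intro powr_mono2) auto
      also have "\<dots> = 2 ^ Suc g"
        by (subst powr_realpow[symmetric]) (simp_all add: powr_powr)
      finally show ?thesis using False by (simp add: Y_def l_def min_def)
    qed
    have "sqrt Y \<le> sqrt (2 * 2 ^ l i)" using Y by (rule real_sqrt_le_mono)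
    also have "\<dots> = sqrt 2 * r" by (simp add: r_def real_sqrt_mult)
    finally have Yr: "1 / r \<le> sqrt 2 / sqrt Y" using Y0 r(1) by (simp add: field_simps)
    have Q_le: "Q \<le> sqrt 2 * (3 / ln 2) ^ (m + 1) * (1 / \<epsilon> * disc_bound m N p)"
    proof -
      have "Q = (\<Lambda> ^ (m + 1) * ln (real p) / \<epsilon>) * (1 / r)" by (simp add: Q_def)
      also have "\<dots> \<le> (\<Lambda> ^ (m + 1) * ln (real p) / \<epsilon>) * (sqrt 2 / sqrt Y)"
        using \<Lambda>1 lnp0 \<epsilon> by (intro mult_left_mono Yr) auto
      also have "\<dots> = sqrt 2 * (3 / ln 2) ^ (m + 1) * (1 / \<epsilon> * disc_bound m N p)"
        using p2 N(1) unfolding \<Lambda>_def Y_def power_mult_distrib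
        by (subst disc_bound_min) (simp_all add: mult_ac)
      finally show ?thesis .
    qed
    have "discrepancy m N (\<lambda>n i. real_of_int (orb v n i) / real p) \<le> (2 * D + real m / ln 2) * Q"
      unfolding distrib_right using disc first second by linarith
    also have "\<dots> \<le> (2 * D + real m / ln 2) * (sqrt 2 * (3 / ln 2) ^ (m + 1) * (1 / \<epsilon> * disc_bound m N p))"
      using D ln2 by (intro mult_left_mono Q_le) auto
    finally show ?thesis by (simp only: mult_ac)
  qed
  have "E \<subseteq> V" by (auto simp: E_def X_def)
  then show ?thesis
    by (intro exI[of _ E] conjI ballI allI impI cardE main)
qed

theorem corollary9:
  fixes m :: nat and S :: "nat mat"
  assumes "m \<ge> 1"
    and "S \<in> carrier_mat (m + 1) (m + 1)"
    and "upper_triangular S"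
    and "\<forall>i\<le>m. S $$ (i, i) = 1"
    and "(\<Prod>i<m. S $$ (i, i + 1)) \<noteq> 0"
  shows "\<exists>c1 c2 :: real. c1 > 0 \<and> c2 > 0 \<and>
    (\<forall>(p::nat) (\<epsilon>::real) (F :: nat \<Rightarrow> nat \<Rightarrow> int_mpoly).
       prime p \<longrightarrow> 0 < \<epsilon> \<longrightarrow> \<epsilon> < 1 \<longrightarrow>
       (\<forall>k\<ge>1. F k \<in> poly_systems p S m \<and> permutation_system p m (F k)) \<longrightarrow>
       (\<exists>E \<subseteq> Fp_vectors p m.
          real (card E) \<le> c1 * (\<epsilon> * real p ^ (m + 1)) \<and>
          (\<forall>v \<in> Fp_vectors p m - E. \<forall>N. 2 \<le> N \<longrightarrow> N \<le> p ^ (m + 1) \<longrightarrow>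
             discrepancy m N (\<lambda>n i. real_of_int (orbit p m F v n i) / real p)
               \<le> c2 * (1 / \<epsilon> * disc_bound m N p))))"
proof -
  define s where "s i = S $$ (i, Suc i)" for i
  have s: "0 < s i" if "i < m" for i
    using assms(5) that by (simp add: s_def)
  have m: "0 < m" using assms(1) by simp
  define D where "D = discrepancy_constant m (m * (2 * m + 2 * sum s {..<m}))"
  define c2 where "c2 = sqrt 2 * (2 * D + real m / ln 2) * (3 / ln 2) ^ (m + 1)"
  have c1: "0 < real (m + 1) / ln 2" by simp
  have "0 < D" unfolding D_def by (rule discrepancy_constant_pos)
  then have c2: "0 < c2" unfolding c2_def by (intro mult_pos_pos add_pos_nonneg) auto
  have "\<exists>E\<subseteq>Fp_vectors p m. real (card E) \<le> (real (m + 1) / ln 2) * (\<epsilon> * real p ^ (m + 1)) \<and>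
      (\<forall>v\<in>Fp_vectors p m - E. \<forall>N. 2 \<le> N \<longrightarrow> N \<le> p ^ (m + 1) \<longrightarrow>
         discrepancy m N (\<lambda>n i. real_of_int (orbit p m F v n i) / real p) \<le> c2 * (1 / \<epsilon> * disc_bound m N p))"
    if p: "prime p" and \<epsilon>: "0 < \<epsilon>" "\<epsilon> < 1"
      and F: "\<forall>k\<ge>1. F k \<in> poly_systems p S m \<and> permutation_system p m (F k)"
    for p :: nat and \<epsilon> :: real and F :: "nat \<Rightarrow> nat \<Rightarrow> int_mpoly"
  proof -
    have "\<forall>k. \<exists>G H. triangular_step p m s (system_map p m (F (Suc k))) G H"
    proof
      fix k
      have "F (Suc k) \<in> poly_systems p S m" using F by simp
      from poly_systems_triangular_step[OF p this]
      show "\<exists>G H. triangular_step p m s (system_map p m (F (Suc k))) G H"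
        unfolding s_def .
    qed
    then obtain G where "\<forall>k. \<exists>H. triangular_step p m s (system_map p m (F (Suc k))) (G k) H"
      by (rule choice[THEN exE])
    then obtain H where GH: "\<forall>k. triangular_step p m s (system_map p m (F (Suc k))) (G k) (H k)"
      by (rule choice[THEN exE])
    have "triangular_iteration p m s F (\<lambda>k. G (k - 1)) (\<lambda>k. H (k - 1))"
      using p s F GH by unfold_locales simp_all
    from triangular_iteration.exceptional_set[OF this m \<epsilon>]
    show ?thesis unfolding c2_def D_def .
  qed
  then show ?thesis
    by (intro exI[of _ "real (m + 1) / ln 2"] exI[of _ c2] conjI c1 c2 allI impI)
qed

end
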